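(* Let $\alpha>0$ and let $\hat M_N$ be the random $N\times N$ symmetric tridiagonal matrix with diagonal entries $a_1,\dots,a_N$ and off-diagonal entries $b_1,\dots,b_{N-1}$ (i.e. $(\hat M_N)_{ii}=a_i$, $(\hat M_N)_{i,i+1}=(\hat M_N)_{i+1,i}=b_i$, all other entries $0$), where all $a_i,b_i$ are independent, $a_i\sim\mathcal{N}(0,\alpha)$, $b_i\ge0$ and $b_i^2\sim \frac{\alpha}{2}\chi^2(2i/\alpha)$. Let $2\theta_N=2+N^{-2/3}\sigma_N$ where $(\sigma_N)$ is a sequence of positive reals with $(\log\log N)^2/\sigma_N\to0$ and $\sigma_N/(\log N)^2\to0$. Let $\mathcal{D}_N=\det(\hat M_N/\sqrt N-2\theta_N I_N)$. Then \[ \frac{\log|\mathcal{D}_N|-N/2+\frac{\alpha-1}{6}\log N-\sigma_N N^{1/3}+\frac23\sigma_N^{3/2}}{\sqrt{\alpha\log\frac{\theta_N+\sqrt{\theta_N^2-1}}{2\sqrt{\theta_N^2-1}}}}\xrightarrow{d}\mathcal{N}(0,1). \]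
   Context: For $d>0$, $\chi^2(d)$ denotes the distribution with density $\frac{1}{2^{d/2}\Gamma(d/2)}x^{d/2-1}e^{-x/2}\mathbf 1_{x>0}$. The matrix $\hat M_N$ is the tridiagonal model of the Gaussian $\beta$-ensemble with $\beta=1/\alpha$ (for $\alpha=1$ and $\alpha=2$ its eigenvalues have the same joint law as those of GUE and GOE respectively). *)

theory Defs
  imports "HOL-Probability.Probability" "Jordan_Normal_Form.Determinant"
begin

definition chi2_density :: "real \<Rightarrow> real \<Rightarrow> real" where
  "chi2_density d x = (if x > 0 then
     x powr (d/2 - 1) * exp (- x / 2) / (2 powr (d/2) * Gamma (d/2)) else 0)"

text \<open>The N x N symmetric tridiagonal matrix with diagonal a_1..a_N and
  off-diagonal b_1..b_(N-1) (row/column indices are 0-based in the library,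
  so entry (i,i) is a_(i+1) and entry (i,i+1) is b_(i+1)).\<close>
definition tridiag :: "nat \<Rightarrow> (nat \<Rightarrow> real) \<Rightarrow> (nat \<Rightarrow> real) \<Rightarrow> real mat" where
  "tridiag N a b = mat N N (\<lambda>(i, j).
     if i = j then a (i + 1)
     else if j = i + 1 then b (i + 1)
     else if i = j + 1 then b (j + 1)
     else 0)"

end

theory Submission
  imports Defs "HOL-Real_Asymp.Real_Asymp"
begin

text \<open>
  Write the leading principal minors of \<open>x - T\<close>, with \<open>T\<close> the unscaled matrix and
  \<open>x = 2 \<theta> sqrt N\<close>, as products of the ratios \<open>Y k\<close>, which satisfy the random Riccati recursion
  \<open>Y (k+1) = x - A (k+1) - (k + 1 + B (k+1)) / Y k\<close> with centred noise. The frozen noiseless map has the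
  fixed points \<open>\<rho>\<close> (attracting) and \<open>r\<close> (repelling), and it satisfies
  \<open>Y (k+1) - r = \<rho> (Y k - r) / Y k\<close>. With the noise put back this gives an exact telescoping identity
  \<open>ln (Y k) = ln \<rho> + ln (Y k - r) - ln (Y (k+1) - r) + ln (1 - \<eta> k)\<close>, in which \<open>\<eta> k\<close> is a martingale
  difference of conditional variance about \<open>2 \<alpha> / D^2\<close>, where \<open>D = \<rho> - r\<close>. Hence the logarithm of the
  determinant is a deterministic sum, minus a sum of independent variables \<open>\<zeta> k\<close> to which Lyapunov's
  theorem applies, plus an error bounded in probability. The slow variation of \<open>r\<close> and the quadratic
  term \<open>\<eta>^2 / 2\<close> produce the two parts of the \<open>(\<alpha> - 1) / 6 * ln N\<close> correction.

  The relative deviation \<open>u k\<close> of \<open>Y k\<close> from \<open>\<rho>\<close> is controlled by one Lyapunov function, its fourth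
  moment before the exit time from \<open>|u| \<le> 1/4\<close>: each step contracts it by \<open>1 - D / (4 x)\<close> and adds
  \<open>O(x / D^5)\<close>, and \<open>\<Sum> x / D^5 = O(x / D_n^3) = O(\<sigma> powr (-3/2))\<close> is what makes the exit
  probability vanish.
\<close>

section \<open>Determinants of tridiagonal matrices\<close>

text \<open>In the application \<open>n = N - 1\<close>, \<open>x\<close> is about
  \<open>2 * sqrt N\<close>, and \<open>(D k)^2\<close> drops by 4 per step, down to order
  \<open>\<sigma> * N powr (1/3)\<close>. So the sum of \<open>1 / D^2\<close> is logarithmic, near
  \<open>L / 2\<close> with \<open>L\<close> close to \<open>ln N / 3\<close>, while higher powers
  of \<open>1 / D\<close> have bounded sums. The \<open>D^-2\<close> terms must be evaluated up to
  O(1); everything else need only be bounded, as the normalisation has order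
  \<open>sqrt (ln N)\<close>. A second moment would not control the exit time: each step injects
  variance of order \<open>1 / D^2\<close>, and the total diverges. In the fourth moment the fresh
  noise comes multiplied by \<open>u^2\<close>, which the contraction rate \<open>D / x\<close>
  holds near \<open>x / D^3\<close>; this is the origin of \<open>x / D^5\<close>.
  \<open>\<eta>\<close> depends on the past; \<open>\<zeta>\<close> is its value at zero deviation,
  and passing from one to the other costs a martingale of bounded variance. The upper bound on
  \<open>\<sigma>\<close> gives \<open>ln \<sigma> = O(ln (ln N))\<close>, so that \<open>L\<close>
  is \<open>ln N / 3\<close> up to an error negligible against \<open>sqrt (ln N)\<close>, and it
  keeps the fourth order term of the edge expansion bounded.\<close>

lemma tridiag_carrier: "tridiag n a b \<in> carrier_mat n n"
  by (simp add: tridiag_def)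

text \<open>Laplace expansion along the last row leaves two terms. The minor of the off-diagonal one
  has \<open>b (n + 1)\<close> as the only nonzero entry of its last column, so a second expansion
  brings it down to size \<open>n\<close>.\<close>

lemma det_tridiag_Suc_Suc:
  "det (tridiag (Suc (Suc n)) a b) =
     a (n + 2) * det (tridiag (Suc n) a b) - (b (n + 1))\<^sup>2 * det (tridiag n a b)"
proof -
  let ?A = "tridiag (Suc (Suc n)) a b"
  let ?C = "mat_delete ?A (Suc n) n"
  have A: "?A \<in> carrier_mat (Suc (Suc n)) (Suc (Suc n))" by (rule tridiag_carrier)
  have C: "?C \<in> carrier_mat (Suc n) (Suc n)"
    using mat_delete_carrier[OF A] by simp
  have z: "?A $$ (Suc n, j) = 0" if "j < n" for j
    using that by (simp add: tridiag_def)
  have "det ?A = (\<Sum>j<Suc (Suc n). ?A $$ (Suc n, j) * cofactor ?A (Suc n) j)"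
    by (rule laplace_expansion_row[OF A]) simp
  also have "\<dots> = ?A $$ (Suc n, n) * cofactor ?A (Suc n) n
      + ?A $$ (Suc n, Suc n) * cofactor ?A (Suc n) (Suc n)"
    by (simp add: z)
  finally have 1: "det ?A = b (n+1) * cofactor ?A (Suc n) n + a (n+2) * cofactor ?A (Suc n) (Suc n)"
    by (simp add: tridiag_def)
  have "mat_delete ?A (Suc n) (Suc n) = tridiag (Suc n) a b"
    by (rule eq_matI) (auto simp: mat_delete_def tridiag_def)
  then have 2: "cofactor ?A (Suc n) (Suc n) = det (tridiag (Suc n) a b)"
    by (simp add: cofactor_def)
  have z': "?C $$ (i, n) = 0" if "i < n" for i
    using that by (simp add: mat_delete_def tridiag_def)
  have "det ?C = (\<Sum>i<Suc n. ?C $$ (i, n) * cofactor ?C i n)"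
    by (rule laplace_expansion_column[OF C]) simp
  also have "\<dots> = ?C $$ (n, n) * cofactor ?C n n"
    by (simp add: z')
  also have "?C $$ (n, n) = b (n + 1)"
    by (simp add: mat_delete_def tridiag_def)
  also have "mat_delete ?C n n = tridiag n a b"
    by (rule eq_matI) (auto simp: mat_delete_def tridiag_def)
  then have "cofactor ?C n n = det (tridiag n a b)" by (simp add: cofactor_def)
  finally have 3: "cofactor ?A (Suc n) n = - b (n+1) * det (tridiag n a b)"
    by (simp add: cofactor_def)
  show ?thesis unfolding 1 2 3 by (simp add: power2_eq_square)
qed

lemma det_tridiag_0: "det (tridiag 0 a b) = 1"
  by (rule det_dim_zero[OF tridiag_carrier])

lemma det_tridiag_1: "det (tridiag (Suc 0) a b) = a 1"
  by (simp add: det_single tridiag_def)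

lemma measurable_det_tridiag [measurable]:
  assumes [measurable]: "\<And>i. i \<ge> 1 \<Longrightarrow> a i \<in> borel_measurable M" "\<And>i. i \<ge> 1 \<Longrightarrow> b i \<in> borel_measurable M"
  shows "(\<lambda>\<omega>. det (tridiag n (\<lambda>i. a i \<omega>) (\<lambda>i. b i \<omega>))) \<in> borel_measurable M"
proof (induction n rule: less_induct)
  case (less n)
  consider "n = 0" | "n = Suc 0" | m where "n = Suc (Suc m)"
    by (metis not0_implies_Suc)
  then show ?case
  proof cases
    case 3
    have [measurable]: "(\<lambda>\<omega>. det (tridiag m (\<lambda>i. a i \<omega>) (\<lambda>i. b i \<omega>))) \<in> borel_measurable M"
      "(\<lambda>\<omega>. det (tridiag (Suc m) (\<lambda>i. a i \<omega>) (\<lambda>i. b i \<omega>))) \<in> borel_measurable M"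
      "a (m + 2) \<in> borel_measurable M" "b (m + 1) \<in> borel_measurable M"
      using less.IH 3 assms by auto
    show ?thesis unfolding 3 det_tridiag_Suc_Suc by measurable
  qed (simp_all add: det_tridiag_0 det_tridiag_1 assms)
qed

lemma det_scaled_tridiag:
  "det (smult_mat (1 / sqrt (real N)) (tridiag N a b) - smult_mat t (1\<^sub>m N))
    = det (tridiag N (\<lambda>i. a i - t * sqrt (real N)) b) / sqrt (real N) ^ N"
proof -
  \<comment> \<open>For \<open>N = 0\<close> the scalar \<open>1 / sqrt 0\<close> is 0 by
    convention, but the matrices are empty and the identity still holds.\<close>
  have "smult_mat (1 / sqrt (real N)) (tridiag N a b) - smult_mat t (1\<^sub>m N)
     = smult_mat (1 / sqrt (real N)) (tridiag N (\<lambda>i. a i - t * sqrt (real N)) b)"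
    by (cases "N = 0"; intro eq_matI) (auto simp: tridiag_def field_simps)
  then show ?thesis
    by (simp add: det_smult tridiag_def power_divide)
qed

section \<open>Moments of the entries\<close>

lemma (in prob_space) normal_moments:
  assumes "\<alpha> > 0" "distributed M lborel X (normal_density 0 (sqrt \<alpha>))"
  shows "integrable M (\<lambda>\<omega>. X \<omega> ^ k)" "expectation X = 0"
    "expectation (\<lambda>\<omega>. X \<omega> ^ 2) = \<alpha>" "expectation (\<lambda>\<omega>. X \<omega> ^ 4) = 3 * \<alpha>\<^sup>2"
proof -
  have s: "sqrt \<alpha> > 0" using assms by simp
  have D: "distributed M lborel X (\<lambda>x. ennreal (normal_density 0 (sqrt \<alpha>) x))" using assms by simp
  show "integrable M (\<lambda>\<omega>. X \<omega> ^ k)"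
    using integrable_normal_moment[OF s, of 0 k] distributed_integrable[OF D, of "\<lambda>x. x ^ k"] by simp
  have e: "expectation (\<lambda>\<omega>. X \<omega> ^ k) = (LBINT x. normal_density 0 (sqrt \<alpha>) x * x ^ k)" for k
    using distributed_integral[OF D, of "\<lambda>x. x ^ k"] by simp
  show "expectation X = 0"
    using e[of 1] integral_normal_moment_odd[OF s, of 0 0] by simp
  show "expectation (\<lambda>\<omega>. X \<omega> ^ 2) = \<alpha>"
    using e[of 2] integral_normal_moment_even[OF s, of 0 1] assms by simp
  show "expectation (\<lambda>\<omega>. X \<omega> ^ 4) = 3 * \<alpha>\<^sup>2"
    using e[of 4] integral_normal_moment_even[OF s, of 0 2] assms
    by (simp add: fact_numeral power_divide)
qed

lemma chi2_density_nonneg: "d > 0 \<Longrightarrow> 0 \<le> chi2_density d x"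
  by (auto simp: chi2_density_def intro!: divide_nonneg_nonneg mult_nonneg_nonneg Gamma_real_nonneg)

text \<open>The substitution \<open>x = 2 t\<close> in the Gamma integral with parameter
  \<open>d / 2 + k\<close> gives \<open>2 ^ k * Gamma (d / 2 + k) / Gamma (d / 2)\<close>, a rising
  factorial. The integrands are compared off the null set \<open>{0}\<close>.\<close>

lemma chi2_density_moment:
  assumes "d > 0"
  shows "has_bochner_integral lborel (\<lambda>x. chi2_density d x * x ^ k) (2 ^ k * pochhammer (d / 2) k)"
proof -
  define s where "s = d / 2 + real k"
  have s: "s > 0" "d / 2 > 0" using assms by (auto simp: s_def intro: add_pos_nonneg)
  have G: "has_bochner_integral lborel (\<lambda>t. indicat_real {0..} t * t powr (s - 1) / exp t) (Gamma s)"
    by (rule has_bochner_integral_nn_integral)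
       (use Gamma_conv_nn_integral_real[OF s(1)] Gamma_real_pos[OF s(1)] in \<open>auto simp: less_imp_le\<close>)
  have "has_bochner_integral lborel
      (\<lambda>x. indicat_real {0..} (0 + (1/2) * x) * (0 + (1/2) * x) powr (s - 1) / exp (0 + (1/2) * x))
      (Gamma s /\<^sub>R \<bar>1/2\<bar>)"
    using lborel_has_bochner_integral_real_affine_iff[THEN iffD1, OF _ G, of "1/2" 0] by simp
  then have H: "has_bochner_integral lborel
      (\<lambda>x. (2 ^ k / (2 * Gamma (d/2))) * (indicat_real {0..} (0 + (1/2) * x) * (0 + (1/2) * x) powr (s - 1) / exp (0 + (1/2) * x)))
      ((2 ^ k / (2 * Gamma (d/2))) * (Gamma s /\<^sub>R \<bar>1/2\<bar>))"
    by (rule has_bochner_integral_mult_right)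
  have Gp: "Gamma (d/2) > 0" using s by (simp add: Gamma_real_pos)
  have eq: "(2 ^ k / (2 * Gamma (d/2))) * (indicat_real {0..} (0 + (1/2) * x) * (0 + (1/2) * x) powr (s - 1) / exp (0 + (1/2) * x))
     = chi2_density d x * x ^ k" if "x \<noteq> 0" for x
  proof (cases "x > 0")
    case True
    have a: "(x / 2) powr (s - 1) = x powr (d/2 - 1) * x ^ k * 2 / (2 powr (d / 2) * 2 ^ k)"
    proof -
      have "(x / 2) powr (s - 1) = (x / 2) powr (d/2) * (x / 2) powr (real k) / (x / 2) powr 1"
        unfolding s_def by (simp only: powr_add powr_diff)
      also have "\<dots> = x powr (d/2) * x ^ k * 2 / (2 powr (d / 2) * 2 ^ k * x)"
        using True by (simp add: powr_divide powr_realpow power_divide)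
      also have "x powr (d/2) = x powr (d/2 - 1) * x"
        using True by (simp add: powr_diff)
      finally show ?thesis using True by simp
    qed
    show ?thesis using True Gp
      by (simp add: chi2_density_def a exp_minus field_simps)
  next
    case False
    then show ?thesis using that by (simp add: chi2_density_def)
  qed
  have "has_bochner_integral lborel (\<lambda>x. chi2_density d x * x ^ k)
      ((2 ^ k / (2 * Gamma (d/2))) * (Gamma s /\<^sub>R \<bar>1/2\<bar>))"
  proof (rule has_bochner_integralI_AE[OF H])
    show "(\<lambda>x. chi2_density d x * x ^ k) \<in> borel_measurable lborel"
      unfolding chi2_density_def by measurable
    show "AE x in lborel. (2 ^ k / (2 * Gamma (d/2))) * (indicat_real {0..} (0 + (1/2) * x) * (0 + (1/2) * x) powr (s - 1) / exp (0 + (1/2) * x)) = chi2_density d x * x ^ k"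
      using AE_lborel_singleton[of 0] by eventually_elim (rule eq)
  qed
  moreover have "d/2 \<notin> \<int>\<^sub>\<le>\<^sub>0" using nonpos_Ints_nonpos[of "d/2"] s by auto
  then have "(2 ^ k / (2 * Gamma (d/2))) * (Gamma s /\<^sub>R \<bar>1/2\<bar>) = 2 ^ k * pochhammer (d/2) k"
    using pochhammer_Gamma[of "d/2" k] by (simp add: s_def)
  ultimately show ?thesis by simp
qed

lemma (in prob_space) chi2_moments:
  assumes "\<alpha> > 0" "s > 0" and D: "distributed M lborel (\<lambda>\<omega>. (2 / \<alpha>) * W \<omega>) (chi2_density (2 * s / \<alpha>))"
  shows "integrable M (\<lambda>\<omega>. W \<omega> ^ k)"
    "expectation (\<lambda>\<omega>. W \<omega> ^ k) = \<alpha> ^ k * pochhammer (s / \<alpha>) k"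
proof -
  let ?d = "2 * s / \<alpha>"
  have d: "?d > 0" using assms by simp
  have D': "distributed M lborel (\<lambda>\<omega>. (2 / \<alpha>) * W \<omega>) (\<lambda>x. ennreal (chi2_density ?d x))" using D by simp
  have nn: "\<And>x. x \<in> space lborel \<Longrightarrow> 0 \<le> chi2_density ?d x" using d by (rule chi2_density_nonneg)
  have W: "W \<omega> ^ k = (\<alpha>/2)^k * ((2 / \<alpha>) * W \<omega>) ^ k" for \<omega>
    using assms(1) by (simp add: power_mult_distrib[symmetric])
  have "integrable M (\<lambda>\<omega>. ((2 / \<alpha>) * W \<omega>) ^ k)"
    using distributed_integrable[OF D' _ nn, of "\<lambda>x. x ^ k"] chi2_density_moment[OF d, of k]
    by (simp add: has_bochner_integral_iff)
  then show "integrable M (\<lambda>\<omega>. W \<omega> ^ k)" unfolding W by (rule integrable_mult_right)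
  have "expectation (\<lambda>\<omega>. ((2 / \<alpha>) * W \<omega>) ^ k) = 2 ^ k * pochhammer (?d / 2) k"
    using distributed_integral[OF D' _ nn, of "\<lambda>x. x ^ k"] chi2_density_moment[OF d, of k]
    by (simp add: has_bochner_integral_iff)
  then have "expectation (\<lambda>\<omega>. W \<omega> ^ k) = (\<alpha>/2)^k * (2 ^ k * pochhammer (?d / 2) k)"
    unfolding W by simp
  then show "expectation (\<lambda>\<omega>. W \<omega> ^ k) = \<alpha> ^ k * pochhammer (s / \<alpha>) k"
    by (simp add: power_divide)
qed

text \<open>Used with \<open>W = b_i^2\<close> and \<open>s = i\<close>. The cubic and quartic
  powers of \<open>s\<close> cancel in the fourth central moment; the surviving order
  \<open>s^2\<close> is what keeps the fourth moment of \<open>B k / \<rho> k\<close> bounded in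
  \<open>k\<close>.\<close>

lemma (in prob_space) chi2_central_moments:
  assumes "\<alpha> > 0" "s > 0" and D: "distributed M lborel (\<lambda>\<omega>. (2 / \<alpha>) * W \<omega>) (chi2_density (2 * s / \<alpha>))"
  shows "integrable M (\<lambda>\<omega>. (W \<omega> - s) ^ 4)"
    "expectation (\<lambda>\<omega>. W \<omega> - s) = 0"
    "expectation (\<lambda>\<omega>. (W \<omega> - s) ^ 2) = \<alpha> * s"
    "expectation (\<lambda>\<omega>. (W \<omega> - s) ^ 4) = 3 * \<alpha>\<^sup>2 * s\<^sup>2 + 6 * \<alpha> ^ 3 * s"
proof -
  note m = chi2_moments[OF assms]
  have i1: "integrable M W" using m(1)[of 1] by simp
  note i = m(1)[of 2] m(1)[of 3] m(1)[of 4] i1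
  have e1: "expectation W = s" using m(2)[of 1] assms by simp
  have ex: "\<alpha> ^ 2 * pochhammer (s / \<alpha>) 2 = s * (s + \<alpha>)"
      "\<alpha> ^ 3 * pochhammer (s / \<alpha>) 3 = s * (s + \<alpha>) * (s + 2 * \<alpha>)"
      "\<alpha> ^ 4 * pochhammer (s / \<alpha>) 4 = s * (s + \<alpha>) * (s + 2 * \<alpha>) * (s + 3 * \<alpha>)"
    using assms(1) by (simp_all add: pochhammer_Suc numeral_eq_Suc field_simps)
  note e2 = m(2)[of 2, unfolded ex] and e3 = m(2)[of 3, unfolded ex] and e4 = m(2)[of 4, unfolded ex]
  have x4: "(W \<omega> - s) ^ 4 = W \<omega> ^ 4 - 4 * s * W \<omega> ^ 3 + 6 * s\<^sup>2 * W \<omega> ^ 2 - 4 * s ^ 3 * W \<omega> + s ^ 4" for \<omega>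
    by (simp add: power2_eq_square power3_eq_cube power4_eq_xxxx algebra_simps)
  have x2: "(W \<omega> - s) ^ 2 = W \<omega> ^ 2 - 2 * s * W \<omega> + s\<^sup>2" for \<omega> by (simp add: power2_eq_square algebra_simps)
  show "integrable M (\<lambda>\<omega>. (W \<omega> - s) ^ 4)" unfolding x4 using i by simp
  show "expectation (\<lambda>\<omega>. W \<omega> - s) = 0" using i e1 by (simp add: prob_space)
  have "expectation (\<lambda>\<omega>. (W \<omega> - s) ^ 2) = s * (s + \<alpha>) - 2 * s * s + s\<^sup>2"
    unfolding x2 using i e1 e2 by (simp add: prob_space)
  then show "expectation (\<lambda>\<omega>. (W \<omega> - s) ^ 2) = \<alpha> * s" by (simp add: algebra_simps power2_eq_square)
  have "expectation (\<lambda>\<omega>. (W \<omega> - s) ^ 4) = s * (s + \<alpha>) * (s + 2 * \<alpha>) * (s + 3 * \<alpha>)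
     - 4 * s * (s * (s + \<alpha>) * (s + 2 * \<alpha>)) + 6 * s\<^sup>2 * (s * (s + \<alpha>)) - 4 * s ^ 3 * s + s ^ 4"
    unfolding x4 using i e1 e2 e3 e4 by (simp add: prob_space)
  also have "\<dots> = 3 * \<alpha>\<^sup>2 * s\<^sup>2 + 6 * \<alpha> ^ 3 * s"
    by (simp add: power2_eq_square power3_eq_cube power4_eq_xxxx algebra_simps)
  finally show "expectation (\<lambda>\<omega>. (W \<omega> - s) ^ 4) = 3 * \<alpha>\<^sup>2 * s\<^sup>2 + 6 * \<alpha> ^ 3 * s" .
qed

section \<open>A central limit theorem and its stability under perturbation\<close>

lemma abs_exp_minus_taylor1: "0 \<le> (z::real) \<Longrightarrow> \<bar>exp (- z) - (1 - z)\<bar> \<le> z\<^sup>2 / 2"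
proof -
  assume z: "0 \<le> z"
  have 1: "1 - z \<le> exp (- z)" using exp_ge_add_one_self[of "-z"] by simp
  have "(\<lambda>y. 1 - y + y\<^sup>2 / 2 - exp (-y)) 0 \<le> (\<lambda>y. 1 - y + y\<^sup>2 / 2 - exp (-y)) z"
  proof (rule DERIV_nonneg_imp_nondecreasing[OF z])
    fix y assume "0 \<le> y" "y \<le> z"
    have "((\<lambda>y. 1 - y + y\<^sup>2 / 2 - exp (-y)) has_real_derivative (-1 + y + exp (-y))) (at y)"
      by (auto intro!: derivative_eq_intros)
    moreover have "-1 + y + exp (-y) \<ge> 0" using exp_ge_add_one_self[of "-y"] by simp
    ultimately show "\<exists>d. ((\<lambda>y. 1 - y + y\<^sup>2 / 2 - exp (-y)) has_real_derivative d) (at y) \<and> 0 \<le> d" by blast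
  qed
  with 1 show ?thesis by simp
qed

text \<open>AM-GM with a free weight \<open>l\<close>, so that third moments never have to be
  assumed or computed: they are traded for second and fourth ones.\<close>

lemma abs_cube_le: "l > 0 \<Longrightarrow> \<bar>y::real\<bar> ^ 3 \<le> (l * y\<^sup>2 + y ^ 4 / l) / 2"
proof -
  assume l: "l > 0"
  have "0 \<le> (l - \<bar>y\<bar>)\<^sup>2 * y\<^sup>2 / l" using l by simp
  also have "(l - \<bar>y\<bar>)\<^sup>2 * y\<^sup>2 / l = l * y\<^sup>2 + y ^ 4 / l - 2 * \<bar>y\<bar> ^ 3"
  proof -
    have "(l - \<bar>y\<bar>)\<^sup>2 * \<bar>y\<bar>\<^sup>2 = l * (l * \<bar>y\<bar>\<^sup>2 + \<bar>y\<bar> ^ 4 / l - 2 * \<bar>y\<bar> ^ 3)"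
      using l by (simp add: field_simps power2_eq_square power4_eq_xxxx power3_eq_cube)
    then show ?thesis using l by (simp add: power_even_abs)
  qed
  finally show ?thesis by simp
qed

context prob_space begin

lemma integrable_power_le:
  assumes [measurable]: "Z \<in> borel_measurable M" and i: "integrable M (\<lambda>\<omega>. (Z \<omega> :: real) ^ m)" and "even m" "k \<le> m"
  shows "integrable M (\<lambda>\<omega>. \<bar>Z \<omega>\<bar> ^ k)" "integrable M (\<lambda>\<omega>. Z \<omega> ^ k)"
proof -
  have b: "\<bar>z\<bar> ^ k \<le> 1 + z ^ m" for z :: real
  proof (cases "\<bar>z\<bar> \<le> 1")
    case True
    then have "\<bar>z\<bar> ^ k \<le> 1" by (simp add: power_le_one)
    moreover have "0 \<le> z ^ m" using \<open>even m\<close> by (simp add: zero_le_even_power)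
    ultimately show ?thesis by linarith
  next
    case False
    then have "\<bar>z\<bar> ^ k \<le> \<bar>z\<bar> ^ m" using \<open>k \<le> m\<close> by (intro power_increasing) auto
    also have "\<dots> = z ^ m" using \<open>even m\<close> by (simp add: power_even_abs)
    finally show ?thesis by simp
  qed
  have i1: "integrable M (\<lambda>\<omega>. 1 + Z \<omega> ^ m)" using i by simp
  have nn: "0 \<le> z ^ m" for z :: real using \<open>even m\<close> by (simp add: zero_le_even_power)
  show "integrable M (\<lambda>\<omega>. \<bar>Z \<omega>\<bar> ^ k)"
    by (rule Bochner_Integration.integrable_bound[OF i1]) (use b nn in \<open>auto simp: add_nonneg_nonneg\<close>)
  show "integrable M (\<lambda>\<omega>. Z \<omega> ^ k)"
    by (rule Bochner_Integration.integrable_bound[OF i1]) (use b nn in \<open>auto simp: add_nonneg_nonneg power_abs\<close>)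
qed

lemma abs_third_moment_le:
  assumes [measurable]: "Z \<in> borel_measurable M" and i: "integrable M (\<lambda>\<omega>. (Z \<omega> :: real) ^ 4)"
  shows "expectation (\<lambda>\<omega>. \<bar>Z \<omega>\<bar> ^ 3) \<le> (expectation (\<lambda>\<omega>. (Z \<omega>)\<^sup>2) + expectation (\<lambda>\<omega>. Z \<omega> ^ 4)) / 2"
proof -
  have i2: "integrable M (\<lambda>\<omega>. (Z \<omega>)\<^sup>2)" by (rule integrable_power_le(2)[OF _ i]) auto
  have i3: "integrable M (\<lambda>\<omega>. \<bar>Z \<omega>\<bar> ^ 3)" by (rule integrable_power_le(1)[OF _ i]) auto
  have "expectation (\<lambda>\<omega>. \<bar>Z \<omega>\<bar> ^ 3) \<le> expectation (\<lambda>\<omega>. ((Z \<omega>)\<^sup>2 + Z \<omega> ^ 4) / 2)"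
    using abs_cube_le[of 1] i2 i i3 by (intro integral_mono) auto
  then show ?thesis using i2 i by simp
qed

lemma square_expectation_square_le:
  assumes [measurable]: "Z \<in> borel_measurable M" and i: "integrable M (\<lambda>\<omega>. (Z \<omega> :: real) ^ 4)"
  shows "(expectation (\<lambda>\<omega>. (Z \<omega>)\<^sup>2))\<^sup>2 \<le> expectation (\<lambda>\<omega>. Z \<omega> ^ 4)"
proof -
  have i2: "integrable M (\<lambda>\<omega>. (Z \<omega>)\<^sup>2)" by (rule integrable_power_le(2)[OF _ i]) auto
  have "0 \<le> variance (\<lambda>\<omega>. (Z \<omega>)\<^sup>2)" by simp
  also have "variance (\<lambda>\<omega>. (Z \<omega>)\<^sup>2) = expectation (\<lambda>\<omega>. ((Z \<omega>)\<^sup>2)\<^sup>2) - (expectation (\<lambda>\<omega>. (Z \<omega>)\<^sup>2))\<^sup>2"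
    using i2 i by (intro variance_eq) (simp_all add: power_mult[symmetric])
  finally show ?thesis by (simp add: power_mult[symmetric])
qed

text \<open>Both the characteristic function and the Gaussian factor of equal variance are compared
  with \<open>1 - t^2 * Var / 2\<close>. The weight \<open>l\<close> stays free, because the central
  limit theorem must choose it for the whole row at once.\<close>

lemma char_approx_fourth_moment:
  assumes [measurable]: "X \<in> borel_measurable M" and i: "integrable M (\<lambda>\<omega>. X \<omega> ^ 4)"
    and e: "expectation X = 0" and l: "l > 0"
  shows "cmod (char (distr M borel X) t - complex_of_real (exp (- (t\<^sup>2 * expectation (\<lambda>\<omega>. (X \<omega>)\<^sup>2) / 2))))
    \<le> \<bar>t\<bar> ^ 3 / 12 * (l * expectation (\<lambda>\<omega>. (X \<omega>)\<^sup>2) + expectation (\<lambda>\<omega>. X \<omega> ^ 4) / l)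
      + t ^ 4 / 8 * expectation (\<lambda>\<omega>. X \<omega> ^ 4)"
proof -
  let ?s = "expectation (\<lambda>\<omega>. (X \<omega>)\<^sup>2)" and ?q = "expectation (\<lambda>\<omega>. X \<omega> ^ 4)"
  have i2: "integrable M (\<lambda>\<omega>. (X \<omega>)\<^sup>2)" by (rule integrable_power_le(2)[OF _ i]) auto
  have i1: "integrable M X" using integrable_power_le(2)[OF _ i, of 1] by simp
  have s: "0 \<le> ?s" by (rule integral_nonneg_AE) simp
  have "cmod (char (distr M borel X) t - complex_of_real (1 - t\<^sup>2 * ?s / 2))
      \<le> t\<^sup>2 / 6 * expectation (\<lambda>\<omega>. min (6 * (X \<omega>)\<^sup>2) (\<bar>t\<bar> * \<bar>X \<omega>\<bar> ^ 3))"
    by (rule char_approx3') (use i1 i2 e in auto)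
  also have "\<dots> \<le> t\<^sup>2 / 6 * expectation (\<lambda>\<omega>. \<bar>t\<bar> / 2 * (l * (X \<omega>)\<^sup>2 + X \<omega> ^ 4 / l))"
  proof (intro mult_left_mono integral_mono)
    show "integrable M (\<lambda>\<omega>. min (6 * (X \<omega>)\<^sup>2) (\<bar>t\<bar> * \<bar>X \<omega>\<bar> ^ 3))"
      by (rule Bochner_Integration.integrable_bound[OF integrable_mult_right[OF i2, of 6]]) auto
    show "integrable M (\<lambda>\<omega>. \<bar>t\<bar> / 2 * (l * (X \<omega>)\<^sup>2 + X \<omega> ^ 4 / l))" using i i2 by auto
    show "min (6 * (X \<omega>)\<^sup>2) (\<bar>t\<bar> * \<bar>X \<omega>\<bar> ^ 3) \<le> \<bar>t\<bar> / 2 * (l * (X \<omega>)\<^sup>2 + X \<omega> ^ 4 / l)" for \<omega>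
      using mult_left_mono[OF abs_cube_le[OF l, of "X \<omega>"], of "\<bar>t\<bar>"] by (simp add: min_le_iff_disj)
  qed simp
  also have "\<dots> = t\<^sup>2 / 6 * (\<bar>t\<bar> / 2 * (l * ?s + ?q / l))" using i i2 by simp
  also have "\<dots> = \<bar>t\<bar> ^ 3 / 12 * (l * ?s + ?q / l)"
  proof -
    have "\<bar>t\<bar> ^ 3 = t\<^sup>2 * \<bar>t\<bar>" by (simp add: power3_eq_cube power2_eq_square)
    then show ?thesis by simp
  qed
  finally have 1: "cmod (char (distr M borel X) t - complex_of_real (1 - t\<^sup>2 * ?s / 2))
      \<le> \<bar>t\<bar> ^ 3 / 12 * (l * ?s + ?q / l)" .
  have "\<bar>exp (- (t\<^sup>2 * ?s / 2)) - (1 - t\<^sup>2 * ?s / 2)\<bar> \<le> (t\<^sup>2 * ?s / 2)\<^sup>2 / 2"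
    using s by (intro abs_exp_minus_taylor1) auto
  also have "\<dots> = t ^ 4 / 8 * ?s\<^sup>2" by (simp add: field_simps power2_eq_square power4_eq_xxxx)
  also have "\<dots> \<le> t ^ 4 / 8 * ?q"
    using square_expectation_square_le[OF _ i] by (intro mult_left_mono) (auto simp: zero_le_even_power)
  finally have 2: "cmod (complex_of_real (1 - t\<^sup>2 * ?s / 2) - complex_of_real (exp (- (t\<^sup>2 * ?s / 2)))) \<le> t ^ 4 / 8 * ?q"
    by (metis norm_minus_commute norm_of_real of_real_diff)
  show ?thesis using norm_triangle_le[OF add_mono[OF 1 2]] by (simp add: algebra_simps)
qed

text \<open>One independent family with coefficients depending on \<open>n\<close> covers the
  triangular array needed here. All factors have modulus at most 1, so the distance between the
  product of characteristic functions and the Gaussian product is at most the sum of the factorwise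
  distances.\<close>

theorem lyapunov_clt:
  fixes Z :: "'i \<Rightarrow> 'a \<Rightarrow> real" and c :: "nat \<Rightarrow> 'i \<Rightarrow> real" and I :: "nat \<Rightarrow> 'i set"
  assumes ind: "indep_vars (\<lambda>_. borel) Z J" and IJ: "\<And>n. I n \<subseteq> J" and fin: "\<And>n. finite (I n)"
    and int4: "\<And>i. i \<in> J \<Longrightarrow> integrable M (\<lambda>\<omega>. Z i \<omega> ^ 4)"
    and mean: "\<And>i. i \<in> J \<Longrightarrow> expectation (Z i) = 0"
    and var: "(\<lambda>n. \<Sum>i\<in>I n. (c n i)\<^sup>2 * expectation (\<lambda>\<omega>. (Z i \<omega>)\<^sup>2)) \<longlonglongrightarrow> 1"
    and fourth: "(\<lambda>n. \<Sum>i\<in>I n. (c n i) ^ 4 * expectation (\<lambda>\<omega>. Z i \<omega> ^ 4)) \<longlonglongrightarrow> 0"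
  shows "weak_conv_m (\<lambda>n. distr M borel (\<lambda>\<omega>. \<Sum>i\<in>I n. c n i * Z i \<omega>)) std_normal_distribution"
proof (rule levy_continuity)
  have meas: "Z i \<in> borel_measurable M" if "i \<in> J" for i
    using ind that unfolding indep_vars_def by blast
  show "real_distribution (distr M borel (\<lambda>\<omega>. \<Sum>i\<in>I n. c n i * Z i \<omega>))" for n
    using meas IJ by (intro real_distribution_distr borel_measurable_sum borel_measurable_times) auto
  show "real_distribution std_normal_distribution" by (rule real_dist_normal_dist)
  define V where "V n = (\<Sum>i\<in>I n. (c n i)\<^sup>2 * expectation (\<lambda>\<omega>. (Z i \<omega>)\<^sup>2))" for n
  define Q where "Q n = (\<Sum>i\<in>I n. (c n i) ^ 4 * expectation (\<lambda>\<omega>. Z i \<omega> ^ 4))" for n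
  \<comment> \<open>Both \<open>l\<close> and \<open>Q / l\<close> have to tend to 0, which
    \<open>sqrt Q\<close> achieves; the summand \<open>1 / (n + 1)\<close> only keeps
    \<open>l\<close> positive when \<open>Q n = 0\<close>.\<close>
  define l where "l n = sqrt (Q n) + 1 / (real n + 1)" for n
  have Q0: "Q n \<ge> 0" for n unfolding Q_def by (intro sum_nonneg mult_nonneg_nonneg) (auto simp: zero_le_even_power)
  have lpos: "l n > 0" for n unfolding l_def using Q0 by (intro add_nonneg_pos) auto
  have Qlim: "Q \<longlonglongrightarrow> 0" and Vlim: "V \<longlonglongrightarrow> 1" using var fourth by (simp_all add: V_def[abs_def] Q_def[abs_def])
  have slim: "(\<lambda>n. sqrt (Q n)) \<longlonglongrightarrow> 0" using tendsto_real_sqrt[OF Qlim] by simp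
  have llim: "l \<longlonglongrightarrow> 0" unfolding l_def
    using tendsto_add[OF slim] LIMSEQ_inverse_real_of_nat by (fastforce simp: inverse_eq_divide add.commute)
  have Ql: "Q n / l n \<le> sqrt (Q n)" for n
  proof -
    have "Q n = sqrt (Q n) * sqrt (Q n)" using Q0 by simp
    also have "\<dots> \<le> sqrt (Q n) * l n" using Q0 by (intro mult_left_mono) (auto simp: l_def)
    finally show ?thesis using lpos by (simp add: divide_le_eq)
  qed
  fix t :: real
  let ?X = "\<lambda>n i \<omega>. c n i * Z i \<omega>"
  let ?s = "\<lambda>n i. expectation (\<lambda>\<omega>. (?X n i \<omega>)\<^sup>2)" and ?q = "\<lambda>n i. expectation (\<lambda>\<omega>. ?X n i \<omega> ^ 4)"
  have bound: "cmod (char (distr M borel (\<lambda>\<omega>. \<Sum>i\<in>I n. c n i * Z i \<omega>)) t - complex_of_real (exp (- (t\<^sup>2 * V n / 2))))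
      \<le> \<bar>t\<bar> ^ 3 / 12 * (l n * V n + sqrt (Q n)) + t ^ 4 / 8 * Q n" for n
  proof -
    have V: "V n = (\<Sum>i\<in>I n. ?s n i)" and Q: "Q n = (\<Sum>i\<in>I n. ?q n i)"
      by (simp_all add: V_def Q_def power_mult_distrib)
    have "char (distr M borel (\<lambda>\<omega>. \<Sum>i\<in>I n. c n i * Z i \<omega>)) t = (\<Prod>i\<in>I n. char (distr M borel (?X n i)) t)"
      by (rule char_distr_sum, rule indep_vars_compose2[OF indep_vars_subset[OF ind IJ]]) auto
    moreover have "complex_of_real (exp (- (t\<^sup>2 * V n / 2))) = (\<Prod>i\<in>I n. complex_of_real (exp (- (t\<^sup>2 * ?s n i / 2))))"
      unfolding V by (simp add: exp_sum[OF fin, symmetric] of_real_prod[symmetric] sum_distrib_left sum_divide_distrib sum_negf[symmetric] del: of_real_prod)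
    ultimately have "cmod (char (distr M borel (\<lambda>\<omega>. \<Sum>i\<in>I n. c n i * Z i \<omega>)) t - complex_of_real (exp (- (t\<^sup>2 * V n / 2))))
      = cmod ((\<Prod>i\<in>I n. char (distr M borel (?X n i)) t) - (\<Prod>i\<in>I n. complex_of_real (exp (- (t\<^sup>2 * ?s n i / 2)))))"
      by simp
    also have "\<dots> \<le> (\<Sum>i\<in>I n. cmod (char (distr M borel (?X n i)) t - complex_of_real (exp (- (t\<^sup>2 * ?s n i / 2)))))"
    proof (rule norm_prod_diff)
      fix i assume i: "i \<in> I n"
      have [measurable]: "Z i \<in> borel_measurable M" using meas IJ i by blast
      interpret rd: real_distribution "distr M borel (?X n i)" by (rule real_distribution_distr) simp
      show "cmod (char (distr M borel (?X n i)) t) \<le> 1" by (rule rd.cmod_char_le_1)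
      show "cmod (complex_of_real (exp (- (t\<^sup>2 * ?s n i / 2)))) \<le> 1"
        by (simp add: mult_nonneg_nonneg integral_nonneg_AE)
    qed
    also have "\<dots> \<le> (\<Sum>i\<in>I n. \<bar>t\<bar> ^ 3 / 12 * (l n * ?s n i + ?q n i / l n) + t ^ 4 / 8 * ?q n i)"
    proof (rule sum_mono)
      fix i assume i: "i \<in> I n"
      then have iJ: "i \<in> J" using IJ by blast
      have [measurable]: "Z i \<in> borel_measurable M" using meas iJ by blast
      show "cmod (char (distr M borel (?X n i)) t - complex_of_real (exp (- (t\<^sup>2 * ?s n i / 2))))
        \<le> \<bar>t\<bar> ^ 3 / 12 * (l n * ?s n i + ?q n i / l n) + t ^ 4 / 8 * ?q n i"
        by (rule char_approx_fourth_moment)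
           (use int4[OF iJ] mean[OF iJ] lpos in \<open>auto simp: power_mult_distrib\<close>)
    qed
    also have "\<dots> = \<bar>t\<bar> ^ 3 / 12 * (l n * V n + Q n / l n) + t ^ 4 / 8 * Q n"
      unfolding V Q by (simp only: sum.distrib sum_distrib_left sum_divide_distrib distrib_left)
    also have "\<dots> \<le> \<bar>t\<bar> ^ 3 / 12 * (l n * V n + sqrt (Q n)) + t ^ 4 / 8 * Q n"
      by (intro add_right_mono mult_left_mono add_left_mono Ql) auto
    finally show ?thesis .
  qed
  have "(\<lambda>n. \<bar>t\<bar> ^ 3 / 12 * (l n * V n + sqrt (Q n)) + t ^ 4 / 8 * Q n) \<longlonglongrightarrow> \<bar>t\<bar> ^ 3 / 12 * (0 * 1 + 0) + t ^ 4 / 8 * 0"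
    by (intro tendsto_intros llim Vlim slim Qlim)
  then have lim0: "(\<lambda>n. char (distr M borel (\<lambda>\<omega>. \<Sum>i\<in>I n. c n i * Z i \<omega>)) t - complex_of_real (exp (- (t\<^sup>2 * V n / 2)))) \<longlonglongrightarrow> 0"
    by (intro Lim_null_comparison[OF always_eventually[OF allI[OF bound]]]) simp
  have "(\<lambda>n. complex_of_real (exp (- (t\<^sup>2 * V n / 2)))) \<longlonglongrightarrow> complex_of_real (exp (- (t\<^sup>2 * 1 / 2)))"
    by (intro tendsto_intros Vlim) auto
  from tendsto_add[OF lim0 this]
  show "(\<lambda>n. char (distr M borel (\<lambda>\<omega>. \<Sum>i\<in>I n. c n i * Z i \<omega>)) t) \<longlonglongrightarrow> char std_normal_distribution t"
    by (simp add: char_std_normal_distribution)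
qed

text \<open>Slutsky's argument on distribution functions: outside the event that the difference
  exceeds \<open>e\<close>, the event for \<open>Q\<close> lies between those for \<open>T\<close>
  at \<open>x - e\<close> and \<open>x + e\<close>. Continuity of the limit at every point makes
  both shifted values converge.\<close>

lemma weak_conv_m_perturb:
  fixes T Q :: "nat \<Rightarrow> 'a \<Rightarrow> real"
  assumes T[measurable]: "\<And>n. T n \<in> borel_measurable M" and Q[measurable]: "\<And>n. Q n \<in> borel_measurable M"
    and conv: "weak_conv_m (\<lambda>n. distr M borel (T n)) \<mu>" and cont: "\<And>x. isCont (cdf \<mu>) x"
    and diff: "\<And>e. e > 0 \<Longrightarrow> (\<lambda>n. prob {\<omega> \<in> space M. \<bar>Q n \<omega> - T n \<omega>\<bar> > e}) \<longlonglongrightarrow> 0"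
  shows "weak_conv_m (\<lambda>n. distr M borel (Q n)) \<mu>"
  unfolding weak_conv_m_def weak_conv_def
proof (intro allI impI)
  fix x assume "isCont (cdf \<mu>) x"
  have cT: "(\<lambda>n. prob {\<omega> \<in> space M. T n \<omega> \<le> y}) \<longlonglongrightarrow> cdf \<mu> y" for y
    using conv cont[of y] unfolding weak_conv_m_def weak_conv_def cdf_def
    by (simp add: measure_distr vimage_def Int_def conj_commute)
  have "(\<lambda>n. prob {\<omega> \<in> space M. Q n \<omega> \<le> x}) \<longlonglongrightarrow> cdf \<mu> x"
  proof (rule LIMSEQ_I)
    fix r :: real assume r: "r > 0"
    have "(cdf \<mu> \<longlongrightarrow> cdf \<mu> x) (at x)" using cont[of x] by (simp add: isCont_def)
    then obtain d where d: "d > 0" "\<And>y. y \<noteq> x \<Longrightarrow> dist y x < d \<Longrightarrow> dist (cdf \<mu> y) (cdf \<mu> x) < r/3"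
      using r unfolding tendsto_iff eventually_at by (metis UNIV_I zero_less_divide_iff zero_less_numeral)
    define e where "e = d / 2"
    have e: "e > 0" using d by (simp add: e_def)
    have c: "\<bar>cdf \<mu> (x+e) - cdf \<mu> x\<bar> < r/3" "\<bar>cdf \<mu> (x-e) - cdf \<mu> x\<bar> < r/3"
      using d(2)[of "x+e"] d(2)[of "x-e"] e d(1) by (auto simp: dist_real_def e_def)
    have "\<forall>\<^sub>F n in sequentially. \<bar>prob {\<omega> \<in> space M. T n \<omega> \<le> x+e} - cdf \<mu> (x+e)\<bar> < r/3"
      using cT[of "x+e"] r unfolding tendsto_iff dist_real_def by (meson divide_pos_pos zero_less_numeral)
    moreover have "\<forall>\<^sub>F n in sequentially. \<bar>prob {\<omega> \<in> space M. T n \<omega> \<le> x-e} - cdf \<mu> (x-e)\<bar> < r/3"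
      using cT[of "x-e"] r unfolding tendsto_iff dist_real_def by (meson divide_pos_pos zero_less_numeral)
    moreover have "\<forall>\<^sub>F n in sequentially. \<bar>prob {\<omega> \<in> space M. \<bar>Q n \<omega> - T n \<omega>\<bar> > e} - 0\<bar> < r/3"
      using diff[OF e] r unfolding tendsto_iff dist_real_def by (meson divide_pos_pos zero_less_numeral)
    ultimately have "\<forall>\<^sub>F n in sequentially. norm (prob {\<omega> \<in> space M. Q n \<omega> \<le> x} - cdf \<mu> x) < r"
    proof eventually_elim
      case (elim n)
      have "prob {\<omega> \<in> space M. Q n \<omega> \<le> x} \<le> prob ({\<omega> \<in> space M. T n \<omega> \<le> x+e} \<union> {\<omega> \<in> space M. \<bar>Q n \<omega> - T n \<omega>\<bar> > e})"
        by (intro finite_measure_mono) auto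
      also have "\<dots> \<le> prob {\<omega> \<in> space M. T n \<omega> \<le> x+e} + prob {\<omega> \<in> space M. \<bar>Q n \<omega> - T n \<omega>\<bar> > e}"
        by (intro measure_Un_le) auto
      finally have 1: "prob {\<omega> \<in> space M. Q n \<omega> \<le> x} \<le> prob {\<omega> \<in> space M. T n \<omega> \<le> x+e} + prob {\<omega> \<in> space M. \<bar>Q n \<omega> - T n \<omega>\<bar> > e}" .
      have "prob {\<omega> \<in> space M. T n \<omega> \<le> x-e} \<le> prob ({\<omega> \<in> space M. Q n \<omega> \<le> x} \<union> {\<omega> \<in> space M. \<bar>Q n \<omega> - T n \<omega>\<bar> > e})"
        by (intro finite_measure_mono) auto
      also have "\<dots> \<le> prob {\<omega> \<in> space M. Q n \<omega> \<le> x} + prob {\<omega> \<in> space M. \<bar>Q n \<omega> - T n \<omega>\<bar> > e}"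
        by (intro measure_Un_le) auto
      finally have "prob {\<omega> \<in> space M. T n \<omega> \<le> x-e} \<le> prob {\<omega> \<in> space M. Q n \<omega> \<le> x} + prob {\<omega> \<in> space M. \<bar>Q n \<omega> - T n \<omega>\<bar> > e}" .
      then show ?case using 1 elim c unfolding real_norm_def by linarith
    qed
    then show "\<exists>no. \<forall>n\<ge>no. norm (prob {\<omega> \<in> space M. Q n \<omega> \<le> x} - cdf \<mu> x) < r"
      by (simp add: eventually_sequentially)
  qed
  then show "(\<lambda>n. cdf (distr M borel (Q n)) x) \<longlonglongrightarrow> cdf \<mu> x"
    by (simp add: cdf_def measure_distr vimage_def Int_def conj_commute)
qed

end

lemma isCont_cdf_std_normal: "isCont (cdf std_normal_distribution) x"
proof -
  interpret real_distribution std_normal_distribution by (rule real_dist_normal_dist)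
  have "emeasure std_normal_distribution {x} = 0"
    using AE_lborel_singleton[of x]
    by (subst emeasure_density) (auto intro!: nn_integral_0_iff_AE[THEN iffD2] simp: indicator_def)
  then show ?thesis by (simp add: isCont_cdf measure_def)
qed

section \<open>The deterministic recursion near the edge\<close>

text \<open>\<open>big_root\<close> and \<open>small_root\<close> are the solutions of
  \<open>y^2 - x y + t = 0\<close>, the fixed points of \<open>y = x - t / y\<close>, and
  \<open>root_gap\<close> is their distance. The index is a real \<open>t\<close> because the sum of
  logarithms below is compared with an integral in \<open>t\<close>.\<close>

definition root_gap :: "real \<Rightarrow> real \<Rightarrow> real" where
  "root_gap x t = sqrt (x\<^sup>2 - 4 * t)"

definition big_root :: "real \<Rightarrow> real \<Rightarrow> real" where
  "big_root x t = (x + root_gap x t) / 2"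

definition small_root :: "real \<Rightarrow> real \<Rightarrow> real" where
  "small_root x t = (x - root_gap x t) / 2"

text \<open>The margin 100 gives \<open>D k \<ge> 10\<close> for all \<open>k \<le> n\<close>, hence
  \<open>1 / D^2 \<le> 1/100\<close> in every Taylor estimate, and it leaves the roots real at
  \<open>n + 1\<close>, one step beyond the recursion.\<close>

locale edge =
  fixes x :: real and n :: nat
  assumes x_pos: "x > 0" and x_sq: "x\<^sup>2 \<ge> 4 * real n + 100"
begin

abbreviation D :: "nat \<Rightarrow> real" where "D k \<equiv> root_gap x (real k)"
abbreviation \<rho> :: "nat \<Rightarrow> real" where "\<rho> k \<equiv> big_root x (real k)"
abbreviation r :: "nat \<Rightarrow> real" where "r k \<equiv> small_root x (real k)"

definition \<tau> :: "nat \<Rightarrow> real" where "\<tau> k = r k / \<rho> k"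
definition \<delta> :: "nat \<Rightarrow> real" where "\<delta> k = r (Suc k) - r k"
text \<open>The logarithmic scale of the problem: up to bounded errors the sums of
  \<open>1 / D^2\<close> and of \<open>\<delta> / D\<close> are \<open>L / 2\<close>, and the
  variance of the linear noise is \<open>\<alpha> * L\<close>.\<close>

definition L :: real where "L = ln (x / D n)"

declare of_nat_Suc [simp del]

lemma D_sq: "k \<le> n + 1 \<Longrightarrow> (D k)\<^sup>2 = x\<^sup>2 - 4 * real k"
  using x_sq by (auto simp: root_gap_def)

lemma D_antimono: "j \<le> k \<Longrightarrow> D k \<le> D j"
  by (auto simp: root_gap_def)

lemma D_0: "root_gap x 0 = x" using x_pos by (simp add: root_gap_def)

lemma D_le_x: "D k \<le> x" using D_antimono[of 0 k] by (simp add: D_0)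

lemma D_ge_10: "k \<le> n \<Longrightarrow> 10 \<le> D k"
proof -
  assume k: "k \<le> n"
  have "sqrt (10\<^sup>2) \<le> sqrt (x\<^sup>2 - 4 * real k)"
    using x_sq k by (intro real_sqrt_le_mono) auto
  then show ?thesis by (simp add: root_gap_def)
qed

lemma D_pos: "k \<le> n \<Longrightarrow> 0 < D k" using D_ge_10[of k] by simp

lemma D_step: "k < n \<Longrightarrow> 0 < D k \<and> 0 < D (Suc k) \<and> D (Suc k) \<le> D k \<and> Suc k \<le> n"
  using D_pos[of k] D_pos[of "Suc k"] D_antimono[of k "Suc k"] by auto

lemma x_ge_10: "10 \<le> x" using D_ge_10[of 0] by (simp add: D_0)

lemma rho_bounds: "k \<le> n \<Longrightarrow> x / 2 \<le> \<rho> k" "\<rho> k \<le> x" "k \<le> n \<Longrightarrow> 0 < \<rho> k"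
  using D_pos[of k] D_le_x[of k] x_pos by (auto simp: big_root_def)

lemma r_nonneg: "0 \<le> r k" using D_le_x[of k] by (simp add: small_root_def)

lemma rho_r: "k \<le> n + 1 \<Longrightarrow> \<rho> k * r k = real k"
  using D_sq[of k] by (simp add: big_root_def small_root_def field_simps power2_eq_square)

lemma rho_minus_r: "\<rho> k - r k = D k" and rho_plus_r: "\<rho> k + r k = x"
  by (simp_all add: big_root_def small_root_def field_simps)

lemma one_minus_tau: "k \<le> n \<Longrightarrow> 1 - \<tau> k = D k / \<rho> k"
  using rho_bounds(3)[of k] rho_minus_r[of k] by (simp add: \<tau>_def field_simps)

lemma tau_bounds: "k \<le> n \<Longrightarrow> 0 \<le> \<tau> k" "k \<le> n \<Longrightarrow> \<tau> k \<le> 1" "k \<le> n \<Longrightarrow> D k / x \<le> 1 - \<tau> k"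
proof -
  assume k: "k \<le> n"
  show "0 \<le> \<tau> k" using r_nonneg rho_bounds(3)[OF k] by (simp add: \<tau>_def)
  show "D k / x \<le> 1 - \<tau> k"
    using rho_bounds(2)[of k] rho_bounds(3)[OF k] D_pos[OF k] unfolding one_minus_tau[OF k]
    by (intro divide_left_mono) auto
  then show "\<tau> k \<le> 1" using D_pos[OF k] x_pos by (smt (verit) divide_pos_pos)
qed

section \<open>Sums over powers of the gap, by comparison with telescoping differences\<close>

lemma D_diff: "Suc k \<le> n \<Longrightarrow> D k - D (Suc k) = 4 / (D k + D (Suc k))"
proof -
  assume k: "Suc k \<le> n"
  have "(D k - D (Suc k)) * (D k + D (Suc k)) = (D k)\<^sup>2 - (D (Suc k))\<^sup>2"
    by (simp add: power2_eq_square algebra_simps)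
  also have "\<dots> = 4" using k D_sq[of k] D_sq[of "Suc k"] by (simp add: of_nat_Suc)
  finally show ?thesis using D_pos[OF k] D_pos[of k] k by (simp add: field_simps)
qed

lemma delta_eq: "\<delta> k = (D k - D (Suc k)) / 2"
  by (simp add: \<delta>_def small_root_def field_simps)

lemma delta_nonneg: "0 \<le> \<delta> k" using D_antimono[of k "Suc k"] by (simp add: delta_eq)

lemma delta_le: "Suc k \<le> n \<Longrightarrow> \<delta> k \<le> 1 / D (Suc k)"
proof -
  assume k: "Suc k \<le> n"
  have "4 / (D k + D (Suc k)) \<le> 4 / (2 * D (Suc k))"
    using D_antimono[of k "Suc k"] D_pos[OF k] by (intro divide_left_mono) auto
  then have "4 / (D k + D (Suc k)) / 2 \<le> 4 / (2 * D (Suc k)) / 2" by (rule divide_right_mono) simp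
  also have "4 / (2 * D (Suc k)) / 2 = 1 / D (Suc k)" by simp
  finally show ?thesis unfolding delta_eq D_diff[OF k] .
qed

lemma delta_div_le:
  assumes k: "Suc k \<le> n"
  shows "\<delta> k / D (Suc k) \<le> 1 / (D (Suc k))\<^sup>2" "\<delta> k / D k \<le> 1 / (D (Suc k))\<^sup>2"
proof -
  show 1: "\<delta> k / D (Suc k) \<le> 1 / (D (Suc k))\<^sup>2"
    using divide_right_mono[OF delta_le[OF k], of "D (Suc k)"] D_pos[OF k] by (simp add: power2_eq_square)
  have "\<delta> k / D k \<le> \<delta> k / D (Suc k)"
    using D_antimono[of k "Suc k"] D_pos[OF k] delta_nonneg by (intro divide_left_mono) auto
  with 1 show "\<delta> k / D k \<le> 1 / (D (Suc k))\<^sup>2" by simp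
qed

lemma inverse_sq_le: "k \<le> n \<Longrightarrow> 1 / (D k)\<^sup>2 \<le> 1 / 100"
  using power_mono[OF D_ge_10[of k], of 2] by (intro divide_left_mono) auto

text \<open>Since \<open>D^2\<close> decreases linearly with slope 4, \<open>1 / D\<close> grows by
  about \<open>2 / D^3\<close> per step; so the terms are dominated by telescoping increments of
  \<open>1 / D\<close>.\<close>

lemma sum_inverse_cube: "(\<Sum>k\<le>n. 1 / D k ^ 3) \<le> 2 / D n"
proof -
  have *: "1 / D k ^ 3 \<le> 1 / D (Suc k) - 1 / D k" if "k < n" for k
  proof -
    have k: "Suc k \<le> n" using that by simp
    have p: "0 < D k" "0 < D (Suc k)" using D_step[of k] k by auto
    have le: "D (Suc k) \<le> D k" by (rule D_antimono) simp
    have "1 / D k ^ 3 \<le> (2 / D k) / (D k * D k)" using p by (simp add: power3_eq_cube frac_le mult.assoc)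
    also have "\<dots> \<le> (4 / (D k + D (Suc k))) / (D k * D (Suc k))"
    proof (rule frac_le)
      show "2 / D k \<le> 4 / (D k + D (Suc k))" using p le by (simp add: field_simps)
    qed (use p le in auto)
    also have "\<dots> = 1 / D (Suc k) - 1 / D k"
      unfolding D_diff[OF k, symmetric] using p by (simp add: field_simps)
    finally show ?thesis .
  qed
  have "(\<Sum>k\<le>n. 1 / D k ^ 3) = (\<Sum>k<n. 1 / D k ^ 3) + 1 / D n ^ 3"
    by (simp add: lessThan_Suc_atMost[symmetric])
  also have "(\<Sum>k<n. 1 / D k ^ 3) \<le> (\<Sum>k<n. 1 / D (Suc k) - 1 / D k)"
    by (intro sum_mono *) simp
  also have "\<dots> = 1 / D n - 1 / D 0" by (rule sum_lessThan_telescope)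
  also have "\<dots> \<le> 1 / D n" using x_pos by (simp add: D_0)
  also have "1 / D n ^ 3 \<le> 1 / D n"
    using D_ge_10[of n] self_le_power[of "D n" 3] by (intro divide_left_mono) auto
  finally show ?thesis by simp
qed

lemma sum_inverse_cube': "(\<Sum>k<n. 1 / D (Suc k) ^ 3) \<le> 2 / D n"
proof -
  have "(\<Sum>k<n. 1 / D (Suc k) ^ 3) = (\<Sum>k\<in>Suc ` {..<n}. 1 / D k ^ 3)"
    by (simp add: sum.reindex)
  also have "\<dots> \<le> (\<Sum>k\<le>n. 1 / D k ^ 3)"
    using D_pos by (intro sum_mono2) (auto simp: less_imp_le)
  finally show ?thesis using sum_inverse_cube by simp
qed

lemma sum_inverse_power_le:
  assumes "m \<ge> 3"
  shows "(\<Sum>k<n. 1 / D (Suc k) ^ m) \<le> 2 / D n ^ (m - 2)"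
proof -
  have "(\<Sum>k<n. 1 / D (Suc k) ^ m) \<le> (\<Sum>k<n. (1 / D n ^ (m - 3)) * (1 / D (Suc k) ^ 3))"
  proof (intro sum_mono)
    fix k assume "k \<in> {..<n}"
    then have k: "Suc k \<le> n" by simp
    have "D n ^ (m - 3) * D (Suc k) ^ 3 \<le> D (Suc k) ^ (m - 3) * D (Suc k) ^ 3"
      using D_pos[OF k] D_pos[of n] D_antimono[OF k] by (intro mult_right_mono power_mono) auto
    also have "\<dots> = D (Suc k) ^ m" using assms by (simp add: power_add[symmetric])
    finally have "1 / D (Suc k) ^ m \<le> 1 / (D n ^ (m - 3) * D (Suc k) ^ 3)"
      using D_pos[OF k] D_pos[of n] by (intro divide_left_mono) auto
    then show "1 / D (Suc k) ^ m \<le> (1 / D n ^ (m - 3)) * (1 / D (Suc k) ^ 3)" by simp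
  qed
  also have "\<dots> = (1 / D n ^ (m - 3)) * (\<Sum>k<n. 1 / D (Suc k) ^ 3)" by (simp add: sum_distrib_left)
  also have "\<dots> \<le> (1 / D n ^ (m - 3)) * (2 / D n)"
    using D_pos[of n] by (intro mult_left_mono sum_inverse_cube') auto
  also have "\<dots> = 2 / D n ^ (m - 2)"
  proof -
    have "m - 2 = Suc (m - 3)" using assms by simp
    then show ?thesis by (simp add: mult.commute)
  qed
  finally show ?thesis .
qed

lemma ln_ratio_sum: "(\<Sum>k<n. ln (D k / D (Suc k))) = L"
proof -
  have "(\<Sum>k<n. ln (D k / D (Suc k))) = (\<Sum>k<n. ln (D k) - ln (D (Suc k)))"
  proof (rule sum.cong)
    fix k assume "k \<in> {..<n}"
    then show "ln (D k / D (Suc k)) = ln (D k) - ln (D (Suc k))" using D_step[of k] by (simp add: ln_divide_pos)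
  qed simp
  also have "\<dots> = ln (D 0) - ln (D n)" by (rule sum_lessThan_telescope')
  also have "\<dots> = L" using D_pos[of n] x_pos by (simp add: D_0 L_def ln_div)
  finally show ?thesis .
qed

lemma sum_inverse_fourth: "(\<Sum>k<n. 1 / D (Suc k) ^ 4) \<le> 1 / 50"
proof -
  have "(\<Sum>k<n. 1 / D (Suc k) ^ 4) \<le> 2 / D n ^ 2" using sum_inverse_power_le[of 4] by simp
  then show ?thesis using inverse_sq_le[of n] by simp
qed

text \<open>The critical exponent: \<open>1 / D^2\<close> matches half the increment of
  \<open>- ln D\<close>, because
  \<open>2 * ln (D k / D (Suc k)) = ln (1 + 4 / (D (Suc k))^2)\<close>. The quadratic Taylor error
  is \<open>4 / D^4\<close> per term and summable.\<close>

lemma sum_inverse_sq: "\<bar>(\<Sum>k<n. 1 / (D (Suc k))\<^sup>2) - L / 2\<bar> \<le> 1"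
proof -
  have *: "\<bar>1 / (D (Suc k))\<^sup>2 - ln (D k / D (Suc k)) / 2\<bar> \<le> 4 * (1 / D (Suc k) ^ 4)" if "k < n" for k
  proof -
    have k: "Suc k \<le> n" using that by simp
    have p: "0 < D k" "0 < D (Suc k)" using D_step[of k] k by auto
    let ?z = "4 / (D (Suc k))\<^sup>2"
    have "(D k)\<^sup>2 = (D (Suc k))\<^sup>2 + 4" using k D_sq[of k] D_sq[of "Suc k"] by (simp add: of_nat_Suc)
    then have "(D k / D (Suc k))\<^sup>2 = 1 + ?z"
      using p by (simp add: power_divide add_divide_distrib)
    then have "2 * ln (D k / D (Suc k)) = ln (1 + ?z)"
      using p ln_realpow[of "D k / D (Suc k)" 2] by simp
    moreover have "\<bar>ln (1 + ?z) - ?z\<bar> \<le> ?z\<^sup>2"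
      using inverse_sq_le[OF k] by (intro abs_ln_one_plus_x_minus_x_bound_nonneg) auto
    moreover have "?z\<^sup>2 = 16 * (1 / D (Suc k) ^ 4)" by (simp add: power_divide)
    ultimately show ?thesis by (simp add: abs_le_iff)
  qed
  have "\<bar>(\<Sum>k<n. 1 / (D (Suc k))\<^sup>2) - L / 2\<bar> = \<bar>\<Sum>k<n. 1 / (D (Suc k))\<^sup>2 - ln (D k / D (Suc k)) / 2\<bar>"
    by (simp only: ln_ratio_sum[symmetric] sum_subtractf sum_divide_distrib)
  also have "\<dots> \<le> (\<Sum>k<n. 4 * (1 / D (Suc k) ^ 4))"
    by (intro order.trans[OF sum_abs] sum_mono *) simp
  also have "\<dots> \<le> 1" using sum_inverse_fourth unfolding sum_distrib_left[symmetric] by simp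
  finally show ?thesis .
qed

text \<open>This is the accumulated cost of the slow motion of the repelling fixed point. Again each
  term is half of \<open>ln (D k / D (Suc k))\<close>, now through
  \<open>D (Suc k) / D k = 1 - 2 * \<delta> k / D k\<close>.\<close>

lemma sum_delta: "\<bar>(\<Sum>k<n. \<delta> k / D k) - L / 2\<bar> \<le> 1"
proof -
  have *: "\<bar>\<delta> k / D k - ln (D k / D (Suc k)) / 2\<bar> \<le> 4 * (1 / D (Suc k) ^ 4)" if "k < n" for k
  proof -
    have k: "Suc k \<le> n" using that by simp
    have p: "0 < D k" "0 < D (Suc k)" using D_step[of k] k by auto
    define e where "e = \<delta> k / D k"
    have e: "0 \<le> e" "e \<le> 1 / (D (Suc k))\<^sup>2" "e \<le> 1/100"
      unfolding e_def using delta_div_le(2)[OF k] delta_nonneg[of k] p order.trans[OF delta_div_le(2)[OF k] inverse_sq_le[OF k]]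
      by (auto simp del: of_nat_Suc)
    have "D (Suc k) / D k = 1 + (- (2 * e))" using p by (simp add: e_def delta_eq field_simps)
    then have "ln (D k / D (Suc k)) = - ln (1 + (- (2 * e)))"
      using p ln_div[of "D k" "D (Suc k)"] ln_div[of "D (Suc k)" "D k"] by simp
    moreover have "\<bar>ln (1 + (- (2 * e))) - (- (2 * e))\<bar> \<le> 2 * (- (2 * e))\<^sup>2"
      using e by (intro abs_ln_one_plus_x_minus_x_bound_nonpos) auto
    moreover have "e\<^sup>2 \<le> (1 / (D (Suc k))\<^sup>2)\<^sup>2" using e by (intro power_mono) auto
    moreover have "(1 / (D (Suc k))\<^sup>2)\<^sup>2 = 1 / D (Suc k) ^ 4" by (simp add: power_divide)
    ultimately show ?thesis unfolding e_def[symmetric] by (simp add: abs_le_iff power_mult_distrib)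
  qed
  have "\<bar>(\<Sum>k<n. \<delta> k / D k) - L / 2\<bar> = \<bar>\<Sum>k<n. \<delta> k / D k - ln (D k / D (Suc k)) / 2\<bar>"
    by (simp only: ln_ratio_sum[symmetric] sum_subtractf sum_divide_distrib)
  also have "\<dots> \<le> (\<Sum>k<n. 4 * (1 / D (Suc k) ^ 4))"
    by (intro order.trans[OF sum_abs] sum_mono *) simp
  also have "\<dots> \<le> 1" using sum_inverse_fourth unfolding sum_distrib_left[symmetric] by simp
  finally show ?thesis .
qed

text \<open>Writing \<open>1 + \<tau> = 2 - (1 - \<tau>)\<close>, the main part is twice the sum of
  \<open>1 / D^2\<close>. The rest is the sum of \<open>1 / (\<rho> D)\<close>, bounded because the
  sum of \<open>1 / D\<close> telescopes against \<open>D\<close> and is at most of order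
  \<open>x\<close>, while \<open>\<rho> \<ge> x / 2\<close>.\<close>

lemma sum_variance: "\<bar>(\<Sum>k<n. (1 + \<tau> (Suc k)) / (D (Suc k))\<^sup>2) - L\<bar> \<le> 4"
proof -
  have a: "1 / D k \<le> (D k - D (Suc k)) / 2" if "k < n" for k
  proof -
    have k: "Suc k \<le> n" using that by simp
    have p: "0 < D k" "0 < D (Suc k)" "D (Suc k) \<le> D k" using D_step[of k] k by auto
    show ?thesis unfolding D_diff[OF k] using p by (simp add: field_simps)
  qed
  have "(\<Sum>k<n. 1 / D (Suc k)) = (\<Sum>k\<in>Suc ` {..<n}. 1 / D k)" by (simp add: sum.reindex)
  also have "\<dots> \<le> (\<Sum>k\<le>n. 1 / D k)" using D_pos by (intro sum_mono2) (auto simp: less_imp_le)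
  also have "\<dots> = (\<Sum>k<n. 1 / D k) + 1 / D n" by (simp add: lessThan_Suc_atMost[symmetric])
  also have "(\<Sum>k<n. 1 / D k) \<le> (\<Sum>k<n. (D k - D (Suc k)) / 2)" by (intro sum_mono a) simp
  also have "\<dots> = (D 0 - D n) / 2" unfolding sum_divide_distrib[symmetric] using sum_lessThan_telescope'[of D n] by simp
  also have "\<dots> \<le> x / 2" using D_pos[of n] by (simp add: D_0)
  also have "1 / D n \<le> 1" using D_ge_10[of n] by simp
  finally have s: "(\<Sum>k<n. 1 / D (Suc k)) \<le> x" using x_ge_10 by simp
  have t: "0 \<le> (1 - \<tau> (Suc k)) / (D (Suc k))\<^sup>2 \<and> (1 - \<tau> (Suc k)) / (D (Suc k))\<^sup>2 \<le> 2 / x * (1 / D (Suc k))" if "k < n" for k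
  proof -
    have k: "Suc k \<le> n" using that by simp
    have p: "0 < D (Suc k)" using D_step[of k] k by auto
    have "(1 - \<tau> (Suc k)) / (D (Suc k))\<^sup>2 = 1 / (\<rho> (Suc k) * D (Suc k))"
      using p by (simp add: one_minus_tau[OF k] power2_eq_square)
    moreover have "1 / (\<rho> (Suc k) * D (Suc k)) \<le> 1 / ((x / 2) * D (Suc k))"
      using rho_bounds(1)[OF k] p x_pos by (intro divide_left_mono mult_right_mono) auto
    ultimately show ?thesis using tau_bounds(2)[OF k] by (intro conjI divide_nonneg_nonneg) auto
  qed
  have "(\<Sum>k<n. (1 - \<tau> (Suc k)) / (D (Suc k))\<^sup>2) \<le> (\<Sum>k<n. 2 / x * (1 / D (Suc k)))"
    using t by (intro sum_mono) auto
  also have "\<dots> = 2 / x * (\<Sum>k<n. 1 / D (Suc k))" by (simp add: sum_distrib_left)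
  also have "\<dots> \<le> 2 / x * x" using s x_pos by (intro mult_left_mono) auto
  finally have u: "(\<Sum>k<n. (1 - \<tau> (Suc k)) / (D (Suc k))\<^sup>2) \<le> 2" using x_pos by simp
  have l: "0 \<le> (\<Sum>k<n. (1 - \<tau> (Suc k)) / (D (Suc k))\<^sup>2)" using t by (intro sum_nonneg) auto
  have "(\<Sum>k<n. (1 + \<tau> (Suc k)) / (D (Suc k))\<^sup>2)
      = 2 * (\<Sum>k<n. 1 / (D (Suc k))\<^sup>2) - (\<Sum>k<n. (1 - \<tau> (Suc k)) / (D (Suc k))\<^sup>2)"
    by (simp add: sum_distrib_left sum_subtractf[symmetric] diff_divide_distrib[symmetric])
  then show ?thesis using u l sum_inverse_sq by (simp add: abs_le_iff)
qed

text \<open>\<open>ln (big_root x t)\<close> decreases in \<open>t\<close> and has the explicit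
  antiderivative \<open>G\<close>, so the sum is squeezed by integrals over unit intervals.
  Integrating up to \<open>n + 1\<close>, which is \<open>N\<close> in the application, costs one
  end term on either side: \<open>ln x\<close> at 0 and at least \<open>ln (x / 2)\<close> at
  \<open>n + 1\<close>.\<close>

lemma sum_ln_big_root:
  defines "F \<equiv> (real n + 1) * ln (big_root x (real n + 1)) + (small_root x (real n + 1))\<^sup>2 / 2"
  shows "F - ln x \<le> (\<Sum>k<n. ln (\<rho> (Suc k)))" "(\<Sum>k<n. ln (\<rho> (Suc k))) \<le> F - ln (x / 2)"
proof -
  \<comment> \<open>With \<open>b\<close> the root, the derivative is
    \<open>ln b + b' * (t / b - x + b)\<close>, and the bracket vanishes because \<open>b\<close>
    solves \<open>b^2 - x b + t = 0\<close>.\<close>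
  define G where "G t = t * ln (big_root x t) - x * big_root x t + (big_root x t)\<^sup>2 / 2" for t
  have Gd: "(G has_real_derivative ln (big_root x t)) (at t)" if "0 \<le> t" "t \<le> real n + 1" for t
  proof -
    have p: "x\<^sup>2 - 4 * t > 0" using x_sq that by simp
    let ?s = "sqrt (x\<^sup>2 - 4 * t)"
    have s: "?s > 0" "?s\<^sup>2 = x\<^sup>2 - 4 * t" using p by auto
    have b: "big_root x t > 0" using add_pos_pos[OF x_pos s(1)] unfolding big_root_def root_gap_def by simp
    have bd: "(big_root x has_real_derivative (- 1 / ?s)) (at t)"
      unfolding big_root_def[abs_def] root_gap_def
      using p by (auto intro!: derivative_eq_intros simp: divide_simps)
    have "(x - (x + s) / 2) * ((x + s) / 2) = (x\<^sup>2 - s\<^sup>2) / 4" for s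
      by (simp add: power2_eq_square field_simps)
    then have "(x - big_root x t) * big_root x t = (x\<^sup>2 - ?s\<^sup>2) / 4"
      unfolding big_root_def root_gap_def .
    also have "\<dots> = t" unfolding s(2) by simp
    finally have br: "t / big_root x t = x - big_root x t" using b by (simp add: divide_eq_eq)
    have "(G has_real_derivative (1 * ln (big_root x t) + (1 / big_root x t * (- 1 / ?s)) * t
        - x * (- 1 / ?s) + (2 * big_root x t * (- 1 / ?s)) / 2)) (at t)"
      unfolding G_def[abs_def] using b
      by (auto intro!: derivative_eq_intros bd)
    moreover have "(1 * l + (1 / b * c) * t - x * c + (2 * b * c) / 2) = l + c * (t / b - x + b)" for l b c :: real
      by (simp add: algebra_simps)
    then have "(1 * ln (big_root x t) + (1 / big_root x t * (- 1 / ?s)) * t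
        - x * (- 1 / ?s) + (2 * big_root x t * (- 1 / ?s)) / 2) = ln (big_root x t) + (- 1 / ?s) * (t / big_root x t - x + big_root x t)"
      by blast
    ultimately have "(G has_real_derivative ln (big_root x t) + (- 1 / ?s) * (t / big_root x t - x + big_root x t)) (at t)"
      by (simp only:)
    then show ?thesis unfolding br by simp
  qed
  have mono: "big_root x t \<le> big_root x s" if "s \<le> t" for s t
    using that by (simp add: big_root_def root_gap_def)
  have pos: "big_root x t > 0" if "t \<le> real n + 1" for t
  proof -
    have "0 \<le> root_gap x t" unfolding root_gap_def using x_sq that by (intro real_sqrt_ge_zero) linarith
    then show ?thesis using x_pos by (simp add: big_root_def)
  qed
  have step: "ln (\<rho> (Suc k)) \<le> G (real (Suc k)) - G (real k)" "G (real (Suc k)) - G (real k) \<le> ln (\<rho> k)" if "k \<le> n" for k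
  proof -
    have "\<exists>z>real k. z < real (Suc k) \<and> G (real (Suc k)) - G (real k) = (real (Suc k) - real k) * ln (big_root x z)"
      using that by (intro MVT2 Gd) auto
    then obtain z where z: "real k < z" "z < real (Suc k)" "G (real (Suc k)) - G (real k) = ln (big_root x z)" by auto
    show "ln (\<rho> (Suc k)) \<le> G (real (Suc k)) - G (real k)" "G (real (Suc k)) - G (real k) \<le> ln (\<rho> k)"
      unfolding z(3) using z that by (intro ln_mono mono pos; simp)+
  qed
  have tele: "(\<Sum>k<Suc n. G (real (Suc k)) - G (real k)) = G (real n + 1) - G 0"
  proof -
    have "real (Suc n) = real n + 1" by (simp add: of_nat_Suc)
    then show ?thesis using sum_lessThan_telescope[of "\<lambda>k. G (real k)" "Suc n"] by (simp only: of_nat_0)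
  qed
  have G0: "G 0 = - x\<^sup>2 / 2"
  proof -
    have "big_root x 0 = x" by (simp add: big_root_def D_0)
    then show ?thesis by (simp add: G_def power2_eq_square)
  qed
  have sr: "small_root x t = x - big_root x t" for t by (simp add: big_root_def small_root_def field_simps)
  have FG: "F = G (real n + 1) - G 0"
    unfolding G0 unfolding F_def G_def sr by (simp add: power2_eq_square algebra_simps add_divide_distrib diff_divide_distrib)
  have "G (real n + 1) - G 0 \<le> (\<Sum>k<Suc n. ln (\<rho> k))"
    unfolding tele[symmetric] by (intro sum_mono step) simp
  also have "\<dots> = ln (\<rho> 0) + (\<Sum>k<n. ln (\<rho> (Suc k)))" by (rule sum.lessThan_Suc_shift)
  finally show "F - ln x \<le> (\<Sum>k<n. ln (\<rho> (Suc k)))"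
    using x_pos by (simp add: FG big_root_def root_gap_def)
  have "(\<Sum>k<Suc n. ln (\<rho> (Suc k))) \<le> G (real n + 1) - G 0"
    unfolding tele[symmetric] by (intro sum_mono step) simp
  moreover have "ln (x / 2) \<le> ln (\<rho> (Suc n))"
  proof (rule ln_mono)
    have "0 \<le> root_gap x (real (Suc n))" unfolding root_gap_def using x_sq by (intro real_sqrt_ge_zero) (simp add: of_nat_Suc)
    then show "x / 2 \<le> \<rho> (Suc n)" by (simp add: big_root_def)
  qed (use x_pos in auto)
  ultimately show "(\<Sum>k<n. ln (\<rho> (Suc k))) \<le> F - ln (x / 2)" by (simp add: FG)
qed

end

section \<open>One step of the recursion, pathwise\<close>

context edge begin

text \<open>
  If \<open>u = (Y - \<rho> k) / D k\<close> then \<open>v k u = (Y - \<rho> (Suc k)) / D (Suc k)\<close>: the same point, seen from the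
  fixed point of the next step.
\<close>
definition v :: "nat \<Rightarrow> real \<Rightarrow> real" where "v k u = u + \<delta> k / D (Suc k) * (1 + 2 * u)"

lemma v_bounds:
  assumes k: "k < n" and u: "\<bar>u\<bar> \<le> 1/4"
  shows "\<bar>v k u - u\<bar> \<le> 3/2 / (D (Suc k))\<^sup>2" "\<bar>v k u\<bar> \<le> 3/10"
proof -
  have k': "Suc k \<le> n" using k by simp
  have "0 \<le> \<delta> k / D (Suc k)" using delta_nonneg D_step[OF k] by simp
  have "\<bar>v k u - u\<bar> = \<delta> k / D (Suc k) * \<bar>1 + 2 * u\<bar>"
    using \<open>0 \<le> \<delta> k / D (Suc k)\<close> by (simp only: v_def abs_mult add_diff_cancel_left' abs_of_nonneg)
  also have "\<dots> \<le> 1 / (D (Suc k))\<^sup>2 * (3/2)"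
    using delta_div_le(1)[OF k'] u by (intro mult_mono) auto
  finally show 1: "\<bar>v k u - u\<bar> \<le> 3/2 / (D (Suc k))\<^sup>2" by simp
  have "3/2 / (D (Suc k))\<^sup>2 = 3/2 * (1 / (D (Suc k))\<^sup>2)" by simp
  with 1 u inverse_sq_le[OF k'] show "\<bar>v k u\<bar> \<le> 3/10" by linarith
qed

text \<open>\<open>D (1 + u')\<close> is the distance of \<open>Y'\<close> from the repelling fixed
  point. Multiplying the recursion by \<open>Y\<close> and using \<open>\<rho> * r = k + 1\<close>
  gives the noisy form of \<open>Y' - r = \<rho> (Y - r) / Y\<close>. The step from \<open>k\<close>
  uses the fixed points of index \<open>Suc k\<close>, hence \<open>v\<close> in place of
  \<open>u\<close>.\<close>

lemma riccati_step:
  fixes Y A B :: real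
  assumes k: "k < n" and u: "u = (Y - \<rho> k) / D k" and ub: "\<bar>u\<bar> \<le> 1/4"
    and Y': "Y' = x - A - (real (Suc k) + B) / Y" and u': "u' = (Y' - \<rho> (Suc k)) / D (Suc k)"
  defines "s \<equiv> 1 - \<tau> (Suc k)"
  shows "Y = \<rho> (Suc k) * (1 + s * v k u)"
    "(1 + s * v k u) * (1 + u') = 1 + v k u - (A * (1 + s * v k u) + B / \<rho> (Suc k)) / D (Suc k)"
    "0 < 1 + s * v k u"
proof -
  have k': "Suc k \<le> n" "Suc k \<le> n + 1" using k by auto
  have p: "0 < D k" "0 < D (Suc k)" "0 < \<rho> (Suc k)" using D_step[OF k] rho_bounds(3)[OF k'(1)] by auto
  let ?P = "\<rho> (Suc k)" and ?D = "D (Suc k)" and ?v = "v k u"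
  have s: "s = ?D / ?P" unfolding s_def by (rule one_minus_tau[OF k'(1)])
  have s01: "0 \<le> s" "s \<le> 1" using tau_bounds(1,2)[OF k'(1)] by (auto simp: s_def)
  have "Y = \<rho> k + D k * u" using p by (simp add: u)
  also have "\<rho> k = ?P + \<delta> k" by (simp add: delta_eq big_root_def field_simps)
  also have "D k = ?D + 2 * \<delta> k" by (simp add: delta_eq field_simps)
  also have "?P + \<delta> k + (?D + 2 * \<delta> k) * u = ?P + ?D * ?v" using p by (simp add: v_def field_simps)
  finally have Yv: "Y = ?P + ?D * ?v" .
  also have "\<dots> = ?P * (1 + s * ?v)" using p by (simp add: s field_simps)
  finally show Y1: "Y = ?P * (1 + s * ?v)" .
  have "\<bar>s * ?v\<bar> \<le> 1 * (3/10)" unfolding abs_mult using s01 v_bounds(2)[OF k ub] by (intro mult_mono) auto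
  then show pos: "0 < 1 + s * ?v" by (simp add: abs_le_iff)
  then have Yp: "Y > 0" using p by (simp add: Y1)
  have "Y' = ?P + ?D * u'" using p by (simp add: u')
  then have "?D * (1 + u') = Y' - r (Suc k)" using rho_minus_r[of "Suc k"] by (simp add: algebra_simps)
  also have "\<dots> = ?P - A - (?P * r (Suc k) + B) / Y"
    unfolding Y' rho_r[OF k'(2)] using rho_plus_r[of "Suc k"] by simp
  finally have "?D * (1 + u') * Y = ?P * (Y - r (Suc k)) - A * Y - B"
    using Yp by (simp add: field_simps)
  also have "Y - r (Suc k) = ?D * (1 + ?v)" using rho_minus_r[of "Suc k"] Yv by (simp add: algebra_simps)
  finally have "?D * (1 + u') * (?P * (1 + s * ?v)) = ?P * (?D * (1 + ?v)) - A * (?P * (1 + s * ?v)) - B"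
    unfolding Y1 .
  moreover define E where "E = (A * (1 + s * ?v) + B / ?P) / ?D"
  moreover have "(?P * ?D) * E = A * (?P * (1 + s * ?v)) + B" using p by (simp add: E_def field_simps)
  ultimately have "(?P * ?D) * ((1 + s * ?v) * (1 + u')) = (?P * ?D) * (1 + ?v - E)"
    by (simp add: algebra_simps)
  then have "(1 + s * ?v) * (1 + u') = 1 + ?v - E" using p by simp
  then show "(1 + s * ?v) * (1 + u') = 1 + ?v - (A * (1 + s * ?v) + B / ?P) / ?D" unfolding E_def .
qed

text \<open>The logarithm of the multiplicative identity \<open>Y * (Y' - r (Suc k)) = \<rho> (Suc
  k) * (Y - r (Suc k)) * (1 - \<eta>)\<close>. The factor with \<open>\<delta>\<close> replaces
  \<open>r (Suc k)\<close> by \<open>r k\<close> in \<open>Y - r (Suc k)\<close>, so that the last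
  two terms telescope over \<open>k\<close>.\<close>

lemma ln_step:
  fixes Y A B :: real
  assumes k: "k < n" and u: "u = (Y - \<rho> k) / D k" and ub: "\<bar>u\<bar> \<le> 1/4"
    and Y': "Y' = x - A - (real (Suc k) + B) / Y" and u': "u' = (Y' - \<rho> (Suc k)) / D (Suc k)"
    and ub': "\<bar>u'\<bar> \<le> 1/4"
  defines "\<eta> \<equiv> (A * (1 + (1 - \<tau> (Suc k)) * v k u) + B / \<rho> (Suc k)) / (D (Suc k) * (1 + v k u))"
  shows "2/5 \<le> 1 - \<eta>"
    "ln Y = ln (\<rho> (Suc k)) + ln (1 - \<eta>) + ln (1 - \<delta> k / D k / (1 + u)) + ln (D k * (1 + u)) - ln (D (Suc k) * (1 + u'))"
    "0 < 1 - \<delta> k / D k / (1 + u)"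
proof -
  have k': "Suc k \<le> n" "Suc k \<le> n + 1" using k by auto
  have p: "0 < D k" "0 < D (Suc k)" "0 < \<rho> (Suc k)" using D_step[OF k] rho_bounds(3)[OF k'(1)] by auto
  define s where "s = 1 - \<tau> (Suc k)"
  let ?P = "\<rho> (Suc k)" and ?D = "D (Suc k)" and ?v = "v k u"
  note st = riccati_step[OF k u ub Y' u', folded s_def]
  have s01: "0 \<le> s" "s \<le> 1" using tau_bounds(1,2)[OF k'(1)] by (auto simp: s_def)
  have vb: "\<bar>?v\<bar> \<le> 3/10" by (rule v_bounds(2)[OF k ub])
  have "\<bar>s * ?v\<bar> \<le> 1 * (3/10)" unfolding abs_mult using s01 vb by (intro mult_mono) auto
  then have sv: "7/10 \<le> 1 + s * ?v" by (simp add: abs_le_iff)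
  have v1: "7/10 \<le> 1 + ?v" "1 + ?v \<le> 13/10" using vb by (auto simp: abs_le_iff)
  have u1: "3/4 \<le> 1 + u'" "3/4 \<le> 1 + u" using ub ub' by (auto simp: abs_le_iff)
  have "1 - \<eta> = (1 + ?v - (A * (1 + s * ?v) + B / ?P) / ?D) / (1 + ?v)"
    using v1 unfolding \<eta>_def s_def[symmetric] by (simp add: diff_divide_distrib)
  then have eta: "1 - \<eta> = (1 + s * ?v) * (1 + u') / (1 + ?v)" unfolding st(2)[symmetric] .
  \<comment> \<open>The noise is unbounded, so the lower bound on \<open>1 - \<eta>\<close> cannot
    come from \<open>A\<close> and \<open>B\<close>; it comes from \<open>u'\<close> also lying in
    the window.\<close>
  have "2/5 \<le> (7/10 * (3/4)) / (13/10 :: real)" by simp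
  also have "\<dots> \<le> (1 + s * ?v) * (1 + u') / (1 + ?v)"
    using sv v1 u1 by (intro frac_le mult_mono) auto
  finally show eta_ge: "2/5 \<le> 1 - \<eta>" unfolding eta .
  have e: "?D * (1 + ?v) = D k * (1 + u) - \<delta> k"
    using p by (simp add: v_def delta_eq field_simps)
  also have "\<dots> = D k * (1 + u) * (1 - \<delta> k / D k / (1 + u))"
  proof -
    have "1 + u \<noteq> 0" using u1 by linarith
    then show ?thesis using p by (simp add: right_diff_distrib)
  qed
  finally have e2: "?D * (1 + ?v) = D k * (1 + u) * (1 - \<delta> k / D k / (1 + u))" .
  have "0 < ?D * (1 + ?v)" using p v1 by simp
  moreover have "0 < D k * (1 + u)" using p u1 by simp
  ultimately show pe: "0 < 1 - \<delta> k / D k / (1 + u)" unfolding e2 by (rule zero_less_mult_pos)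
  have "Y * (?D * (1 + u')) = ?P * (?D * (1 + ?v)) * (1 - \<eta>)"
    unfolding st(1) eta using v1 by simp
  also have "\<dots> = ?P * (1 - \<eta>) * (1 - \<delta> k / D k / (1 + u)) * (D k * (1 + u))"
    unfolding e2 by simp
  finally have "ln (Y * (?D * (1 + u'))) = ln (?P * (1 - \<eta>) * (1 - \<delta> k / D k / (1 + u)) * (D k * (1 + u)))" by simp
  moreover have "0 < Y" using st(1,3) p by simp
  ultimately show "ln Y = ln ?P + ln (1 - \<eta>) + ln (1 - \<delta> k / D k / (1 + u)) + ln (D k * (1 + u)) - ln (?D * (1 + u'))"
    using p eta_ge pe u1 by (simp add: ln_mult_pos)
qed

end

section \<open>Elementary inequalities for the fourth moment and for the Taylor remainders\<close>

lemma quartic_diff_le: "(p - q) ^ 4 \<le> p ^ 4 - 4 * p ^ 3 * q + 8 * p\<^sup>2 * q\<^sup>2 + 3 * (q::real) ^ 4"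
proof -
  \<comment> \<open>The term linear in \<open>q\<close> is kept exactly, since it will have mean
    zero; only the odd term \<open>- 4 p q^3\<close> is absorbed into the two neighbouring
    ones.\<close>
  have "p ^ 4 - 4 * p ^ 3 * q + 8 * p\<^sup>2 * q\<^sup>2 + 3 * q ^ 4 - (p - q) ^ 4 = 2 * (q * (p + q))\<^sup>2"
    by (simp add: power2_eq_square power3_eq_cube power4_eq_xxxx algebra_simps)
  then show ?thesis by (smt (verit) zero_le_power2)
qed

lemma sum_sq_le: "(a + b)\<^sup>2 \<le> 2 * a\<^sup>2 + 2 * (b::real)\<^sup>2"
  using sum_squares_bound[of a b] by (simp add: power2_sum)

text \<open>Here \<open>u' = p - q\<close>, with \<open>p\<close> the noiseless image of
  \<open>v\<close> and \<open>q = (A + G / (1 + s v)) / D\<close>. The noiseless map multiplies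
  \<open>v\<close> by \<open>(1 - s) / (1 + s v)\<close>. The 5 is \<open>2 * (5/2)\<close>, where
  \<open>5/2\<close> bounds the square of \<open>1 / (1 + s v) \<le> 10/7\<close>; the coefficients
  8 and 50 arise from squaring once more.\<close>

lemma quartic_contraction:
  fixes v s A G D :: real
  assumes v: "\<bar>v\<bar> \<le> 3/10" and s: "0 \<le> s" "s \<le> 1" and D: "0 < D"
    and u': "(1 + s * v) * (1 + u') = 1 + v - (A * (1 + s * v) + G) / D"
  defines "p \<equiv> (1 - s) * v / (1 + s * v)"
  shows "u' ^ 4 \<le> (1 - s/2) * v ^ 4 - (4 * p ^ 3 / D * A + 4 * p ^ 3 / (1 + s * v) / D * G)
     + 8 * v\<^sup>2 * (2 * A\<^sup>2 + 5 * G\<^sup>2) / D\<^sup>2 + 3 * (8 * A ^ 4 + 50 * G ^ 4) / D ^ 4"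
    "\<bar>p\<bar> \<le> 1" "1 / (1 + s * v) \<le> 2" "0 < 1 + s * v"
proof -
  have "\<bar>s * v\<bar> \<le> s * (3/10)" unfolding abs_mult using mult_left_mono[OF v s(1)] s by simp
  then have sv: "1 - 3/10 * s \<le> 1 + s * v" by (simp add: abs_le_iff)
  then have sv7: "7/10 \<le> 1 + s * v" using s by linarith
  then show pos: "0 < 1 + s * v" by simp
  define w where "w = 1 / (1 + s * v)"
  have w0: "0 < w" using pos by (simp add: w_def)
  have wle: "w \<le> 10/7" using sv7 pos by (simp add: w_def divide_le_eq)
  then show "1 / (1 + s * v) \<le> 2" by (simp add: w_def)
  have pw: "p = (1 - s) * w * v" by (simp add: p_def w_def)
  \<comment> \<open>Half of the contraction is given away so that the bound holds uniformly for
    \<open>\<bar>v\<bar> \<le> 3/10\<close>.\<close>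
  have tw: "(1 - s) * w \<le> 1 - s / 2"
  proof -
    have "(1 - s/2) * (1 - 3/10 * s) = 1 - s + (s/5 + 3/20 * s\<^sup>2)"
      by (simp add: power2_eq_square field_simps)
    then have "1 - s \<le> (1 - s/2) * (1 - 3/10 * s)" using s zero_le_power2[of s] by linarith
    also have "\<dots> \<le> (1 - s/2) * (1 + s * v)" using s sv by (intro mult_left_mono) auto
    finally show ?thesis using pos by (simp add: w_def divide_le_eq)
  qed
  have tw0: "0 \<le> (1 - s) * w" using s w0 by simp
  have pv: "\<bar>p\<bar> \<le> \<bar>v\<bar>" unfolding pw abs_mult[of _ v] using tw tw0 s by (simp add: mult_left_le_one_le)
  then show "\<bar>p\<bar> \<le> 1" using v by simp
  define q where "q = (A + w * G) / D"
  have "(1 + s * v) * u' = (1 - s) * v - (A * (1 + s * v) + G) / D" using u' by (simp add: algebra_simps)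
  then have "u' = ((1 - s) * v - (A * (1 + s * v) + G) / D) / (1 + s * v)" using pos by (simp add: field_simps)
  moreover have "(c - (A * W + G) / D) / W = c / W - (A + 1 / W * G) / D" if "0 < W" for c W
    using that D by (simp add: field_simps)
  from this[OF pos] have "((1 - s) * v - (A * (1 + s * v) + G) / D) / (1 + s * v) = p - q"
    unfolding p_def q_def w_def .
  ultimately have "u' ^ 4 \<le> p ^ 4 - 4 * p ^ 3 * q + 8 * p\<^sup>2 * q\<^sup>2 + 3 * q ^ 4" using quartic_diff_le[of p q] by simp
  moreover have "p ^ 4 \<le> (1 - s/2) * v ^ 4"
  proof -
    have "((1 - s) * w) ^ 4 \<le> ((1 - s) * w) ^ 1" using tw0 tw s by (intro power_decreasing) auto
    then have "((1 - s) * w) ^ 4 \<le> 1 - s / 2" using tw by simp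
    then show ?thesis unfolding pw power_mult_distrib[of _ v] by (intro mult_right_mono) (auto simp: zero_le_even_power)
  qed
  moreover have q2: "q\<^sup>2 \<le> (2 * A\<^sup>2 + 5 * G\<^sup>2) / D\<^sup>2"
  proof -
    have "w\<^sup>2 \<le> (10/7)\<^sup>2" using w0 wle by (intro power_mono) auto
    then have "w\<^sup>2 * G\<^sup>2 \<le> 5/2 * G\<^sup>2" by (intro mult_right_mono) (auto simp: power2_eq_square)
    then have "(A + w * G)\<^sup>2 \<le> 2 * A\<^sup>2 + 5 * G\<^sup>2" using sum_sq_le[of A "w * G"] by (simp add: power_mult_distrib)
    then show ?thesis unfolding q_def power_divide by (intro divide_right_mono) auto
  qed
  moreover have "p\<^sup>2 * q\<^sup>2 \<le> v\<^sup>2 * ((2 * A\<^sup>2 + 5 * G\<^sup>2) / D\<^sup>2)"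
    using pv q2 by (intro mult_mono) (auto simp: abs_le_square_iff)
  moreover have "q ^ 4 \<le> (8 * A ^ 4 + 50 * G ^ 4) / D ^ 4"
  proof -
    have "q ^ 4 = (q\<^sup>2)\<^sup>2" by simp
    also have "\<dots> \<le> ((2 * A\<^sup>2 + 5 * G\<^sup>2) / D\<^sup>2)\<^sup>2" using q2 by (intro power_mono) auto
    also have "\<dots> = (2 * A\<^sup>2 + 5 * G\<^sup>2)\<^sup>2 / D ^ 4" by (simp add: power_divide)
    also have "\<dots> \<le> (8 * A ^ 4 + 50 * G ^ 4) / D ^ 4"
      using sum_sq_le[of "2 * A\<^sup>2" "5 * G\<^sup>2"] D by (intro divide_right_mono) (auto simp: power_mult_distrib)
    finally show ?thesis .
  qed
  moreover have "4 * p ^ 3 * q = 4 * p ^ 3 / D * A + 4 * p ^ 3 / (1 + s * v) / D * G"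
    by (simp add: q_def w_def add_divide_distrib distrib_left mult.assoc)
  moreover have "3 * (8 * A ^ 4 + 50 * G ^ 4) / D ^ 4 = 3 * ((8 * A ^ 4 + 50 * G ^ 4) / D ^ 4)"
    "8 * v\<^sup>2 * (2 * A\<^sup>2 + 5 * G\<^sup>2) / D\<^sup>2 = 8 * (v\<^sup>2 * ((2 * A\<^sup>2 + 5 * G\<^sup>2) / D\<^sup>2))" by simp_all
  ultimately show "u' ^ 4 \<le> (1 - s/2) * v ^ 4 - (4 * p ^ 3 / D * A + 4 * p ^ 3 / (1 + s * v) / D * G)
     + 8 * v\<^sup>2 * (2 * A\<^sup>2 + 5 * G\<^sup>2) / D\<^sup>2 + 3 * (8 * A ^ 4 + 50 * G ^ 4) / D ^ 4" by linarith
qed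

text \<open>The cost of passing from \<open>u\<close> to \<open>v\<close>. The shift is
  O(\<open>1 / D^2\<close>), and since \<open>4 * \<bar>u\<bar> \<le> 1\<close> the cross term
  \<open>4 u^3 h\<close> is at most of the form \<open>u^2 / D^2\<close>, the same form as the
  contribution of the noise.\<close>

lemma perturbed_powers_le:
  fixes u v D :: real
  assumes u: "\<bar>u\<bar> \<le> 1/4" and h: "\<bar>v - u\<bar> \<le> 3/2 / D\<^sup>2" and D: "D \<ge> 10"
  shows "v ^ 4 \<le> u ^ 4 + 2 * u\<^sup>2 / D\<^sup>2 + 1 / D ^ 4" "v\<^sup>2 \<le> 2 * u\<^sup>2 + 1 / D\<^sup>2"
proof -
  define h where "h = v - u"
  define z where "z = 1 / D\<^sup>2"
  have D2: "100 \<le> D\<^sup>2" using power_mono[OF D, of 2] by simp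
  have z: "0 \<le> z" "z \<le> 1/100" unfolding z_def using D2 frac_le[of 1 1 100 "D\<^sup>2"] by auto
  have hz: "\<bar>h\<bar> \<le> 3/2 * z" using h by (simp add: h_def z_def)
  have h2: "h\<^sup>2 \<le> 9/4 * z\<^sup>2"
    using power_mono[OF hz, of 2] by (simp add: power_mult_distrib power2_eq_square)
  have zz: "z\<^sup>2 \<le> 1/100 * z" using mult_right_mono[OF z(2,1)] by (simp add: power2_eq_square)
  have vh: "v = u + h" by (simp add: h_def)
  have "v\<^sup>2 \<le> 2 * u\<^sup>2 + 2 * h\<^sup>2" unfolding vh by (rule sum_sq_le)
  then show "v\<^sup>2 \<le> 2 * u\<^sup>2 + 1 / D\<^sup>2" using h2 zz z unfolding z_def[symmetric] by linarith
  have e: "v ^ 4 = u ^ 4 + 4 * u ^ 3 * h + 6 * (u\<^sup>2 * h\<^sup>2) + 4 * u * h ^ 3 + h ^ 4"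
    unfolding vh by (simp add: power2_eq_square power3_eq_cube power4_eq_xxxx algebra_simps)
  have t1: "4 * u ^ 3 * h \<le> u\<^sup>2 * (3/2 * z)"
  proof -
    have "4 * u ^ 3 * h \<le> \<bar>4 * u ^ 3 * h\<bar>" by simp
    also have "\<dots> = u\<^sup>2 * ((4 * \<bar>u\<bar>) * \<bar>h\<bar>)" by (simp add: abs_mult power3_eq_cube power2_eq_square)
    also have "\<dots> \<le> u\<^sup>2 * (1 * (3/2 * z))" using u hz by (intro mult_left_mono mult_mono) auto
    finally show ?thesis by simp
  qed
  have t3: "4 * u * h ^ 3 \<le> 2 * (u\<^sup>2 * h\<^sup>2) + 2 * h ^ 4"
  proof -
    have "2 * (u\<^sup>2 * h\<^sup>2) + 2 * h ^ 4 - 4 * u * h ^ 3 = 2 * (h * (u - h))\<^sup>2"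
      by (simp add: power2_eq_square power3_eq_cube power4_eq_xxxx algebra_simps)
    then show ?thesis by (smt (verit) zero_le_power2)
  qed
  have t2: "u\<^sup>2 * h\<^sup>2 \<le> u\<^sup>2 * (9/400 * z)" using h2 zz by (intro mult_left_mono) auto
  have t4: "3 * h ^ 4 \<le> z\<^sup>2"
  proof -
    have "h ^ 4 = h\<^sup>2 * h\<^sup>2" by (simp add: power2_eq_square power4_eq_xxxx)
    also have "\<dots> \<le> (9/4 * z\<^sup>2) * (9/4 * (1/100 * (1/100)))"
      using h2 zz z by (intro mult_mono) auto
    finally show ?thesis using zero_le_power2[of z] by linarith
  qed
  have "v ^ 4 \<le> u ^ 4 + 2 * (u\<^sup>2 * z) + z\<^sup>2"
    using t1 t2 t3 t4 mult_nonneg_nonneg[OF zero_le_power2[of u] z(1)] unfolding e by linarith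
  then show "v ^ 4 \<le> u ^ 4 + 2 * u\<^sup>2 / D\<^sup>2 + 1 / D ^ 4" by (simp add: z_def power_divide)
qed

text \<open>The remainder \<open>ln (1 + t) - t + t^2 / 2\<close> vanishes at 0 and has derivative
  \<open>t^2 / (1 + t)\<close>; between 0 and \<open>- y\<close> the denominator is at least
  \<open>2/5\<close>. Large negative \<open>y\<close> is allowed, as the noise requires.\<close>

lemma ln_taylor2:
  assumes "2/5 \<le> 1 - (y::real)"
  shows "\<bar>ln (1 - y) + y + y\<^sup>2 / 2\<bar> \<le> 5/2 * \<bar>y\<bar> ^ 3"
proof -
  define g where "g t = ln (1 + t) - t + t\<^sup>2 / 2" for t :: real
  have g': "(g has_real_derivative t\<^sup>2 / (1 + t)) (at t)" if "2/5 \<le> 1 + t" for t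
  proof -
    have "((\<lambda>t. ln (1 + t)) has_real_derivative 1 / (1 + t)) (at t)"
      using that by (auto intro!: derivative_eq_intros)
    moreover have "((\<lambda>t. t\<^sup>2 / 2) has_real_derivative t) (at t)"
      by (auto intro!: derivative_eq_intros)
    ultimately have "(g has_real_derivative (1 / (1 + t) - 1 + t)) (at t)"
      unfolding g_def[abs_def] by (intro DERIV_add DERIV_diff DERIV_ident)
    moreover have "1 / (1 + t) - 1 + t = t\<^sup>2 / (1 + t)" using that by (simp add: field_simps power2_eq_square)
    ultimately show ?thesis by simp
  qed
  have b: "\<bar>t\<^sup>2 / (1 + t)\<bar> \<le> 5/2 * y\<^sup>2" if "2/5 \<le> 1 + t" "\<bar>t\<bar> \<le> \<bar>y\<bar>" for t
  proof -
    have "t\<^sup>2 \<le> y\<^sup>2" using that(2) by (simp add: abs_le_square_iff)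
    then have "t\<^sup>2 / (1 + t) \<le> y\<^sup>2 / (2/5)" using that(1) by (intro frac_le) auto
    then show ?thesis using that(1) by simp
  qed
  have "\<bar>g (- y)\<bar> \<le> 5/2 * y\<^sup>2 * \<bar>y\<bar>"
  proof (cases "y = 0")
    case True then show ?thesis by (simp add: g_def)
  next
    case False
    then consider "y < 0" | "y > 0" by linarith
    then show ?thesis
    proof cases
      case 1
      then obtain t where t: "0 < t" "t < - y" "g (- y) - g 0 = (- y - 0) * (t\<^sup>2 / (1 + t))"
        using MVT2[of 0 "-y" g "\<lambda>t. t\<^sup>2 / (1 + t)"] g' by auto
      have "g (- y) = (- y) * (t\<^sup>2 / (1 + t))" using t(3) by (simp add: g_def[of 0])
      then have "\<bar>g (- y)\<bar> = \<bar>y\<bar> * \<bar>t\<^sup>2 / (1 + t)\<bar>" by (simp only: abs_minus_cancel abs_mult)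
      also have "\<dots> \<le> \<bar>y\<bar> * (5/2 * y\<^sup>2)" using t 1 by (intro mult_left_mono b) auto
      finally show ?thesis by (simp add: mult_ac)
    next
      case 2
      then obtain t where t: "- y < t" "t < 0" "g 0 - g (- y) = (0 - - y) * (t\<^sup>2 / (1 + t))"
        using MVT2[of "-y" 0 g "\<lambda>t. t\<^sup>2 / (1 + t)"] g' assms by auto
      have "g (- y) = (- y) * (t\<^sup>2 / (1 + t))" using t(3) by (simp add: g_def[of 0])
      then have "\<bar>g (- y)\<bar> = \<bar>y\<bar> * \<bar>t\<^sup>2 / (1 + t)\<bar>" by (simp only: abs_minus_cancel abs_mult)
      also have "\<dots> \<le> \<bar>y\<bar> * (5/2 * y\<^sup>2)" using t 2 assms by (intro mult_left_mono b) auto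
      finally show ?thesis by (simp add: mult_ac)
    qed
  qed
  also have "5/2 * y\<^sup>2 * \<bar>y\<bar> = 5/2 * \<bar>y\<bar> ^ 3" by (simp add: power2_eq_square power3_eq_cube)
  finally show ?thesis by (simp add: g_def)
qed

text \<open>Applied with \<open>e = \<delta> k / D k\<close>, \<open>y = u k\<close> and
  \<open>z = 1 / (D (Suc k))^2\<close>: the \<open>z^2\<close> part is the quadratic Taylor error,
  the other part comes from dropping the deviation in the denominator.\<close>

lemma drift_expansion:
  fixes e y :: real
  assumes e: "0 \<le> e" "e \<le> z" "z \<le> 1/100" and y: "\<bar>y\<bar> \<le> 1/4"
  shows "\<bar>ln (1 - e / (1 + y)) + e\<bar> \<le> 4 * z\<^sup>2 + 2 * \<bar>y\<bar> * z"
proof -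
  have y1: "3/4 \<le> 1 + y" using y by (simp add: abs_le_iff)
  have f: "0 \<le> e / (1 + y)" "e / (1 + y) \<le> 4/3 * e"
    using divide_left_mono[of "3/4" "1 + y" e] y1 e by auto
  have "\<bar>ln (1 + (- (e / (1 + y)))) - (- (e / (1 + y)))\<bar> \<le> 2 * (- (e / (1 + y)))\<^sup>2"
    using f e by (intro abs_ln_one_plus_x_minus_x_bound_nonpos) auto
  moreover have "(e / (1 + y))\<^sup>2 \<le> (4/3 * z)\<^sup>2" using f e by (intro power_mono) auto
  moreover have "(4/3 * z)\<^sup>2 = 16/9 * z\<^sup>2" by (simp add: power2_eq_square)
  moreover have "\<bar>e - e / (1 + y)\<bar> \<le> 2 * \<bar>y\<bar> * z"
  proof -
    have "e - e / (1 + y) = e / (1 + y) * y" using y1 by (simp add: field_simps)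
    then have "\<bar>e - e / (1 + y)\<bar> = e / (1 + y) * \<bar>y\<bar>" using f by (simp only: abs_mult abs_of_nonneg)
    also have "\<dots> \<le> (2 * z) * \<bar>y\<bar>"
    proof (rule mult_right_mono)
      show "e / (1 + y) \<le> 2 * z" using f e by linarith
    qed simp
    finally show ?thesis by (simp add: mult_ac)
  qed
  ultimately show ?thesis using zero_le_power2[of z] by (simp only: power2_minus minus_minus diff_minus_eq_add uminus_add_conv_diff) (simp add: abs_le_iff)
qed

text \<open>Bookkeeping over free reals, so that the arithmetic sees no sums. In its use
  \<open>q\<close> is the telescoped boundary term, \<open>e\<close> the total drift,
  \<open>m\<close> the total variance with approximation \<open>p\<close>, and \<open>y\<close> the
  logarithm of the last factor.\<close>

lemma combine_errors:
  fixes a r z m X e q p L y l \<alpha> R :: real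
  assumes "\<bar>a - r + z + m / 2 + X + e - q\<bar> \<le> R" "\<bar>m - p\<bar> \<le> 4 * \<alpha>" "\<bar>q - L\<bar> \<le> 1" "\<bar>y - l\<bar> \<le> 1" "\<bar>e - L / 2\<bar> \<le> 1"
  shows "\<bar>a + y - (r + l + (L / 2 - p / 2)) + z\<bar> \<le> 2 * \<alpha> + 4 + R + \<bar>X\<bar>"
  using assms by linarith

section \<open>The random recursion\<close>

text \<open>
  In the application \<open>A k\<close> is \<open>a (k + 1)\<close> and \<open>B k\<close> is \<open>(b k)^2 - k\<close>, so that \<open>(A k, B k)\<close> is the noise
  entering step \<open>k\<close>; \<open>B 0\<close> is a dummy.
\<close>
locale noise = prob_space M for M :: "'w measure" +
  fixes \<alpha> :: real and Fm :: "nat \<Rightarrow> 'w measure" and A B :: "nat \<Rightarrow> 'w \<Rightarrow> real"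
  assumes alpha_pos: "\<alpha> > 0"
    and subalg: "\<And>k. subalgebra M (Fm k)"
    and filtration: "\<And>k. subalgebra (Fm (Suc k)) (Fm k)"
    and A_adapted: "\<And>k. A k \<in> borel_measurable (Fm k)"
    and B_adapted: "\<And>k. B k \<in> borel_measurable (Fm k)"
    and indep: "\<And>k f g. f \<in> borel_measurable (Fm k) \<Longrightarrow> g \<in> borel_measurable (borel \<Otimes>\<^sub>M borel) \<Longrightarrow>
      indep_var borel (f :: 'w \<Rightarrow> real) borel (\<lambda>\<omega>. g (A (Suc k) \<omega>, B (Suc k) \<omega>))"
    and A_int: "\<And>k. integrable M (\<lambda>\<omega>. A k \<omega> ^ 4)"
    and A_moments: "\<And>k. expectation (A k) = 0" "\<And>k. expectation (\<lambda>\<omega>. (A k \<omega>)\<^sup>2) = \<alpha>"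
      "\<And>k. expectation (\<lambda>\<omega>. A k \<omega> ^ 4) = 3 * \<alpha>\<^sup>2"
    and AB_uncorrelated: "\<And>k. expectation (\<lambda>\<omega>. A (Suc k) \<omega> * B (Suc k) \<omega>) = 0"
    and B_int: "\<And>k. integrable M (\<lambda>\<omega>. B (Suc k) \<omega> ^ 4)"
    and B_moments: "\<And>k. expectation (B (Suc k)) = 0"
      "\<And>k. expectation (\<lambda>\<omega>. (B (Suc k) \<omega>)\<^sup>2) = \<alpha> * real (Suc k)"
      "\<And>k. expectation (\<lambda>\<omega>. B (Suc k) \<omega> ^ 4) = 3 * \<alpha>\<^sup>2 * (real (Suc k))\<^sup>2 + 6 * \<alpha> ^ 3 * real (Suc k)"
begin

lemma measurable_Fm: "f \<in> borel_measurable (Fm k) \<Longrightarrow> f \<in> borel_measurable M"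
  using subalg by (rule measurable_from_subalg)

lemma A_measurable [measurable]: "A k \<in> borel_measurable M"
  using A_adapted by (rule measurable_Fm)

lemma B_measurable [measurable]: "B k \<in> borel_measurable M"
  using B_adapted by (rule measurable_Fm)

text \<open>Takes the place of conditional expectation: a factor known at time \<open>k\<close>
  splits off from any function of the next noise pair.\<close>

lemma indep_mult:
  assumes f: "f \<in> borel_measurable (Fm k)" and g: "g \<in> borel_measurable (borel \<Otimes>\<^sub>M borel)"
    and fi: "integrable M f" and gi: "integrable M (\<lambda>\<omega>. g (A (Suc k) \<omega>, B (Suc k) \<omega>))"
  shows "integrable M (\<lambda>\<omega>. f \<omega> * g (A (Suc k) \<omega>, B (Suc k) \<omega>) :: real)"
    "expectation (\<lambda>\<omega>. f \<omega> * g (A (Suc k) \<omega>, B (Suc k) \<omega>)) = expectation f * expectation (\<lambda>\<omega>. g (A (Suc k) \<omega>, B (Suc k) \<omega>))"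
proof -
  have i: "indep_var borel f borel (\<lambda>\<omega>. g (A (Suc k) \<omega>, B (Suc k) \<omega>))" using f g by (rule indep)
  show "integrable M (\<lambda>\<omega>. f \<omega> * g (A (Suc k) \<omega>, B (Suc k) \<omega>))" by (rule indep_var_integrable[OF i fi gi])
  show "expectation (\<lambda>\<omega>. f \<omega> * g (A (Suc k) \<omega>, B (Suc k) \<omega>)) = expectation f * expectation (\<lambda>\<omega>. g (A (Suc k) \<omega>, B (Suc k) \<omega>))"
    by (rule indep_var_lebesgue_integral[OF i fi gi])
qed

lemma A_integrable: "m \<le> 4 \<Longrightarrow> integrable M (\<lambda>\<omega>. \<bar>A k \<omega>\<bar> ^ m)" "m \<le> 4 \<Longrightarrow> integrable M (\<lambda>\<omega>. A k \<omega> ^ m)"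
  using integrable_power_le[OF A_measurable A_int] by auto

lemma B_integrable: "m \<le> 4 \<Longrightarrow> integrable M (\<lambda>\<omega>. \<bar>B (Suc k) \<omega>\<bar> ^ m)" "m \<le> 4 \<Longrightarrow> integrable M (\<lambda>\<omega>. B (Suc k) \<omega> ^ m)"
  using integrable_power_le[OF B_measurable B_int] by auto

lemma integrable_bounded:
  assumes "f \<in> borel_measurable M" "\<And>\<omega>. \<bar>f \<omega> :: real\<bar> \<le> C"
  shows "integrable M f"
  by (rule integrable_const_bound[of _ C]) (use assms in auto)

end

section \<open>The Riccati process up to its exit time\<close>

locale edge_noise = noise M \<alpha> Fm A B + edge x n
  for M :: "'w measure" and \<alpha> Fm A B x n
begin

text \<open>Division by \<open>\<rho> k\<close> brings \<open>B k\<close> to the scale of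
  \<open>A k\<close>: as \<open>k / \<rho>^2 = \<tau>\<close>, the variance becomes
  \<open>\<alpha> * \<tau> k \<le> \<alpha>\<close>.\<close>

definition G :: "nat \<Rightarrow> 'w \<Rightarrow> real" where "G k \<omega> = B k \<omega> / \<rho> k"

text \<open>Ratios of consecutive leading minors of \<open>x - T\<close>. Division by zero keeps the
  process total; its values are interpreted only while the path has not left the window, where they
  are positive.\<close>

primrec Y :: "nat \<Rightarrow> 'w \<Rightarrow> real" where
  "Y 0 \<omega> = x - A 0 \<omega>"
| "Y (Suc k) \<omega> = x - A (Suc k) \<omega> - (real (Suc k) + B (Suc k) \<omega>) / Y k \<omega>"

definition u :: "nat \<Rightarrow> 'w \<Rightarrow> real" where "u k \<omega> = (Y k \<omega> - \<rho> k) / D k"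

text \<open>The survival indicator up to time \<open>k\<close>, adapted and decreasing in
  \<open>k\<close>. It is a real number so that it can multiply integrands; all moments below are
  truncated by it.\<close>

definition I :: "nat \<Rightarrow> 'w \<Rightarrow> real" where "I k \<omega> = (if \<forall>j\<le>k. \<bar>u j \<omega>\<bar> \<le> 1/4 then 1 else 0)"

text \<open>A common bound for the two noise combinations that \<open>quartic_contraction\<close>
  produces: \<open>7 = 2 + 5\<close>, \<open>174 = 8 * 3 + 50 * 3\<close> and
  \<open>300 = 50 * 6\<close>.\<close>

definition K :: real where "K = 7 * \<alpha> + 174 * \<alpha>\<^sup>2 + 300 * \<alpha> ^ 3"

lemma K_pos: "0 < K" using alpha_pos by (simp add: K_def add_pos_pos)

lemma Y_adapted: "Y k \<in> borel_measurable (Fm k)"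
proof (induction k)
  case 0
  have "(\<lambda>\<omega>. x - A 0 \<omega>) \<in> borel_measurable (Fm 0)" using A_adapted[of 0] by simp
  then show ?case by (simp add: fun_eq_iff[symmetric] cong: measurable_cong)
next
  case (Suc k)
  have [measurable]: "Y k \<in> borel_measurable (Fm (Suc k))" using filtration Suc by (rule measurable_from_subalg)
  have [measurable]: "A (Suc k) \<in> borel_measurable (Fm (Suc k))" "B (Suc k) \<in> borel_measurable (Fm (Suc k))"
    by (rule A_adapted B_adapted)+
  have "(\<lambda>\<omega>. x - A (Suc k) \<omega> - (real (Suc k) + B (Suc k) \<omega>) / Y k \<omega>) \<in> borel_measurable (Fm (Suc k))" by measurable
  then show ?case by (simp cong: measurable_cong)
qed

lemma subalg_le: "j \<le> k \<Longrightarrow> subalgebra (Fm k) (Fm j)"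
proof (induction k rule: dec_induct)
  case base show ?case by (simp add: subalgebra_def)
next
  case (step k) then show ?case using filtration[of k] by (auto simp: subalgebra_def)
qed

lemma u_adapted: "j \<le> k \<Longrightarrow> u j \<in> borel_measurable (Fm k)"
proof -
  assume j: "j \<le> k"
  have [measurable]: "Y j \<in> borel_measurable (Fm k)" by (rule measurable_from_subalg[OF subalg_le[OF j] Y_adapted])
  show ?thesis unfolding u_def[abs_def] by measurable
qed

lemma I_adapted: "I k \<in> borel_measurable (Fm k)"
proof -
  have [measurable]: "\<And>j. j \<in> {..k} \<Longrightarrow> u j \<in> borel_measurable (Fm k)" using u_adapted by auto
  have "(\<lambda>\<omega>. if \<forall>j\<in>{..k}. \<bar>u j \<omega>\<bar> \<le> 1/4 then 1 else 0 :: real) \<in> borel_measurable (Fm k)" by measurable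
  then show ?thesis by (simp add: I_def[abs_def] Ball_def)
qed

lemma u_measurable [measurable]: "u k \<in> borel_measurable M" and I_measurable [measurable]: "I k \<in> borel_measurable M"
  and Y_measurable [measurable]: "Y k \<in> borel_measurable M" and G_measurable [measurable]: "G k \<in> borel_measurable M"
  using measurable_Fm[OF u_adapted] measurable_Fm[OF I_adapted] measurable_Fm[OF Y_adapted]
  by (auto simp: G_def[abs_def])

lemma I_bounds: "0 \<le> I k \<omega>" "I k \<omega> \<le> 1" "\<bar>I k \<omega>\<bar> \<le> 1" "I k \<omega> * I k \<omega> = I k \<omega>" by (auto simp: I_def)

lemma I_Suc: "I (Suc k) \<omega> = I k \<omega> * (if \<bar>u (Suc k) \<omega>\<bar> \<le> 1/4 then 1 else 0)"
  by (auto simp: I_def le_Suc_eq)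

lemma I_nz: "I k \<omega> \<noteq> 0 \<Longrightarrow> j \<le> k \<Longrightarrow> \<bar>u j \<omega>\<bar> \<le> 1/4" by (auto simp: I_def split: if_splits)

lemma I_cases: "I k \<omega> = 0 \<or> (I k \<omega> = 1 \<and> \<bar>u k \<omega>\<bar> \<le> 1/4)" by (auto simp: I_def)

lemma Iu_bound: "\<bar>I k \<omega> * u k \<omega> ^ m\<bar> \<le> 1"
proof -
  have "\<bar>u k \<omega>\<bar> ^ m \<le> 1" if "\<bar>u k \<omega>\<bar> \<le> 1/4" using that by (intro power_le_one) auto
  then show ?thesis using I_cases[of k \<omega>] by (auto simp: abs_mult power_abs)
qed

lemma Iu_integrable: "integrable M (\<lambda>\<omega>. I k \<omega> * u k \<omega> ^ m)"
  by (rule integrable_bounded[of _ 1]) (use Iu_bound in auto)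

lemma I_integrable: "integrable M (I k)" using Iu_integrable[of k 0] by simp

lemma EI_le: "expectation (I k) \<le> 1"
  using integral_mono[OF I_integrable[of k], of "\<lambda>_. 1"] I_bounds by (simp add: prob_space)

lemma rho_ge_5: "k \<le> n \<Longrightarrow> 5 \<le> \<rho> k" using rho_bounds(1)[of k] x_ge_10 by simp

lemma index_le_rho_sq: "Suc k \<le> n \<Longrightarrow> real (Suc k) / (\<rho> (Suc k))\<^sup>2 = \<tau> (Suc k)"
  using rho_r[of "Suc k"] rho_ge_5[of "Suc k"] by (simp add: \<tau>_def power2_eq_square field_simps)

lemma G_integrable: "m \<le> 4 \<Longrightarrow> integrable M (\<lambda>\<omega>. \<bar>G (Suc k) \<omega>\<bar> ^ m)" "m \<le> 4 \<Longrightarrow> integrable M (\<lambda>\<omega>. G (Suc k) \<omega> ^ m)"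
  using B_integrable[of m k] by (simp_all add: G_def power_divide abs_divide)

lemma G_moments:
  assumes k: "k < n"
  shows "expectation (G (Suc k)) = 0" "expectation (\<lambda>\<omega>. (G (Suc k) \<omega>)\<^sup>2) = \<alpha> * \<tau> (Suc k)"
    "expectation (\<lambda>\<omega>. (G (Suc k) \<omega>)\<^sup>2) \<le> \<alpha>"
    "expectation (\<lambda>\<omega>. G (Suc k) \<omega> ^ 4) \<le> 3 * \<alpha>\<^sup>2 + 6 * \<alpha> ^ 3"
proof -
  have k': "Suc k \<le> n" using k by simp
  let ?P = "\<rho> (Suc k)"
  show "expectation (G (Suc k)) = 0" by (simp add: G_def[abs_def] B_moments)
  show 2: "expectation (\<lambda>\<omega>. (G (Suc k) \<omega>)\<^sup>2) = \<alpha> * \<tau> (Suc k)"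
    unfolding index_le_rho_sq[OF k', symmetric] by (simp add: G_def power_divide B_moments)
  show "expectation (\<lambda>\<omega>. (G (Suc k) \<omega>)\<^sup>2) \<le> \<alpha>"
    unfolding 2 using tau_bounds(2)[OF k'] alpha_pos by (simp add: mult_left_le)
  have "expectation (\<lambda>\<omega>. G (Suc k) \<omega> ^ 4) = (3 * \<alpha>\<^sup>2 * (real (Suc k))\<^sup>2 + 6 * \<alpha> ^ 3 * real (Suc k)) / ?P ^ 4"
    by (simp add: G_def power_divide B_moments)
  also have "\<dots> = 3 * \<alpha>\<^sup>2 * (real (Suc k) / ?P\<^sup>2)\<^sup>2 + 6 * \<alpha> ^ 3 * (real (Suc k) / ?P\<^sup>2) * (1 / ?P\<^sup>2)"
    by (simp add: power_divide add_divide_distrib power2_eq_square power4_eq_xxxx)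
  also have "\<dots> = 3 * \<alpha>\<^sup>2 * (\<tau> (Suc k))\<^sup>2 + 6 * \<alpha> ^ 3 * \<tau> (Suc k) * (1 / ?P\<^sup>2)"
    unfolding index_le_rho_sq[OF k'] ..
  also have "\<dots> \<le> 3 * \<alpha>\<^sup>2 * 1 + 6 * \<alpha> ^ 3 * 1 * 1"
  proof (intro add_mono mult_mono)
    show "(\<tau> (Suc k))\<^sup>2 \<le> 1" using tau_bounds[OF k'] by (intro power_le_one)
    show "1 / ?P\<^sup>2 \<le> 1" using rho_ge_5[OF k'] power_mono[of 5 ?P 2] by simp
  qed (use tau_bounds[OF k'] alpha_pos in auto)
  finally show "expectation (\<lambda>\<omega>. G (Suc k) \<omega> ^ 4) \<le> 3 * \<alpha>\<^sup>2 + 6 * \<alpha> ^ 3" by simp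
qed

lemma Q_moments:
  assumes k: "k < n"
  shows "expectation (\<lambda>\<omega>. 2 * (A (Suc k) \<omega>)\<^sup>2 + 5 * (G (Suc k) \<omega>)\<^sup>2) \<le> K"
    "expectation (\<lambda>\<omega>. 8 * A (Suc k) \<omega> ^ 4 + 50 * G (Suc k) \<omega> ^ 4) \<le> K"
proof -
  note g = G_moments[OF k] and i = A_integrable(2)[of 2 "Suc k"] A_integrable(2)[of 4 "Suc k"] G_integrable(2)[of 2 k] G_integrable(2)[of 4 k]
  have p: "0 \<le> \<alpha>\<^sup>2" "0 \<le> \<alpha> ^ 3" using alpha_pos by auto
  have "expectation (\<lambda>\<omega>. 2 * (A (Suc k) \<omega>)\<^sup>2 + 5 * (G (Suc k) \<omega>)\<^sup>2) = 2 * \<alpha> + 5 * expectation (\<lambda>\<omega>. (G (Suc k) \<omega>)\<^sup>2)"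
    using i by (simp add: A_moments)
  then show "expectation (\<lambda>\<omega>. 2 * (A (Suc k) \<omega>)\<^sup>2 + 5 * (G (Suc k) \<omega>)\<^sup>2) \<le> K"
    using g(3) p unfolding K_def by linarith
  have "expectation (\<lambda>\<omega>. 8 * A (Suc k) \<omega> ^ 4 + 50 * G (Suc k) \<omega> ^ 4) = 8 * (3 * \<alpha>\<^sup>2) + 50 * expectation (\<lambda>\<omega>. G (Suc k) \<omega> ^ 4)"
    using i by (simp add: A_moments)
  then show "expectation (\<lambda>\<omega>. 8 * A (Suc k) \<omega> ^ 4 + 50 * G (Suc k) \<omega> ^ 4) \<le> K"
    using g(4) p alpha_pos unfolding K_def by linarith
qed

text \<open>The martingale property in the form used for truncated quantities. The bound on
  \<open>f\<close> serves integrability; the products with the linear noise vanish because that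
  noise is centred and independent of the past.\<close>

lemma past_mult:
  assumes f: "f \<in> borel_measurable (Fm k)" "\<And>\<omega>. \<bar>f \<omega>\<bar> \<le> C"
  shows "integrable M (\<lambda>\<omega>. f \<omega> * A (Suc k) \<omega>)" "expectation (\<lambda>\<omega>. f \<omega> * A (Suc k) \<omega>) = 0"
    "integrable M (\<lambda>\<omega>. f \<omega> * G (Suc k) \<omega>)" "k < n \<Longrightarrow> expectation (\<lambda>\<omega>. f \<omega> * G (Suc k) \<omega>) = 0"
    "integrable M (\<lambda>\<omega>. f \<omega> * (a * (A (Suc k) \<omega>)\<^sup>2 + b * (G (Suc k) \<omega>)\<^sup>2))"
    "expectation (\<lambda>\<omega>. f \<omega> * (a * (A (Suc k) \<omega>)\<^sup>2 + b * (G (Suc k) \<omega>)\<^sup>2))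
      = expectation f * expectation (\<lambda>\<omega>. a * (A (Suc k) \<omega>)\<^sup>2 + b * (G (Suc k) \<omega>)\<^sup>2)"
proof -
  have fi: "integrable M f" by (rule integrable_bounded[OF measurable_Fm[OF f(1)] f(2)])
  have i1: "integrable M (A (Suc k))" using A_integrable(2)[of 1] by simp
  have i2: "integrable M (\<lambda>\<omega>. B (Suc k) \<omega> / \<rho> (Suc k))" using G_integrable(2)[of 1] by (simp add: G_def)
  have i3: "integrable M (\<lambda>\<omega>. a * (A (Suc k) \<omega>)\<^sup>2 + b * (G (Suc k) \<omega>)\<^sup>2)"
    using A_integrable(2)[of 2] G_integrable(2)[of 2] by simp
  have "integrable M (\<lambda>\<omega>. f \<omega> * fst (A (Suc k) \<omega>, B (Suc k) \<omega>)) \<and>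
     expectation (\<lambda>\<omega>. f \<omega> * fst (A (Suc k) \<omega>, B (Suc k) \<omega>)) = expectation f * expectation (\<lambda>\<omega>. fst (A (Suc k) \<omega>, B (Suc k) \<omega>))"
    by (intro conjI indep_mult[OF f(1) _ fi]) (use i1 in auto)
  then show "integrable M (\<lambda>\<omega>. f \<omega> * A (Suc k) \<omega>)" "expectation (\<lambda>\<omega>. f \<omega> * A (Suc k) \<omega>) = 0"
    by (auto simp: A_moments)
  have "integrable M (\<lambda>\<omega>. f \<omega> * (\<lambda>p. snd p / \<rho> (Suc k)) (A (Suc k) \<omega>, B (Suc k) \<omega>)) \<and>
     expectation (\<lambda>\<omega>. f \<omega> * (\<lambda>p. snd p / \<rho> (Suc k)) (A (Suc k) \<omega>, B (Suc k) \<omega>)) = expectation f * expectation (\<lambda>\<omega>. (\<lambda>p. snd p / \<rho> (Suc k)) (A (Suc k) \<omega>, B (Suc k) \<omega>))"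
    by (intro conjI indep_mult[OF f(1) _ fi]) (use i2 in \<open>auto simp: G_def\<close>)
  then show "integrable M (\<lambda>\<omega>. f \<omega> * G (Suc k) \<omega>)" "k < n \<Longrightarrow> expectation (\<lambda>\<omega>. f \<omega> * G (Suc k) \<omega>) = 0"
    by (auto simp: G_def B_moments)
  have "integrable M (\<lambda>\<omega>. f \<omega> * (\<lambda>p. a * (fst p)\<^sup>2 + b * (snd p / \<rho> (Suc k))\<^sup>2) (A (Suc k) \<omega>, B (Suc k) \<omega>)) \<and>
     expectation (\<lambda>\<omega>. f \<omega> * (\<lambda>p. a * (fst p)\<^sup>2 + b * (snd p / \<rho> (Suc k))\<^sup>2) (A (Suc k) \<omega>, B (Suc k) \<omega>)) = expectation f * expectation (\<lambda>\<omega>. (\<lambda>p. a * (fst p)\<^sup>2 + b * (snd p / \<rho> (Suc k))\<^sup>2) (A (Suc k) \<omega>, B (Suc k) \<omega>))"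
    by (intro conjI indep_mult[OF f(1) _ fi]) (use i3 in \<open>auto simp: G_def\<close>)
  then show "integrable M (\<lambda>\<omega>. f \<omega> * (a * (A (Suc k) \<omega>)\<^sup>2 + b * (G (Suc k) \<omega>)\<^sup>2))"
    "expectation (\<lambda>\<omega>. f \<omega> * (a * (A (Suc k) \<omega>)\<^sup>2 + b * (G (Suc k) \<omega>)\<^sup>2))
      = expectation f * expectation (\<lambda>\<omega>. a * (A (Suc k) \<omega>)\<^sup>2 + b * (G (Suc k) \<omega>)\<^sup>2)"
    by (simp_all add: G_def)
qed

section \<open>Drift of the truncated fourth moment and the exit probability\<close>

definition K' :: real where "K' = (2 + 16 * K)\<^sup>2 + 11 * K + 1"

text \<open>After averaging \<open>quartic_contraction\<close>, the noise and the motion of the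
  fixed point leave a term of order \<open>E u^2 / D^2\<close>. Half of the contraction
  \<open>s / 2\<close> is spent on absorbing it, which costs
  \<open>1 / (D^4 s) \<le> x / D^5\<close>; the other half survives and yields
  \<open>D / (4 x)\<close>.\<close>

lemma fourth_moment_step:
  assumes k: "k < n"
  shows "integrable M (\<lambda>\<omega>. I k \<omega> * u (Suc k) \<omega> ^ 4)"
    "expectation (\<lambda>\<omega>. I k \<omega> * u (Suc k) \<omega> ^ 4)
      \<le> (1 - D (Suc k) / (4 * x)) * expectation (\<lambda>\<omega>. I k \<omega> * u k \<omega> ^ 4) + K' * x * (1 / D (Suc k) ^ 5)"
proof -
  have k': "Suc k \<le> n" using k by simp
  define d where "d = D (Suc k)"
  define s where "s = 1 - \<tau> (Suc k)"
  define z where "z = 1 / d\<^sup>2"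
  have d: "10 \<le> d" "d \<le> x" "0 < d" using D_ge_10[OF k'] D_le_x by (auto simp: d_def)
  have s: "0 \<le> s" "s \<le> 1" "d / x \<le> s" using tau_bounds[OF k'] by (auto simp: s_def d_def)
  have sp: "0 < s" using s(3) d x_pos by (smt (verit) divide_pos_pos)
  have z0: "0 \<le> z" by (simp add: z_def)
  have zz: "z\<^sup>2 = 1 / d ^ 4" by (simp add: z_def power_divide)
  have d5: "d ^ 5 = d ^ 4 * d" by (simp add: eval_nat_numeral)
  let ?v = "\<lambda>\<omega>. v k (u k \<omega>)"
  let ?A = "A (Suc k)" and ?G = "G (Suc k)"
  define p where "p \<omega> = (1 - s) * ?v \<omega> / (1 + s * ?v \<omega>)" for \<omega>
  define f1 where "f1 \<omega> = I k \<omega> * (4 * p \<omega> ^ 3 / d)" for \<omega>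
  define f2 where "f2 \<omega> = I k \<omega> * (4 * p \<omega> ^ 3 / (1 + s * ?v \<omega>) / d)" for \<omega>
  define g where "g \<omega> = I k \<omega> * (8 * (2 * (u k \<omega>)\<^sup>2 + z) * z)" for \<omega>
  let ?Q2 = "\<lambda>\<omega>. 2 * (?A \<omega>)\<^sup>2 + 5 * (?G \<omega>)\<^sup>2" and ?Q4 = "\<lambda>\<omega>. 8 * ?A \<omega> ^ 4 + 50 * ?G \<omega> ^ 4"
  define R where "R \<omega> = (1 - s/2) * (I k \<omega> * u k \<omega> ^ 4 + 2 * z * (I k \<omega> * (u k \<omega>)\<^sup>2) + z\<^sup>2) - (f1 \<omega> * ?A \<omega> + f2 \<omega> * ?G \<omega>)
      + g \<omega> * ?Q2 \<omega> + 3 * z\<^sup>2 * ?Q4 \<omega>" for \<omega>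
  have [measurable]: "u k \<in> borel_measurable (Fm k)" "I k \<in> borel_measurable (Fm k)" by (auto intro: u_adapted I_adapted)
  have [measurable]: "f1 \<in> borel_measurable (Fm k)" "f2 \<in> borel_measurable (Fm k)" "g \<in> borel_measurable (Fm k)"
    unfolding f1_def[abs_def] f2_def[abs_def] g_def[abs_def] p_def v_def by measurable
  have Q: "integrable M ?Q2" "integrable M ?Q4"
    using A_integrable(2)[of 2 "Suc k"] A_integrable(2)[of 4 "Suc k"] G_integrable(2)[of 2 k] G_integrable(2)[of 4 k] by simp_all
  have eqn: "(1 + s * ?v \<omega>) * (1 + u (Suc k) \<omega>) = 1 + ?v \<omega> - (?A \<omega> * (1 + s * ?v \<omega>) + ?G \<omega>) / d"
    if "\<bar>u k \<omega>\<bar> \<le> 1/4" for \<omega>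
    unfolding s_def d_def G_def by (rule riccati_step(2)[OF k u_def that _ u_def]) simp
  \<comment> \<open>Off the event \<open>I k = 1\<close> the left side is 0 and \<open>R\<close> is
    nonnegative. The bounds 8, 8 and 24 are crude, as they are needed for integrability
    alone.\<close>
  have pw: "I k \<omega> * u (Suc k) \<omega> ^ 4 \<le> R \<omega> \<and> \<bar>f1 \<omega>\<bar> \<le> 8 \<and> \<bar>f2 \<omega>\<bar> \<le> 8 \<and> \<bar>g \<omega>\<bar> \<le> 24" for \<omega>
  proof (cases "I k \<omega> = 0")
    case True
    have "0 \<le> R \<omega>" using s by (simp add: R_def f1_def f2_def g_def True zero_le_even_power)
    then show ?thesis by (simp add: True f1_def f2_def g_def)
  next
    case False
    then have I1: "I k \<omega> = 1" and ub: "\<bar>u k \<omega>\<bar> \<le> 1/4" using I_cases[of k \<omega>] by auto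
    note qc = quartic_contraction[OF v_bounds(2)[OF k ub] s(1,2) d(3) eqn[OF ub], folded p_def]
    note pp = perturbed_powers_le[OF ub v_bounds(1)[OF k ub, folded d_def] d(1), folded zz]
    have z1: "z \<le> 1" using power_mono[OF d(1), of 2] frac_le[of 1 1 1 "d\<^sup>2"] by (simp add: z_def)
    have "u (Suc k) \<omega> ^ 4 \<le> (1 - s/2) * ?v \<omega> ^ 4 - (4 * p \<omega> ^ 3 / d * ?A \<omega> + 4 * p \<omega> ^ 3 / (1 + s * ?v \<omega>) / d * ?G \<omega>)
        + 8 * (?v \<omega>)\<^sup>2 * z * ?Q2 \<omega> + 3 * z\<^sup>2 * ?Q4 \<omega>"
      using qc(1) by (simp add: z_def power_divide)
    also have "\<dots> \<le> (1 - s/2) * (u k \<omega> ^ 4 + 2 * z * (u k \<omega>)\<^sup>2 + z\<^sup>2) - (4 * p \<omega> ^ 3 / d * ?A \<omega> + 4 * p \<omega> ^ 3 / (1 + s * ?v \<omega>) / d * ?G \<omega>)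
        + 8 * (2 * (u k \<omega>)\<^sup>2 + z) * z * ?Q2 \<omega> + 3 * z\<^sup>2 * ?Q4 \<omega>"
    proof (intro add_right_mono add_mono diff_right_mono)
      have "2 * (u k \<omega>)\<^sup>2 / d\<^sup>2 = 2 * z * (u k \<omega>)\<^sup>2" by (simp add: z_def)
      then show "(1 - s/2) * ?v \<omega> ^ 4 \<le> (1 - s/2) * (u k \<omega> ^ 4 + 2 * z * (u k \<omega>)\<^sup>2 + z\<^sup>2)"
        using pp(1) s by (intro mult_left_mono) auto
      show "8 * (?v \<omega>)\<^sup>2 * z * ?Q2 \<omega> \<le> 8 * (2 * (u k \<omega>)\<^sup>2 + z) * z * ?Q2 \<omega>"
        using pp(2) z0 by (intro mult_right_mono mult_left_mono) (auto simp: z_def)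
    qed
    also have "\<dots> = R \<omega>" by (simp add: R_def I1 f1_def f2_def g_def)
    finally have 1: "I k \<omega> * u (Suc k) \<omega> ^ 4 \<le> R \<omega>" by (simp add: I1)
    have p3: "\<bar>p \<omega> ^ 3\<bar> \<le> 1" using qc(2) by (simp add: power_abs power_le_one)
    have a: "\<bar>4 * p \<omega> ^ 3 / d\<bar> \<le> 4"
    proof -
      have "\<bar>4 * p \<omega> ^ 3 / d\<bar> = 4 * \<bar>p \<omega> ^ 3\<bar> / d" using d by (simp add: abs_mult)
      also have "\<dots> \<le> 4 * 1 / 1" using p3 d by (intro frac_le mult_left_mono) auto
      finally show ?thesis by simp
    qed
    then have f1: "\<bar>f1 \<omega>\<bar> \<le> 8" by (simp add: f1_def I1)
    have "f2 \<omega> = (4 * p \<omega> ^ 3 / d) * (1 / (1 + s * ?v \<omega>))" by (simp add: f2_def I1)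
    then have "\<bar>f2 \<omega>\<bar> = \<bar>4 * p \<omega> ^ 3 / d\<bar> * \<bar>1 / (1 + s * ?v \<omega>)\<bar>" by (simp only: abs_mult)
    also have "\<dots> \<le> 4 * 2" using a qc(3,4) by (intro mult_mono) auto
    finally have f2: "\<bar>f2 \<omega>\<bar> \<le> 8" by simp
    have "(u k \<omega>)\<^sup>2 \<le> 1" using ub abs_square_le_1[of "u k \<omega>"] by simp
    then have "8 * (2 * (u k \<omega>)\<^sup>2 + z) * z \<le> 8 * (2 * 1 + 1) * 1" using z0 z1 by (intro mult_mono add_mono) auto
    moreover have "0 \<le> 8 * (2 * (u k \<omega>)\<^sup>2 + z) * z" using z0 by simp
    ultimately have "\<bar>g \<omega>\<bar> \<le> 24" by (simp add: g_def I1)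
    with 1 f1 f2 show ?thesis by simp
  qed
  have b: "\<bar>f1 \<omega>\<bar> \<le> 8" "\<bar>f2 \<omega>\<bar> \<le> 8" "\<bar>g \<omega>\<bar> \<le> 24" for \<omega> using pw by auto
  note pm1 = past_mult[of f1 k 8] and pm2 = past_mult[of f2 k 8] and pmg = past_mult[of g k 24]
  have ints: "integrable M (\<lambda>\<omega>. f1 \<omega> * ?A \<omega>)" "integrable M (\<lambda>\<omega>. f2 \<omega> * ?G \<omega>)" "integrable M (\<lambda>\<omega>. g \<omega> * ?Q2 \<omega>)"
    using pm1(1) pm2(3) pmg(5) b by auto
  have Iu2: "integrable M (\<lambda>\<omega>. I k \<omega> * (u k \<omega>)\<^sup>2)" by (rule Iu_integrable)
  have Iu4: "integrable M (\<lambda>\<omega>. I k \<omega> * u k \<omega> ^ 4)" by (rule Iu_integrable)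
  have Rint: "integrable M R" unfolding R_def[abs_def]
    using ints Iu2 Iu4 Q(2) by simp
  show int: "integrable M (\<lambda>\<omega>. I k \<omega> * u (Suc k) \<omega> ^ 4)"
  proof (rule Bochner_Integration.integrable_bound[OF Rint])
    show "AE \<omega> in M. norm (I k \<omega> * u (Suc k) \<omega> ^ 4) \<le> norm (R \<omega>)"
    proof (rule AE_I2)
      fix \<omega>
      have "0 \<le> I k \<omega> * u (Suc k) \<omega> ^ 4" using I_bounds(1) by (simp add: zero_le_even_power)
      then show "norm (I k \<omega> * u (Suc k) \<omega> ^ 4) \<le> norm (R \<omega>)" using pw[of \<omega>] by (auto simp: abs_le_iff)
    qed
  qed measurable
  define m4 where "m4 = expectation (\<lambda>\<omega>. I k \<omega> * u k \<omega> ^ 4)"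
  define m2 where "m2 = expectation (\<lambda>\<omega>. I k \<omega> * (u k \<omega>)\<^sup>2)"
  define P where "P = expectation (I k)"
  have m: "0 \<le> m2" "0 \<le> m4" "0 \<le> P" "P \<le> 1" unfolding m2_def m4_def P_def using EI_le I_bounds(1)
    by (auto intro!: integral_nonneg_AE simp: zero_le_even_power)
  have Eg: "expectation g = 8 * (2 * m2 + z * P) * z"
  proof -
    have "g = (\<lambda>\<omega>. 16 * z * (I k \<omega> * (u k \<omega>)\<^sup>2) + 8 * z * z * I k \<omega>)"
      by (simp add: g_def fun_eq_iff algebra_simps)
    then show ?thesis using Iu2 I_integrable[of k] by (simp add: m2_def P_def algebra_simps)
  qed
  have "expectation (\<lambda>\<omega>. I k \<omega> * u (Suc k) \<omega> ^ 4) \<le> expectation R"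
    using int Rint pw by (intro integral_mono) auto
  also have "expectation R = (1 - s/2) * (m4 + 2 * z * m2 + z\<^sup>2) - (expectation (\<lambda>\<omega>. f1 \<omega> * ?A \<omega>) + expectation (\<lambda>\<omega>. f2 \<omega> * ?G \<omega>))
      + expectation (\<lambda>\<omega>. g \<omega> * ?Q2 \<omega>) + 3 * z\<^sup>2 * expectation ?Q4"
    unfolding R_def[abs_def] m4_def m2_def using ints Iu2 Iu4 Q(2) by (simp add: prob_space)
  \<comment> \<open>The terms linear in the noise have mean zero, because \<open>f1\<close> and
    \<open>f2\<close> are known at time \<open>k\<close>; the square terms factorise.\<close>
  also have "\<dots> = (1 - s/2) * (m4 + 2 * z * m2 + z\<^sup>2) + 8 * (2 * m2 + z * P) * z * expectation ?Q2 + 3 * z\<^sup>2 * expectation ?Q4"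
    using pm1(2) pm2(4) pmg(6)[of 2 5] b k by (simp add: Eg)
  also have "\<dots> \<le> (1 - s/2) * (m4 + 2 * z * m2 + z\<^sup>2) + 8 * (2 * m2 + z * 1) * z * K + 3 * z\<^sup>2 * K"
    using Q_moments[OF k] m z0 K_pos
    by (intro add_mono mult_mono order_refl) (auto intro!: integral_nonneg_AE)
  also have "\<dots> \<le> (1 - s/2) * m4 + 1 * (2 * z * m2 + z\<^sup>2) + 8 * (2 * m2 + z * 1) * z * K + 3 * z\<^sup>2 * K"
    using mult_right_mono[of "1 - s/2" 1 "2 * z * m2 + z\<^sup>2"] s z0 m by (simp add: algebra_simps)
  also have "\<dots> = (1 - s/2) * m4 + (2 + 16 * K) * (z * m2) + (11 * K + 1) * z\<^sup>2"
    by (simp add: algebra_simps power2_eq_square)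
  \<comment> \<open>The 16 is \<open>8 * 2\<close>, from the bound of \<open>v^2\<close> by
    \<open>2 * u^2 + z\<close>. The square is completed with weight \<open>s / 4\<close>, pointwise
    under the expectation and using that \<open>I k\<close> is idempotent; this produces the summand
    \<open>(2 + 16 * K)^2\<close> of \<open>K'\<close>.\<close>
  also have "(2 + 16 * K) * (z * m2) \<le> s / 4 * m4 + (2 + 16 * K)\<^sup>2 * z\<^sup>2 / s"
  proof -
    let ?c = "2 + 16 * K"
    have amgm: "?c * z * y \<le> s / 4 * y\<^sup>2 + ?c\<^sup>2 * z\<^sup>2 / s" for y
    proof -
      have sq: "(s / 2 * y - w)\<^sup>2 / s = s / 4 * y\<^sup>2 + w\<^sup>2 / s - w * y" for w
        using sp by (simp add: power2_eq_square field_simps)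
      have "0 \<le> (s / 2 * y - ?c * z)\<^sup>2 / s" using sp by simp
      also have "\<dots> = s / 4 * y\<^sup>2 + ?c\<^sup>2 * z\<^sup>2 / s - ?c * z * y"
        unfolding sq power_mult_distrib ..
      finally show ?thesis by simp
    qed
    have "expectation (\<lambda>\<omega>. ?c * z * (I k \<omega> * (u k \<omega>)\<^sup>2)) \<le> expectation (\<lambda>\<omega>. s / 4 * (I k \<omega> * u k \<omega> ^ 4) + ?c\<^sup>2 * z\<^sup>2 / s)"
    proof (rule integral_mono)
      fix \<omega>
      have "(I k \<omega> * (u k \<omega>)\<^sup>2)\<^sup>2 = I k \<omega> * u k \<omega> ^ 4"
        using I_cases[of k \<omega>] by (auto simp: power_mult_distrib)
      then show "?c * z * (I k \<omega> * (u k \<omega>)\<^sup>2) \<le> s / 4 * (I k \<omega> * u k \<omega> ^ 4) + ?c\<^sup>2 * z\<^sup>2 / s"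
        using amgm[of "I k \<omega> * (u k \<omega>)\<^sup>2"] by simp
    qed (use Iu2 Iu4 in auto)
    then show ?thesis using Iu2 Iu4 by (simp add: m2_def m4_def prob_space mult.assoc)
  qed
  also have "(2 + 16 * K)\<^sup>2 * z\<^sup>2 / s \<le> (2 + 16 * K)\<^sup>2 * (x / d ^ 5)"
  proof -
    have "z\<^sup>2 / s \<le> z\<^sup>2 / (d / x)" using s(3) d x_pos sp by (intro divide_left_mono) auto
    also have "\<dots> = x / d ^ 5" unfolding zz d5 by simp
    finally show ?thesis using mult_left_mono[of "z\<^sup>2 / s" "x / d ^ 5" "(2 + 16 * K)\<^sup>2"] by simp
  qed
  also have "(11 * K + 1) * z\<^sup>2 \<le> (11 * K + 1) * (x / d ^ 5)"
  proof (rule mult_left_mono)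
    have "z\<^sup>2 = d / d ^ 5" unfolding zz d5 using d by simp
    also have "\<dots> \<le> x / d ^ 5" using d by (intro divide_right_mono) auto
    finally show "z\<^sup>2 \<le> x / d ^ 5" .
  qed (use K_pos in auto)
  finally have "expectation (\<lambda>\<omega>. I k \<omega> * u (Suc k) \<omega> ^ 4)
     \<le> (1 - s/4) * m4 + K' * (x / d ^ 5)" by (simp add: K'_def algebra_simps)
  also have "(1 - s/4) * m4 \<le> (1 - d / (4 * x)) * m4" using s(3) m by (intro mult_right_mono) auto
  finally show "expectation (\<lambda>\<omega>. I k \<omega> * u (Suc k) \<omega> ^ 4)
      \<le> (1 - D (Suc k) / (4 * x)) * expectation (\<lambda>\<omega>. I k \<omega> * u k \<omega> ^ 4) + K' * x * (1 / D (Suc k) ^ 5)"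
    by (simp add: m4_def d_def)
qed

definition K'' :: real where "K'' = 2 * K' + 3 * \<alpha>\<^sup>2"

lemma K'_pos: "0 < K'" using K_pos by (simp add: K'_def add_nonneg_pos)

lemma K''_pos: "0 < K''" using K'_pos by (simp add: K''_def add_pos_nonneg)

text \<open>
  A path that leaves \<open>|u| \<le> 1/4\<close> at step \<open>m\<close> carries \<open>u^4 \<ge> 1/256\<close>, so dropping it from the truncated
  fourth moment pays for the exit probability.
\<close>
lemma lyapunov:
  assumes "m \<le> n"
  shows "expectation (\<lambda>\<omega>. I m \<omega> * u m \<omega> ^ 4) + (1 - expectation (I m)) / 256
      + (\<Sum>k<m. D (Suc k) / (4 * x) * expectation (\<lambda>\<omega>. I k \<omega> * u k \<omega> ^ 4))
    \<le> 3 * \<alpha>\<^sup>2 / x ^ 4 + (\<Sum>k<m. K' * x * (1 / D (Suc k) ^ 5))"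
  using assms
proof (induction m)
  case 0
  have u0: "u 0 \<omega> = - (A 0 \<omega> / x)" for \<omega>
    using x_pos by (simp add: u_def big_root_def D_0 diff_divide_distrib)
  have u4: "u 0 \<omega> ^ 4 = A 0 \<omega> ^ 4 / x ^ 4" for \<omega>
    by (simp add: u0 power_divide)
  have pw: "I 0 \<omega> * u 0 \<omega> ^ 4 + (1 - I 0 \<omega>) / 256 \<le> u 0 \<omega> ^ 4" for \<omega>
  proof (cases "\<bar>u 0 \<omega>\<bar> \<le> 1/4")
    case False
    then have "(1/4) ^ 4 \<le> \<bar>u 0 \<omega>\<bar> ^ 4" by (intro power_mono) auto
    then show ?thesis using False by (simp add: I_def power_even_abs power4_eq_xxxx)
  qed (simp add: I_def)
  have "expectation (\<lambda>\<omega>. I 0 \<omega> * u 0 \<omega> ^ 4 + (1 - I 0 \<omega>) / 256) \<le> expectation (\<lambda>\<omega>. u 0 \<omega> ^ 4)"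
    using Iu_integrable[of 0 4] I_integrable[of 0] A_integrable(2)[of 4 0] pw
    by (intro integral_mono) (auto simp: u4)
  also have "\<dots> = 3 * \<alpha>\<^sup>2 / x ^ 4" by (simp add: u4 A_moments)
  finally show ?case using Iu_integrable[of 0 4] I_integrable[of 0] by (simp add: prob_space)
next
  case (Suc m)
  then have m: "m < n" "m \<le> n" by auto
  let ?a = "expectation (\<lambda>\<omega>. I m \<omega> * u m \<omega> ^ 4)"
  have pw: "I (Suc m) \<omega> * u (Suc m) \<omega> ^ 4 + (I m \<omega> - I (Suc m) \<omega>) / 256 \<le> I m \<omega> * u (Suc m) \<omega> ^ 4" for \<omega>
  proof (cases "\<bar>u (Suc m) \<omega>\<bar> \<le> 1/4")
    case False
    then have "(1/4) ^ 4 \<le> \<bar>u (Suc m) \<omega>\<bar> ^ 4" by (intro power_mono) auto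
    then have "1 / 256 \<le> u (Suc m) \<omega> ^ 4" by (simp add: power_even_abs power4_eq_xxxx)
    then have "I m \<omega> * (1 / 256) \<le> I m \<omega> * u (Suc m) \<omega> ^ 4" by (rule mult_left_mono[OF _ I_bounds(1)])
    then show ?thesis using False by (simp add: I_Suc)
  qed (simp add: I_Suc)
  have "expectation (\<lambda>\<omega>. I (Suc m) \<omega> * u (Suc m) \<omega> ^ 4 + (I m \<omega> - I (Suc m) \<omega>) / 256)
      \<le> expectation (\<lambda>\<omega>. I m \<omega> * u (Suc m) \<omega> ^ 4)"
    using Iu_integrable[of "Suc m" 4] I_integrable[of m] I_integrable[of "Suc m"] fourth_moment_step(1)[OF m(1)] pw
    by (intro integral_mono) auto
  also have "\<dots> \<le> (1 - D (Suc m) / (4 * x)) * ?a + K' * x * (1 / D (Suc m) ^ 5)"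
    by (rule fourth_moment_step(2)[OF m(1)])
  finally have "expectation (\<lambda>\<omega>. I (Suc m) \<omega> * u (Suc m) \<omega> ^ 4) + (expectation (I m) - expectation (I (Suc m))) / 256
      \<le> ?a - D (Suc m) / (4 * x) * ?a + K' * x * (1 / D (Suc m) ^ 5)"
    using Iu_integrable[of "Suc m" 4] I_integrable[of m] I_integrable[of "Suc m"] by (simp add: left_diff_distrib)
  then show ?case using Suc.IH[OF m(2)] by (simp add: diff_divide_distrib)
qed

lemma lyapunov_total: "3 * \<alpha>\<^sup>2 / x ^ 4 + (\<Sum>k<n. K' * x * (1 / D (Suc k) ^ 5)) \<le> K'' * (x / D n ^ 3)"
proof -
  have "D n ^ 3 \<le> x ^ 3 * x ^ 2"
  proof -
    have "D n ^ 3 * 1 \<le> x ^ 3 * x ^ 2"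
      using D_le_x[of n] D_pos[of n] x_ge_10 by (intro mult_mono power_mono) auto
    then show ?thesis by simp
  qed
  then have "1 / x ^ 4 \<le> x / D n ^ 3"
    using x_pos D_pos[of n] by (simp add: field_simps power_add[symmetric] power_Suc[symmetric] del: power_Suc)
  then have 1: "3 * \<alpha>\<^sup>2 / x ^ 4 \<le> 3 * \<alpha>\<^sup>2 * (x / D n ^ 3)"
    using mult_left_mono[of "1 / x ^ 4" "x / D n ^ 3" "3 * \<alpha>\<^sup>2"] by simp
  have "(\<Sum>k<n. K' * x * (1 / D (Suc k) ^ 5)) = K' * x * (\<Sum>k<n. 1 / D (Suc k) ^ 5)"
    by (rule sum_distrib_left[symmetric])
  also have "\<dots> \<le> K' * x * (2 / D n ^ 3)"
    using sum_inverse_power_le[of 5] K'_pos x_pos by (intro mult_left_mono) auto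
  finally have 2: "(\<Sum>k<n. K' * x * (1 / D (Suc k) ^ 5)) \<le> 2 * K' * (x / D n ^ 3)" by (simp add: mult_ac)
  define q where "q = x / D n ^ 3"
  have "K'' * q = 2 * K' * q + 3 * \<alpha>\<^sup>2 * q" by (simp add: K''_def algebra_simps)
  then show ?thesis using 1 2 unfolding q_def[symmetric] by linarith
qed

text \<open>Both bounds are read off the same Lyapunov inequality by dropping nonnegative terms: one
  keeps the mass lost at the exit, the other the fourth moments dissipated by the contraction along
  the way.\<close>

lemma exit_probability: "1 - expectation (I n) \<le> 256 * K'' * (x / D n ^ 3)"
  and sum_fourth_moments: "(\<Sum>k<n. D (Suc k) / x * expectation (\<lambda>\<omega>. I k \<omega> * u k \<omega> ^ 4)) \<le> 4 * K'' * (x / D n ^ 3)"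
proof -
  have a: "0 \<le> expectation (\<lambda>\<omega>. I k \<omega> * u k \<omega> ^ 4)" for k
    using I_bounds(1) by (auto intro!: integral_nonneg_AE simp: zero_le_even_power)
  have b: "0 \<le> (\<Sum>k<n. D (Suc k) / (4 * x) * expectation (\<lambda>\<omega>. I k \<omega> * u k \<omega> ^ 4))"
    using a x_pos D_step by (intro sum_nonneg mult_nonneg_nonneg) (auto simp: less_imp_le)
  define q where "q = K'' * (x / D n ^ 3)"
  define S where "S = (\<Sum>k<n. D (Suc k) / (4 * x) * expectation (\<lambda>\<omega>. I k \<omega> * u k \<omega> ^ 4))"
  have b': "0 \<le> S" using b by (simp only: S_def)
  have t: "expectation (\<lambda>\<omega>. I n \<omega> * u n \<omega> ^ 4) + (1 - expectation (I n)) / 256 + S \<le> q"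
    unfolding S_def q_def by (rule order.trans[OF lyapunov[OF order_refl] lyapunov_total])
  have "1 - expectation (I n) \<le> 256 * q" using a[of n] b' t by (simp add: field_simps)
  then show "1 - expectation (I n) \<le> 256 * K'' * (x / D n ^ 3)" by (simp add: q_def mult.assoc)
  have "(\<Sum>k<n. D (Suc k) / x * expectation (\<lambda>\<omega>. I k \<omega> * u k \<omega> ^ 4))
     = 4 * S"
    by (simp add: S_def sum_distrib_left)
  also have "\<dots> \<le> 4 * q" using a[of n] EI_le[of n] t by (simp add: field_simps)
  finally show "(\<Sum>k<n. D (Suc k) / x * expectation (\<lambda>\<omega>. I k \<omega> * u k \<omega> ^ 4)) \<le> 4 * K'' * (x / D n ^ 3)" by (simp add: q_def mult.assoc)
qed

lemma Iabs_integrable: "integrable M (\<lambda>\<omega>. I k \<omega> * \<bar>u k \<omega>\<bar>)"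
  using integrable_abs[OF Iu_integrable[of k 1]] by (simp add: abs_mult I_bounds(1))

lemma sum_abs_u:
  assumes x: "x \<le> D n ^ 3"
  shows "(\<Sum>k<n. expectation (\<lambda>\<omega>. I k \<omega> * \<bar>u k \<omega>\<bar>) / (D (Suc k))\<^sup>2) \<le> 2 + 4 * K''"
proof -
  \<comment> \<open>Young's inequality with weight \<open>c / D\<close> splits \<open>|u| / D^2\<close> into two parts that are both summable.\<close>
  define c where "c = root 3 x"
  have c: "0 < c" "c ^ 3 = x" using x_pos by (auto simp: c_def)
  have "c \<le> root 3 (D n ^ 3)" unfolding c_def using x by (intro real_root_le_mono) auto
  also have "\<dots> = D n" using D_pos[of n] by (intro real_root_power_cancel) auto
  finally have cD: "c \<le> D n" .
  have "(\<Sum>k<n. expectation (\<lambda>\<omega>. I k \<omega> * \<bar>u k \<omega>\<bar>) / (D (Suc k))\<^sup>2)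
     \<le> (\<Sum>k<n. c * (1 / D (Suc k) ^ 3) + D (Suc k) / x * expectation (\<lambda>\<omega>. I k \<omega> * u k \<omega> ^ 4))"
  proof (rule sum_mono)
    fix k assume "k \<in> {..<n}"
    then have k: "k < n" by simp
    define d where "d = D (Suc k)"
    have d: "0 < d" using D_step[OF k] by (simp add: d_def)
    have am: "\<bar>y\<bar> \<le> c / d + y ^ 4 / (c / d) ^ 3" for y
    proof (cases "\<bar>y\<bar> \<le> c / d")
      case True
      moreover have "0 \<le> y ^ 4 / (c / d) ^ 3" using c d by (simp add: zero_le_even_power)
      ultimately show ?thesis by linarith
    next
      case False
      have "\<bar>y\<bar> * (c / d) ^ 3 \<le> \<bar>y\<bar> * \<bar>y\<bar> ^ 3" using False c d by (intro mult_left_mono power_mono) auto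
      also have "\<dots> = y ^ 4" by (simp add: power_even_abs flip: power_Suc)
      finally have "\<bar>y\<bar> \<le> y ^ 4 / (c / d) ^ 3" using c d by (simp add: pos_le_divide_eq)
      then show ?thesis using divide_pos_pos[OF c(1) d] by linarith
    qed
    have "expectation (\<lambda>\<omega>. I k \<omega> * \<bar>u k \<omega>\<bar>) \<le> expectation (\<lambda>\<omega>. c / d + I k \<omega> * u k \<omega> ^ 4 / (c / d) ^ 3)"
    proof (rule integral_mono)
      fix \<omega>
      show "I k \<omega> * \<bar>u k \<omega>\<bar> \<le> c / d + I k \<omega> * u k \<omega> ^ 4 / (c / d) ^ 3"
        using I_cases[of k \<omega>] am[of "u k \<omega>"] c d by auto
    qed (use Iabs_integrable Iu_integrable[of k 4] in auto)
    also have "\<dots> = c / d + expectation (\<lambda>\<omega>. I k \<omega> * u k \<omega> ^ 4) / (c / d) ^ 3"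
      using Iu_integrable[of k 4] by (simp add: prob_space)
    finally have "expectation (\<lambda>\<omega>. I k \<omega> * \<bar>u k \<omega>\<bar>) / d\<^sup>2
      \<le> (c / d + expectation (\<lambda>\<omega>. I k \<omega> * u k \<omega> ^ 4) / (c / d) ^ 3) / d\<^sup>2"
      by (rule divide_right_mono) simp
    \<comment> \<open>The choice \<open>c ^ 3 = x\<close> gives the fourth moment exactly the weight
      \<open>d / x\<close> of \<open>sum_fourth_moments\<close>.\<close>
    also have "\<dots> = c * (1 / d ^ 3) + d / x * expectation (\<lambda>\<omega>. I k \<omega> * u k \<omega> ^ 4)"
      using d x_pos unfolding power_divide c(2) by (simp add: add_divide_distrib power2_eq_square power3_eq_cube mult_ac)
    finally show "expectation (\<lambda>\<omega>. I k \<omega> * \<bar>u k \<omega>\<bar>) / (D (Suc k))\<^sup>2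
      \<le> c * (1 / D (Suc k) ^ 3) + D (Suc k) / x * expectation (\<lambda>\<omega>. I k \<omega> * u k \<omega> ^ 4)" by (simp only: d_def)
  qed
  also have "\<dots> = c * (\<Sum>k<n. 1 / D (Suc k) ^ 3) + (\<Sum>k<n. D (Suc k) / x * expectation (\<lambda>\<omega>. I k \<omega> * u k \<omega> ^ 4))"
    by (simp add: sum.distrib sum_distrib_left)
  also have "\<dots> \<le> c * (2 / D n) + 4 * K'' * (x / D n ^ 3)"
    using sum_fourth_moments sum_inverse_cube' c by (intro add_mono mult_left_mono) auto
  \<comment> \<open>The hypothesis \<open>x \<le> D n ^ 3\<close> acts twice: as
    \<open>c \<le> D n\<close> here and as \<open>x / D n ^ 3 \<le> 1\<close> in the next
    bound.\<close>
  also have "c * (2 / D n) \<le> 2" using cD D_pos[of n] by (simp add: field_simps)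
  also have "4 * K'' * (x / D n ^ 3) \<le> 4 * K'' * 1"
    using x D_pos[of n] K''_pos by (intro mult_left_mono) auto
  finally show ?thesis by simp
qed

section \<open>The multiplicative noise and its independent approximation\<close>

definition \<zeta> :: "nat \<Rightarrow> 'w \<Rightarrow> real" where
  "\<zeta> k \<omega> = (A (Suc k) \<omega> + G (Suc k) \<omega>) / D (Suc k)"

text \<open>Setting the deviation \<open>v\<close> to 0 turns this into \<open>\<zeta> k\<close>,
  which involves only the noise of one step; the \<open>\<zeta> k\<close> are therefore independent
  and carry the Gaussian limit.\<close>

definition \<eta> :: "nat \<Rightarrow> 'w \<Rightarrow> real" where
  "\<eta> k \<omega> = (A (Suc k) \<omega> * (1 + (1 - \<tau> (Suc k)) * v k (u k \<omega>)) + G (Suc k) \<omega>) / (D (Suc k) * (1 + v k (u k \<omega>)))"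

definition m\<zeta> :: "nat \<Rightarrow> real" where "m\<zeta> k = \<alpha> * (1 + \<tau> (Suc k)) / (D (Suc k))\<^sup>2"

text \<open>
  \<open>X\<close> is the martingale difference part of the linearisation error, and \<open>R\<close> dominates all the Taylor
  remainders of one step.
\<close>
definition R :: "nat \<Rightarrow> 'w \<Rightarrow> real" where
  "R k \<omega> = 80 * (\<bar>A (Suc k) \<omega>\<bar> ^ 3 + \<bar>G (Suc k) \<omega>\<bar> ^ 3) / D (Suc k) ^ 3
    + I k \<omega> * \<bar>v k (u k \<omega>)\<bar> * (5 * (A (Suc k) \<omega>)\<^sup>2 + 5 * (G (Suc k) \<omega>)\<^sup>2) / (D (Suc k))\<^sup>2
    + 4 / D (Suc k) ^ 4 + 2 * (I k \<omega> * \<bar>u k \<omega>\<bar>) / (D (Suc k))\<^sup>2"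

definition X :: "nat \<Rightarrow> 'w \<Rightarrow> real" where
  "X k \<omega> = I k \<omega> * (\<eta> k \<omega> - \<zeta> k \<omega>) + ((\<zeta> k \<omega>)\<^sup>2 - m\<zeta> k) / 2"

text \<open>An exact formula, not an estimate: the difference is a coefficient known at time
  \<open>k\<close>, of size \<open>v / D\<close>, times fresh centred noise. This is what makes it a
  martingale difference.\<close>

lemma eta_minus_zeta:
  assumes k: "k < n" and ub: "\<bar>u k \<omega>\<bar> \<le> 1/4"
  shows "\<eta> k \<omega> - \<zeta> k \<omega> = - (v k (u k \<omega>) / (D (Suc k) * (1 + v k (u k \<omega>)))) * (\<tau> (Suc k) * A (Suc k) \<omega> + G (Suc k) \<omega>)"
proof -
  let ?v = "v k (u k \<omega>)"
  have "0 < 1 + ?v" using v_bounds(2)[OF k ub] by (simp add: abs_le_iff)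
  moreover have "0 < D (Suc k)" using D_step[OF k] by simp
  ultimately have "(a * (1 + (1 - t) * ?v) + g) / (D (Suc k) * (1 + ?v)) - (a + g) / D (Suc k)
     = - (?v / (D (Suc k) * (1 + ?v))) * (t * a + g)" for a g t
    by (simp add: divide_simps) (simp add: algebra_simps)
  then show ?thesis unfolding \<eta>_def \<zeta>_def .
qed

lemma eta_zeta_bounds:
  assumes k: "k < n" and ub: "\<bar>u k \<omega>\<bar> \<le> 1/4"
  defines "N \<equiv> (\<bar>A (Suc k) \<omega>\<bar> + \<bar>G (Suc k) \<omega>\<bar>) / D (Suc k)"
  shows "\<bar>\<eta> k \<omega>\<bar> \<le> 2 * N" "\<bar>\<zeta> k \<omega>\<bar> \<le> N" "\<bar>\<eta> k \<omega> - \<zeta> k \<omega>\<bar> \<le> 3/2 * (\<bar>v k (u k \<omega>)\<bar> * N)"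
    "\<bar>v k (u k \<omega>) / (D (Suc k) * (1 + v k (u k \<omega>)))\<bar> \<le> 3/2 * \<bar>v k (u k \<omega>)\<bar> / D (Suc k)"
proof -
  let ?v = "v k (u k \<omega>)" and ?a = "A (Suc k) \<omega>" and ?g = "G (Suc k) \<omega>" and ?d = "D (Suc k)"
  have k': "Suc k \<le> n" using k by simp
  have d: "0 < ?d" using D_step[OF k] by simp
  have vb: "\<bar>?v\<bar> \<le> 3/10" by (rule v_bounds(2)[OF k ub])
  then have v1: "7/10 \<le> 1 + ?v" by (simp add: abs_le_iff)
  show zb: "\<bar>\<zeta> k \<omega>\<bar> \<le> N" unfolding \<zeta>_def N_def abs_divide using d by (intro frac_le) auto
  have "\<bar>?v / (?d * (1 + ?v))\<bar> = \<bar>?v\<bar> / (?d * (1 + ?v))" using d v1 by (simp add: abs_mult)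
  also have "\<dots> \<le> \<bar>?v\<bar> / (?d * (2/3))" using d v1 by (intro divide_left_mono mult_left_mono) auto
  finally show c: "\<bar>?v / (?d * (1 + ?v))\<bar> \<le> 3/2 * \<bar>?v\<bar> / ?d" by simp
  have t: "\<bar>\<tau> (Suc k) * ?a + ?g\<bar> \<le> \<bar>?a\<bar> + \<bar>?g\<bar>"
  proof -
    have "\<bar>\<tau> (Suc k) * ?a\<bar> \<le> 1 * \<bar>?a\<bar>" unfolding abs_mult using tau_bounds[OF k'] by (intro mult_right_mono) auto
    then show ?thesis by linarith
  qed
  have "\<bar>\<eta> k \<omega> - \<zeta> k \<omega>\<bar> = \<bar>?v / (?d * (1 + ?v))\<bar> * \<bar>\<tau> (Suc k) * ?a + ?g\<bar>"
    unfolding eta_minus_zeta[OF k ub] by (simp only: abs_mult abs_minus_cancel)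
  also have "\<dots> \<le> (3/2 * \<bar>?v\<bar> / ?d) * (\<bar>?a\<bar> + \<bar>?g\<bar>)" using c t d by (intro mult_mono) auto
  also have "\<dots> = 3/2 * (\<bar>?v\<bar> * N)" by (simp add: N_def)
  finally show ez: "\<bar>\<eta> k \<omega> - \<zeta> k \<omega>\<bar> \<le> 3/2 * (\<bar>?v\<bar> * N)" .
  have N0: "0 \<le> N" using d by (simp add: N_def)
  have "\<bar>?v\<bar> * N \<le> 3/10 * N" using vb N0 by (intro mult_right_mono) auto
  then show "\<bar>\<eta> k \<omega>\<bar> \<le> 2 * N" using ez zb N0 by linarith
qed

text \<open>From \<open>(a + g)^4 \<le> 8 a^4 + 8 g^4\<close>, with fourth moments
  \<open>3 \<alpha>^2\<close> for \<open>A\<close> and at most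
  \<open>3 \<alpha>^2 + 6 \<alpha>^3\<close> for \<open>G\<close>.\<close>

definition K3 :: real where "K3 = 48 * \<alpha>\<^sup>2 + 48 * \<alpha> ^ 3"

lemma AG_integrable: "integrable M (\<lambda>\<omega>. A (Suc k) \<omega> * G (Suc k) \<omega>)"
proof (rule Bochner_Integration.integrable_bound)
  show "integrable M (\<lambda>\<omega>. (A (Suc k) \<omega>)\<^sup>2 + (G (Suc k) \<omega>)\<^sup>2)"
    using A_integrable(2)[of 2] G_integrable(2)[of 2] by simp
  have "\<bar>a * b\<bar> \<le> \<bar>a\<^sup>2 + b\<^sup>2\<bar>" for a b :: real
    using sum_squares_bound[of a b] sum_squares_bound[of a "-b"] by (simp add: abs_le_iff)
  then show "AE \<omega> in M. norm (A (Suc k) \<omega> * G (Suc k) \<omega>) \<le> norm ((A (Suc k) \<omega>)\<^sup>2 + (G (Suc k) \<omega>)\<^sup>2)" by simp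
qed measurable

lemma zeta_measurable [measurable]: "\<zeta> k \<in> borel_measurable M"
  unfolding \<zeta>_def[abs_def] by measurable

lemma zeta_moments:
  assumes k: "k < n"
  shows "integrable M (\<lambda>\<omega>. \<zeta> k \<omega> ^ 4)" "integrable M (\<lambda>\<omega>. (\<zeta> k \<omega>)\<^sup>2)"
    "expectation (\<lambda>\<omega>. (\<zeta> k \<omega>)\<^sup>2) = m\<zeta> k"
    "expectation (\<lambda>\<omega>. \<zeta> k \<omega> ^ 4) \<le> K3 / D (Suc k) ^ 4"
    "integrable M (\<lambda>\<omega>. ((\<zeta> k \<omega>)\<^sup>2 - m\<zeta> k)\<^sup>2)"
    "expectation (\<lambda>\<omega>. ((\<zeta> k \<omega>)\<^sup>2 - m\<zeta> k)\<^sup>2) \<le> K3 / D (Suc k) ^ 4"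
proof -
  let ?a = "A (Suc k)" and ?g = "G (Suc k)" and ?d = "D (Suc k)"
  note i = A_integrable(2)[of 2 "Suc k"] A_integrable(2)[of 4 "Suc k"] G_integrable(2)[of 2 k] G_integrable(2)[of 4 k] AG_integrable[of k]
  have d: "0 < ?d" using D_step[OF k] by simp
  have s4: "(a + b) ^ 4 \<le> 8 * a ^ 4 + 8 * b ^ 4" for a b :: real
  proof -
    have "(a + b) ^ 4 = ((a + b)\<^sup>2)\<^sup>2" by simp
    also have "\<dots> \<le> (2 * a\<^sup>2 + 2 * b\<^sup>2)\<^sup>2" by (intro power_mono sum_sq_le) simp
    also have "\<dots> \<le> 2 * (2 * a\<^sup>2)\<^sup>2 + 2 * (2 * b\<^sup>2)\<^sup>2" by (rule sum_sq_le)
    also have "\<dots> = 8 * a ^ 4 + 8 * b ^ 4" by (simp add: power_mult_distrib)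
    finally show ?thesis .
  qed
  have z4: "\<zeta> k \<omega> ^ 4 \<le> (8 * ?a \<omega> ^ 4 + 8 * ?g \<omega> ^ 4) / ?d ^ 4" for \<omega>
    unfolding \<zeta>_def power_divide using s4 d by (intro divide_right_mono) auto
  have b: "integrable M (\<lambda>\<omega>. (8 * ?a \<omega> ^ 4 + 8 * ?g \<omega> ^ 4) / ?d ^ 4)" using i by simp
  show i4: "integrable M (\<lambda>\<omega>. \<zeta> k \<omega> ^ 4)"
  proof (rule Bochner_Integration.integrable_bound[OF b])
    show "AE \<omega> in M. norm (\<zeta> k \<omega> ^ 4) \<le> norm ((8 * ?a \<omega> ^ 4 + 8 * ?g \<omega> ^ 4) / ?d ^ 4)"
    proof (rule AE_I2)
      fix \<omega> have "0 \<le> \<zeta> k \<omega> ^ 4" by (simp add: zero_le_even_power)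
      then show "norm (\<zeta> k \<omega> ^ 4) \<le> norm ((8 * ?a \<omega> ^ 4 + 8 * ?g \<omega> ^ 4) / ?d ^ 4)" using z4[of \<omega>] unfolding real_norm_def by linarith
    qed
  qed measurable
  show i2: "integrable M (\<lambda>\<omega>. (\<zeta> k \<omega>)\<^sup>2)" by (rule integrable_power_le(2)[OF _ i4]) auto
  have "expectation (\<lambda>\<omega>. ?a \<omega> * ?g \<omega>) = 0" by (simp add: G_def AB_uncorrelated)
  moreover have "expectation (\<lambda>\<omega>. (\<zeta> k \<omega>)\<^sup>2) = expectation (\<lambda>\<omega>. ((?a \<omega>)\<^sup>2 + (?g \<omega>)\<^sup>2 + 2 * (?a \<omega> * ?g \<omega>)) / ?d\<^sup>2)"
    by (simp add: \<zeta>_def power_divide power2_sum mult.assoc)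
  ultimately show e2: "expectation (\<lambda>\<omega>. (\<zeta> k \<omega>)\<^sup>2) = m\<zeta> k"
    using i G_moments(2)[OF k] by (simp add: m\<zeta>_def A_moments distrib_left)
  have "expectation (\<lambda>\<omega>. \<zeta> k \<omega> ^ 4) \<le> expectation (\<lambda>\<omega>. (8 * ?a \<omega> ^ 4 + 8 * ?g \<omega> ^ 4) / ?d ^ 4)"
    using i4 b z4 by (intro integral_mono) auto
  also have "\<dots> = (8 * (3 * \<alpha>\<^sup>2) + 8 * expectation (\<lambda>\<omega>. ?g \<omega> ^ 4)) / ?d ^ 4" using i by (simp add: A_moments)
  also have "\<dots> \<le> K3 / ?d ^ 4" using G_moments(4)[OF k] d by (intro divide_right_mono) (auto simp: K3_def)
  finally show e4: "expectation (\<lambda>\<omega>. \<zeta> k \<omega> ^ 4) \<le> K3 / ?d ^ 4" .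
  have x2: "((\<zeta> k \<omega>)\<^sup>2 - m\<zeta> k)\<^sup>2 = \<zeta> k \<omega> ^ 4 - 2 * m\<zeta> k * (\<zeta> k \<omega>)\<^sup>2 + (m\<zeta> k)\<^sup>2" for \<omega>
    by (simp add: power2_diff)
  show "integrable M (\<lambda>\<omega>. ((\<zeta> k \<omega>)\<^sup>2 - m\<zeta> k)\<^sup>2)" unfolding x2 using i4 i2 by simp
  have "expectation (\<lambda>\<omega>. ((\<zeta> k \<omega>)\<^sup>2 - m\<zeta> k)\<^sup>2) = expectation (\<lambda>\<omega>. \<zeta> k \<omega> ^ 4) - (m\<zeta> k)\<^sup>2"
    unfolding x2 using i4 i2 by (simp add: prob_space e2) (simp add: power2_eq_square)
  then show "expectation (\<lambda>\<omega>. ((\<zeta> k \<omega>)\<^sup>2 - m\<zeta> k)\<^sup>2) \<le> K3 / ?d ^ 4" using e4 by (smt (verit) zero_le_power2)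
qed

text \<open>The predictable coefficient in \<open>eta_minus_zeta\<close>, with the survival
  indicator built in. Through it \<open>X_eq\<close> displays \<open>X\<close> as linear noise with
  a coefficient from the past plus the centred square of \<open>\<zeta>\<close>.\<close>

definition c :: "nat \<Rightarrow> 'w \<Rightarrow> real" where
  "c k \<omega> = - (I k \<omega> * (v k (u k \<omega>) / (D (Suc k) * (1 + v k (u k \<omega>)))))"

lemma c_adapted: "c k \<in> borel_measurable (Fm k)"
proof -
  have [measurable]: "u k \<in> borel_measurable (Fm k)" "I k \<in> borel_measurable (Fm k)" by (auto intro: u_adapted I_adapted)
  show ?thesis unfolding c_def[abs_def] v_def by measurable
qed

text \<open>In the second bound one factor \<open>\<bar>v\<bar>\<close> is given away, by
  \<open>9/4 * \<bar>v\<bar> \<le> 1\<close>, because it is the first moment of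
  \<open>\<bar>v\<bar>\<close> whose sum against \<open>1 / D^2\<close> is controlled.\<close>

lemma c_bounds:
  assumes k: "k < n"
  shows "\<bar>c k \<omega>\<bar> \<le> 1" "(c k \<omega>)\<^sup>2 \<le> I k \<omega> * \<bar>v k (u k \<omega>)\<bar> / (D (Suc k))\<^sup>2"
proof -
  have "\<bar>c k \<omega>\<bar> \<le> 1 \<and> (c k \<omega>)\<^sup>2 \<le> I k \<omega> * \<bar>v k (u k \<omega>)\<bar> / (D (Suc k))\<^sup>2"
  proof (cases "I k \<omega> = 0")
    case False
    then have I1: "I k \<omega> = 1" and ub: "\<bar>u k \<omega>\<bar> \<le> 1/4" using I_cases[of k \<omega>] by auto
    have d: "10 \<le> D (Suc k)" using D_ge_10[of "Suc k"] k by simp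
    let ?v = "v k (u k \<omega>)"
    have vb: "\<bar>?v\<bar> \<le> 3/10" by (rule v_bounds(2)[OF k ub])
    have "\<bar>c k \<omega>\<bar> \<le> 3/2 * \<bar>?v\<bar> / D (Suc k)" using eta_zeta_bounds(4)[OF k ub] by (simp add: c_def I1)
    moreover have "3/2 * \<bar>?v\<bar> / D (Suc k) \<le> 1 / 10" using vb d by (intro frac_le) auto
    moreover have "(c k \<omega>)\<^sup>2 \<le> (3/2 * \<bar>?v\<bar> / D (Suc k))\<^sup>2" using power_mono[OF calculation(1), of 2] by simp
    moreover have "(3/2 * \<bar>?v\<bar> / D (Suc k))\<^sup>2 = \<bar>?v\<bar> * (9/4 * \<bar>?v\<bar>) / (D (Suc k))\<^sup>2" by (simp add: power_divide power2_eq_square)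
    moreover have "\<bar>?v\<bar> * (9/4 * \<bar>?v\<bar>) / (D (Suc k))\<^sup>2 \<le> \<bar>?v\<bar> * 1 / (D (Suc k))\<^sup>2"
      using vb by (intro divide_right_mono mult_left_mono) auto
    ultimately show ?thesis unfolding I1 by simp
  qed (simp add: c_def)
  then show "\<bar>c k \<omega>\<bar> \<le> 1" "(c k \<omega>)\<^sup>2 \<le> I k \<omega> * \<bar>v k (u k \<omega>)\<bar> / (D (Suc k))\<^sup>2" by auto
qed

lemma X_eq: "k < n \<Longrightarrow> X k \<omega> = c k \<omega> * \<tau> (Suc k) * A (Suc k) \<omega> + c k \<omega> * G (Suc k) \<omega> + ((\<zeta> k \<omega>)\<^sup>2 - m\<zeta> k) / 2"
proof -
  assume k: "k < n"
  show ?thesis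
  proof (cases "I k \<omega> = 0")
    case False
    then have I1: "I k \<omega> = 1" and ub: "\<bar>u k \<omega>\<bar> \<le> 1/4" using I_cases[of k \<omega>] by auto
    show ?thesis unfolding X_def eta_minus_zeta[OF k ub] c_def I1 by (simp add: distrib_left)
  qed (simp add: X_def c_def)
qed

lemma Iv_bounds: "k < n \<Longrightarrow> 0 \<le> I k \<omega> * \<bar>v k (u k \<omega>)\<bar> \<and> I k \<omega> * \<bar>v k (u k \<omega>)\<bar> \<le> 1
    \<and> I k \<omega> * \<bar>v k (u k \<omega>)\<bar> \<le> I k \<omega> * \<bar>u k \<omega>\<bar> + 3/2 / (D (Suc k))\<^sup>2"
  using I_cases[of k \<omega>] v_bounds[of k "u k \<omega>"] by (auto simp: abs_le_iff)

lemma Iv_abs: "k < n \<Longrightarrow> \<bar>I k \<omega> * \<bar>v k (u k \<omega>)\<bar>\<bar> \<le> 1"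
  using Iv_bounds[of k \<omega>] unfolding abs_le_iff by linarith

lemma Iv_measurable: "(\<lambda>\<omega>. I k \<omega> * \<bar>v k (u k \<omega>)\<bar>) \<in> borel_measurable (Fm k)"
proof -
  have [measurable]: "u k \<in> borel_measurable (Fm k)" "I k \<in> borel_measurable (Fm k)" by (auto intro: u_adapted I_adapted)
  show ?thesis unfolding v_def by measurable
qed

lemma Iv_integrable: "k < n \<Longrightarrow> integrable M (\<lambda>\<omega>. I k \<omega> * \<bar>v k (u k \<omega>)\<bar>)"
  by (rule integrable_bounded[OF measurable_Fm[OF Iv_measurable] Iv_abs])

lemma expectation_Iv:
  assumes k: "k < n"
  shows "expectation (\<lambda>\<omega>. I k \<omega> * \<bar>v k (u k \<omega>)\<bar>) / (D (Suc k))\<^sup>2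
      \<le> expectation (\<lambda>\<omega>. I k \<omega> * \<bar>u k \<omega>\<bar>) / (D (Suc k))\<^sup>2 + 3/2 * (1 / D (Suc k) ^ 4)"
proof -
  have "expectation (\<lambda>\<omega>. I k \<omega> * \<bar>v k (u k \<omega>)\<bar>) \<le> expectation (\<lambda>\<omega>. I k \<omega> * \<bar>u k \<omega>\<bar> + 3/2 / (D (Suc k))\<^sup>2)"
    using Iv_integrable[OF k] Iabs_integrable[of k] Iv_bounds[OF k] by (intro integral_mono) auto
  also have "\<dots> = expectation (\<lambda>\<omega>. I k \<omega> * \<bar>u k \<omega>\<bar>) + 3/2 / (D (Suc k))\<^sup>2"
    using Iabs_integrable[of k] by (simp add: prob_space)
  finally have "expectation (\<lambda>\<omega>. I k \<omega> * \<bar>v k (u k \<omega>)\<bar>) / (D (Suc k))\<^sup>2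
      \<le> (expectation (\<lambda>\<omega>. I k \<omega> * \<bar>u k \<omega>\<bar>) + 3/2 / (D (Suc k))\<^sup>2) / (D (Suc k))\<^sup>2" by (rule divide_right_mono) simp
  also have "\<dots> = expectation (\<lambda>\<omega>. I k \<omega> * \<bar>u k \<omega>\<bar>) / (D (Suc k))\<^sup>2 + 3/2 * (1 / D (Suc k) ^ 4)"
    by (simp add: add_divide_distrib power2_eq_square power4_eq_xxxx)
  finally show ?thesis .
qed

lemma sum_Iv:
  assumes x: "x \<le> D n ^ 3"
  shows "(\<Sum>k<n. expectation (\<lambda>\<omega>. I k \<omega> * \<bar>v k (u k \<omega>)\<bar>) / (D (Suc k))\<^sup>2) \<le> 3 + 4 * K''"
proof -
  have "(\<Sum>k<n. expectation (\<lambda>\<omega>. I k \<omega> * \<bar>v k (u k \<omega>)\<bar>) / (D (Suc k))\<^sup>2)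
    \<le> (\<Sum>k<n. expectation (\<lambda>\<omega>. I k \<omega> * \<bar>u k \<omega>\<bar>) / (D (Suc k))\<^sup>2 + 3/2 * (1 / D (Suc k) ^ 4))"
    by (intro sum_mono expectation_Iv) simp
  also have "\<dots> = (\<Sum>k<n. expectation (\<lambda>\<omega>. I k \<omega> * \<bar>u k \<omega>\<bar>) / (D (Suc k))\<^sup>2) + 3/2 * (\<Sum>k<n. 1 / D (Suc k) ^ 4)"
    by (simp only: sum.distrib sum_distrib_left)
  also have "\<dots> \<le> 3 + 4 * K''" using sum_abs_u[OF x] sum_inverse_fourth by linarith
  finally show ?thesis .
qed

lemma X_adapted: "k < n \<Longrightarrow> k < m \<Longrightarrow> X k \<in> borel_measurable (Fm m)"
proof -
  assume k: "k < n" "k < m"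
  have [measurable]: "A (Suc k) \<in> borel_measurable (Fm m)" "B (Suc k) \<in> borel_measurable (Fm m)" "c k \<in> borel_measurable (Fm m)"
    using k measurable_from_subalg[OF subalg_le[of "Suc k" m] A_adapted] measurable_from_subalg[OF subalg_le[of "Suc k" m] B_adapted]
      measurable_from_subalg[OF subalg_le[of k m] c_adapted] by auto
  have "(\<lambda>\<omega>. c k \<omega> * \<tau> (Suc k) * A (Suc k) \<omega> + c k \<omega> * G (Suc k) \<omega> + ((\<zeta> k \<omega>)\<^sup>2 - m\<zeta> k) / 2) \<in> borel_measurable (Fm m)"
    unfolding \<zeta>_def G_def by measurable
  then show ?thesis using X_eq[OF k(1)] by (simp cong: measurable_cong)
qed

text \<open>The square of a three-term sum costs a factor 3. The coefficient \<open>c^2\<close> is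
  replaced by its bound and factors from noise of total second moment at most
  \<open>2 * \<alpha>\<close>, whence \<open>6 * \<alpha>\<close>; the centred square contributes a
  summable \<open>1 / D^4\<close>.\<close>

lemma X_second_moment:
  assumes k: "k < n"
  shows "integrable M (\<lambda>\<omega>. (X k \<omega>)\<^sup>2)"
    "expectation (\<lambda>\<omega>. (X k \<omega>)\<^sup>2) \<le> 6 * \<alpha> * (expectation (\<lambda>\<omega>. I k \<omega> * \<bar>v k (u k \<omega>)\<bar>) / (D (Suc k))\<^sup>2) + K3 * (1 / D (Suc k) ^ 4)"
proof -
  have k': "Suc k \<le> n" using k by simp
  let ?a = "A (Suc k)" and ?g = "G (Suc k)" and ?d = "D (Suc k)" and ?h = "\<lambda>\<omega>. (\<zeta> k \<omega>)\<^sup>2 - m\<zeta> k"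
  let ?iv = "\<lambda>\<omega>. I k \<omega> * \<bar>v k (u k \<omega>)\<bar>"
  have Xm [measurable]: "X k \<in> borel_measurable M" using X_adapted[of k "Suc k"] k by (intro measurable_Fm[of _ "Suc k"]) auto
  define b where "b \<omega> = 3 / ?d\<^sup>2 * (?iv \<omega> * (1 * (?a \<omega>)\<^sup>2 + 1 * (?g \<omega>)\<^sup>2)) + 3/4 * (?h \<omega>)\<^sup>2" for \<omega>
  have t: "0 \<le> (\<tau> (Suc k))\<^sup>2" "(\<tau> (Suc k))\<^sup>2 \<le> 1" using tau_bounds[OF k'] by (auto intro: power_le_one)
  have pw: "(X k \<omega>)\<^sup>2 \<le> b \<omega>" for \<omega>
  proof -
    have s3: "(p + q + r)\<^sup>2 \<le> 3 * p\<^sup>2 + 3 * q\<^sup>2 + 3 * r\<^sup>2" for p q r :: real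
    proof -
      have "3 * p\<^sup>2 + 3 * q\<^sup>2 + 3 * r\<^sup>2 - (p + q + r)\<^sup>2 = (p - q)\<^sup>2 + (q - r)\<^sup>2 + (p - r)\<^sup>2"
        by (simp add: power2_eq_square algebra_simps)
      then show ?thesis by (smt (verit) zero_le_power2)
    qed
    have "(X k \<omega>)\<^sup>2 \<le> 3 * (c k \<omega> * \<tau> (Suc k) * ?a \<omega>)\<^sup>2 + 3 * (c k \<omega> * ?g \<omega>)\<^sup>2 + 3 * (?h \<omega> / 2)\<^sup>2"
      unfolding X_eq[OF k] by (rule s3)
    also have "(c k \<omega> * \<tau> (Suc k) * ?a \<omega>)\<^sup>2 = (c k \<omega>)\<^sup>2 * ((\<tau> (Suc k))\<^sup>2 * (?a \<omega>)\<^sup>2)" by (simp add: power_mult_distrib)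
    also have "\<dots> \<le> (?iv \<omega> / ?d\<^sup>2) * (1 * (?a \<omega>)\<^sup>2)"
      using c_bounds(2)[OF k] t Iv_bounds[OF k, of \<omega>] by (intro mult_mono) auto
    also have "(c k \<omega> * ?g \<omega>)\<^sup>2 \<le> (?iv \<omega> / ?d\<^sup>2) * (?g \<omega>)\<^sup>2"
      unfolding power_mult_distrib using c_bounds(2)[OF k] by (intro mult_right_mono) auto
    also have "3 * (?iv \<omega> / ?d\<^sup>2 * (1 * (?a \<omega>)\<^sup>2)) + 3 * (?iv \<omega> / ?d\<^sup>2 * (?g \<omega>)\<^sup>2) + 3 * (?h \<omega> / 2)\<^sup>2 = b \<omega>"
      by (simp add: b_def power_divide add_divide_distrib distrib_left)
    finally show ?thesis by simp
  qed
  have pm: "integrable M (\<lambda>\<omega>. ?iv \<omega> * (1 * (?a \<omega>)\<^sup>2 + 1 * (?g \<omega>)\<^sup>2))"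
    "expectation (\<lambda>\<omega>. ?iv \<omega> * (1 * (?a \<omega>)\<^sup>2 + 1 * (?g \<omega>)\<^sup>2)) = expectation ?iv * expectation (\<lambda>\<omega>. 1 * (?a \<omega>)\<^sup>2 + 1 * (?g \<omega>)\<^sup>2)"
    by (rule past_mult(5,6)[OF Iv_measurable Iv_abs[OF k]])+
  have bi: "integrable M b" unfolding b_def[abs_def] using pm(1) zeta_moments(5)[OF k]
    by (intro Bochner_Integration.integrable_add integrable_mult_right)
  show Xi: "integrable M (\<lambda>\<omega>. (X k \<omega>)\<^sup>2)"
  proof (rule Bochner_Integration.integrable_bound[OF bi])
    show "AE \<omega> in M. norm ((X k \<omega>)\<^sup>2) \<le> norm (b \<omega>)"
    proof (rule AE_I2)
      fix \<omega> show "norm ((X k \<omega>)\<^sup>2) \<le> norm (b \<omega>)" using pw[of \<omega>] zero_le_power2[of "X k \<omega>"] by simp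
    qed
  qed measurable
  have e0: "0 \<le> expectation ?iv" using Iv_bounds[OF k] by (intro integral_nonneg_AE) auto
  have q: "expectation (\<lambda>\<omega>. 1 * (?a \<omega>)\<^sup>2 + 1 * (?g \<omega>)\<^sup>2) \<le> 2 * \<alpha>"
    using A_integrable(2)[of 2 "Suc k"] G_integrable(2)[of 2 k] G_moments(3)[OF k] by (simp add: A_moments)
  have "expectation (\<lambda>\<omega>. (X k \<omega>)\<^sup>2) \<le> expectation b" using Xi bi pw by (intro integral_mono) auto
  also have "\<dots> = 3 / ?d\<^sup>2 * (expectation ?iv * expectation (\<lambda>\<omega>. 1 * (?a \<omega>)\<^sup>2 + 1 * (?g \<omega>)\<^sup>2)) + 3/4 * expectation (\<lambda>\<omega>. (?h \<omega>)\<^sup>2)"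
    unfolding b_def[abs_def] pm(2)[symmetric] using pm(1) zeta_moments(5)[OF k]
    by (subst Bochner_Integration.integral_add) (auto intro: integrable_mult_right simp del: mult_1)
  also have "\<dots> \<le> 3 / ?d\<^sup>2 * (expectation ?iv * (2 * \<alpha>)) + 1 * (K3 / ?d ^ 4)"
  proof (rule add_mono)
    show "3 / ?d\<^sup>2 * (expectation ?iv * expectation (\<lambda>\<omega>. 1 * (?a \<omega>)\<^sup>2 + 1 * (?g \<omega>)\<^sup>2)) \<le> 3 / ?d\<^sup>2 * (expectation ?iv * (2 * \<alpha>))"
      by (intro mult_left_mono q e0) simp
    have "0 \<le> expectation (\<lambda>\<omega>. (?h \<omega>)\<^sup>2)" by (rule integral_nonneg_AE) simp
    then show "3/4 * expectation (\<lambda>\<omega>. (?h \<omega>)\<^sup>2) \<le> 1 * (K3 / ?d ^ 4)" using zeta_moments(6)[OF k] by linarith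
  qed
  finally show "expectation (\<lambda>\<omega>. (X k \<omega>)\<^sup>2) \<le> 6 * \<alpha> * (expectation ?iv / ?d\<^sup>2) + K3 * (1 / ?d ^ 4)"
    by (simp add: mult_ac)
qed

text \<open>Orthogonality of martingale differences: the partial sum \<open>S\<close> is known at
  time \<open>m\<close>, and each of the three parts of \<open>S * X m\<close> is a function of the
  past times a centred function of the next noise pair.\<close>

lemma sum_X_orthogonal:
  assumes "m \<le> n"
  shows "integrable M (\<lambda>\<omega>. (\<Sum>k<m. X k \<omega>)\<^sup>2) \<and> expectation (\<lambda>\<omega>. (\<Sum>k<m. X k \<omega>)\<^sup>2) = (\<Sum>k<m. expectation (\<lambda>\<omega>. (X k \<omega>)\<^sup>2))"
  using assms
proof (induction m)
  case (Suc m)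
  then have m: "m < n" by simp
  define S where "S \<omega> = (\<Sum>k<m. X k \<omega>)" for \<omega>
  have S2: "integrable M (\<lambda>\<omega>. (S \<omega>)\<^sup>2)" "expectation (\<lambda>\<omega>. (S \<omega>)\<^sup>2) = (\<Sum>k<m. expectation (\<lambda>\<omega>. (X k \<omega>)\<^sup>2))"
    using Suc by (auto simp: S_def)
  have Sm [measurable]: "S \<in> borel_measurable (Fm m)"
    unfolding S_def[abs_def] using X_adapted m by (intro borel_measurable_sum) auto
  have SM [measurable]: "S \<in> borel_measurable M" by (rule measurable_Fm[OF Sm])
  have Si: "integrable M S" by (rule square_integrable_imp_integrable[OF SM S2(1)])
  have [measurable]: "c m \<in> borel_measurable (Fm m)" by (rule c_adapted)
  have Scm: "(\<lambda>\<omega>. S \<omega> * c m \<omega>) \<in> borel_measurable (Fm m)" by measurable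
  \<comment> \<open>\<open>S\<close> is unbounded, so \<open>past_mult\<close> does not apply;
    integrability is inherited from \<open>S\<close> because
    \<open>\<bar>c m\<bar> \<le> 1\<close>.\<close>
  have Sci: "integrable M (\<lambda>\<omega>. S \<omega> * c m \<omega>)"
  proof (rule Bochner_Integration.integrable_bound[OF Si measurable_Fm[OF Scm]])
    show "AE \<omega> in M. norm (S \<omega> * c m \<omega>) \<le> norm (S \<omega>)"
      using c_bounds(1)[OF m] by (auto simp: abs_mult intro!: mult_left_le)
  qed
  let ?a = "A (Suc m)" and ?g = "G (Suc m)"
  have e1: "integrable M (\<lambda>\<omega>. S \<omega> * c m \<omega> * ?a \<omega>)" "expectation (\<lambda>\<omega>. S \<omega> * c m \<omega> * ?a \<omega>) = 0"
    using indep_mult[OF Scm measurable_fst Sci] A_integrable(2)[of 1 "Suc m"] by (auto simp: A_moments)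
  have bi: "integrable M (\<lambda>\<omega>. B (Suc m) \<omega>)" using B_integrable(2)[of 1 m] by simp
  have e2': "integrable M (\<lambda>\<omega>. S \<omega> * c m \<omega> * B (Suc m) \<omega>)" "expectation (\<lambda>\<omega>. S \<omega> * c m \<omega> * B (Suc m) \<omega>) = 0"
    using indep_mult[OF Scm measurable_snd Sci] bi by (auto simp: B_moments)
  have e2: "integrable M (\<lambda>\<omega>. S \<omega> * c m \<omega> * ?g \<omega>)" "expectation (\<lambda>\<omega>. S \<omega> * c m \<omega> * ?g \<omega>) = 0"
    using e2' by (simp_all add: G_def)
  define h where "h p = (((fst p + snd p / \<rho> (Suc m)) / D (Suc m))\<^sup>2 - m\<zeta> m) / 2" for p :: "real \<times> real"
  have hm: "h \<in> borel_measurable (borel \<Otimes>\<^sub>M borel)" unfolding h_def[abs_def] by measurable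
  have h: "h (?a \<omega>, B (Suc m) \<omega>) = ((\<zeta> m \<omega>)\<^sup>2 - m\<zeta> m) / 2" for \<omega> by (simp add: h_def \<zeta>_def G_def)
  have hi: "integrable M (\<lambda>\<omega>. h (?a \<omega>, B (Suc m) \<omega>))" unfolding h using zeta_moments(2)[OF m] by simp
  have h0: "expectation (\<lambda>\<omega>. h (?a \<omega>, B (Suc m) \<omega>)) = 0" unfolding h using zeta_moments(2,3)[OF m] by (simp add: prob_space)
  have e3: "integrable M (\<lambda>\<omega>. S \<omega> * h (?a \<omega>, B (Suc m) \<omega>))" "expectation (\<lambda>\<omega>. S \<omega> * h (?a \<omega>, B (Suc m) \<omega>)) = 0"
    using indep_mult[OF Sm hm Si hi] h0 by auto
  have SX: "S \<omega> * X m \<omega> = \<tau> (Suc m) * (S \<omega> * c m \<omega> * ?a \<omega>) + S \<omega> * c m \<omega> * ?g \<omega> + S \<omega> * h (?a \<omega>, B (Suc m) \<omega>)" for \<omega>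
    unfolding h X_eq[OF m] by (simp add: algebra_simps)
  have sx: "integrable M (\<lambda>\<omega>. S \<omega> * X m \<omega>)" "expectation (\<lambda>\<omega>. S \<omega> * X m \<omega>) = 0"
    unfolding SX using e1 e2 e3 by simp_all
  have sq: "(\<Sum>k<Suc m. X k \<omega>)\<^sup>2 = (S \<omega>)\<^sup>2 + (X m \<omega>)\<^sup>2 + 2 * (S \<omega> * X m \<omega>)" for \<omega>
    by (simp add: S_def power2_sum)
  show ?case unfolding sq using S2 sx X_second_moment(1)[OF m] by simp
qed (simp add: prob_space)

definition CX :: real where "CX = 6 * \<alpha> * (3 + 4 * K'') + K3"

lemma sum_X_second_moment:
  assumes x: "x \<le> D n ^ 3"
  shows "expectation (\<lambda>\<omega>. (\<Sum>k<n. X k \<omega>)\<^sup>2) \<le> CX"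
proof -
  have K3: "0 \<le> K3" using alpha_pos by (simp add: K3_def)
  have "expectation (\<lambda>\<omega>. (\<Sum>k<n. X k \<omega>)\<^sup>2) = (\<Sum>k<n. expectation (\<lambda>\<omega>. (X k \<omega>)\<^sup>2))" using sum_X_orthogonal by simp
  also have "\<dots> \<le> (\<Sum>k<n. 6 * \<alpha> * (expectation (\<lambda>\<omega>. I k \<omega> * \<bar>v k (u k \<omega>)\<bar>) / (D (Suc k))\<^sup>2) + K3 * (1 / D (Suc k) ^ 4))"
    by (intro sum_mono X_second_moment(2)) simp
  also have "\<dots> = 6 * \<alpha> * (\<Sum>k<n. expectation (\<lambda>\<omega>. I k \<omega> * \<bar>v k (u k \<omega>)\<bar>) / (D (Suc k))\<^sup>2) + K3 * (\<Sum>k<n. 1 / D (Suc k) ^ 4)"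
    by (simp only: sum.distrib sum_distrib_left)
  also have "\<dots> \<le> 6 * \<alpha> * (3 + 4 * K'') + K3 * 1"
    using sum_Iv[OF x] sum_inverse_fourth alpha_pos K3 by (intro add_mono mult_left_mono) auto
  finally show ?thesis by (simp add: CX_def)
qed

definition CR :: real where "CR = 80 * (\<alpha> + 3 * \<alpha>\<^sup>2 + 3 * \<alpha> ^ 3) + 10 * \<alpha> * (3 + 4 * K'') + 5 + 8 * K''"

lemma R_expectation:
  assumes k: "k < n"
  shows "integrable M (R k)" "0 \<le> R k \<omega>"
    "expectation (R k) \<le> 80 * (\<alpha> + 3 * \<alpha>\<^sup>2 + 3 * \<alpha> ^ 3) * (1 / D (Suc k) ^ 3)
      + 10 * \<alpha> * (expectation (\<lambda>\<omega>. I k \<omega> * \<bar>v k (u k \<omega>)\<bar>) / (D (Suc k))\<^sup>2)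
      + 4 * (1 / D (Suc k) ^ 4) + 2 * (expectation (\<lambda>\<omega>. I k \<omega> * \<bar>u k \<omega>\<bar>) / (D (Suc k))\<^sup>2)"
proof -
  let ?a = "A (Suc k)" and ?g = "G (Suc k)" and ?d = "D (Suc k)"
  let ?iv = "\<lambda>\<omega>. I k \<omega> * \<bar>v k (u k \<omega>)\<bar>"
  have d: "0 < ?d" using D_step[OF k] by simp
  show "0 \<le> R k \<omega>" unfolding R_def using d I_bounds(1)[of k \<omega>]
    by (intro add_nonneg_nonneg divide_nonneg_nonneg mult_nonneg_nonneg) auto
  have pm: "integrable M (\<lambda>\<omega>. ?iv \<omega> * (5 * (?a \<omega>)\<^sup>2 + 5 * (?g \<omega>)\<^sup>2))"
    "expectation (\<lambda>\<omega>. ?iv \<omega> * (5 * (?a \<omega>)\<^sup>2 + 5 * (?g \<omega>)\<^sup>2)) = expectation ?iv * expectation (\<lambda>\<omega>. 5 * (?a \<omega>)\<^sup>2 + 5 * (?g \<omega>)\<^sup>2)"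
    by (rule past_mult(5,6)[OF Iv_measurable Iv_abs[OF k]])+
  note i = A_integrable(1)[of 3 "Suc k"] G_integrable(1)[of 3 k] pm(1) Iabs_integrable[of k]
  show "integrable M (R k)" unfolding R_def[abs_def] using i by simp
  have e: "expectation (R k) = 80 * (expectation (\<lambda>\<omega>. \<bar>?a \<omega>\<bar> ^ 3) + expectation (\<lambda>\<omega>. \<bar>?g \<omega>\<bar> ^ 3)) / ?d ^ 3
      + expectation ?iv * expectation (\<lambda>\<omega>. 5 * (?a \<omega>)\<^sup>2 + 5 * (?g \<omega>)\<^sup>2) / ?d\<^sup>2
      + 4 / ?d ^ 4 + 2 * expectation (\<lambda>\<omega>. I k \<omega> * \<bar>u k \<omega>\<bar>) / ?d\<^sup>2"
    unfolding R_def[abs_def] pm(2)[symmetric] using i by (simp add: prob_space)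
  have e0: "0 \<le> expectation ?iv" using Iv_bounds[OF k] by (intro integral_nonneg_AE) auto
  have q: "expectation (\<lambda>\<omega>. 5 * (?a \<omega>)\<^sup>2 + 5 * (?g \<omega>)\<^sup>2) \<le> 10 * \<alpha>"
    using A_integrable(2)[of 2 "Suc k"] G_integrable(2)[of 2 k] G_moments(3)[OF k] by (simp add: A_moments)
  have "expectation (\<lambda>\<omega>. \<bar>?a \<omega>\<bar> ^ 3) \<le> (\<alpha> + 3 * \<alpha>\<^sup>2) / 2"
    using abs_third_moment_le[OF A_measurable A_int, of "Suc k"] by (simp add: A_moments)
  moreover have "expectation (\<lambda>\<omega>. \<bar>?g \<omega>\<bar> ^ 3) \<le> (\<alpha> + (3 * \<alpha>\<^sup>2 + 6 * \<alpha> ^ 3)) / 2"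
    using abs_third_moment_le[OF G_measurable G_integrable(2)[of 4 k]] G_moments(3,4)[OF k] by simp
  ultimately have "80 * (expectation (\<lambda>\<omega>. \<bar>?a \<omega>\<bar> ^ 3) + expectation (\<lambda>\<omega>. \<bar>?g \<omega>\<bar> ^ 3)) / ?d ^ 3
     \<le> 80 * (\<alpha> + 3 * \<alpha>\<^sup>2 + 3 * \<alpha> ^ 3) / ?d ^ 3" using d by (intro divide_right_mono) auto
  moreover have "expectation ?iv * expectation (\<lambda>\<omega>. 5 * (?a \<omega>)\<^sup>2 + 5 * (?g \<omega>)\<^sup>2) / ?d\<^sup>2 \<le> expectation ?iv * (10 * \<alpha>) / ?d\<^sup>2"
    using q e0 by (intro divide_right_mono mult_left_mono) auto
  ultimately show "expectation (R k) \<le> 80 * (\<alpha> + 3 * \<alpha>\<^sup>2 + 3 * \<alpha> ^ 3) * (1 / ?d ^ 3)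
      + 10 * \<alpha> * (expectation ?iv / ?d\<^sup>2) + 4 * (1 / ?d ^ 4) + 2 * (expectation (\<lambda>\<omega>. I k \<omega> * \<bar>u k \<omega>\<bar>) / ?d\<^sup>2)"
    unfolding e by (simp add: mult_ac)
qed

lemma sum_R_expectation:
  assumes x: "x \<le> D n ^ 3"
  shows "expectation (\<lambda>\<omega>. \<Sum>k<n. R k \<omega>) \<le> CR"
proof -
  let ?c = "80 * (\<alpha> + 3 * \<alpha>\<^sup>2 + 3 * \<alpha> ^ 3)"
  have c: "0 \<le> ?c" using alpha_pos by simp
  have "expectation (\<lambda>\<omega>. \<Sum>k<n. R k \<omega>) = (\<Sum>k<n. expectation (R k))"
    using R_expectation(1) by (intro Bochner_Integration.integral_sum) auto
  also have "\<dots> \<le> (\<Sum>k<n. ?c * (1 / D (Suc k) ^ 3)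
      + 10 * \<alpha> * (expectation (\<lambda>\<omega>. I k \<omega> * \<bar>v k (u k \<omega>)\<bar>) / (D (Suc k))\<^sup>2)
      + 4 * (1 / D (Suc k) ^ 4) + 2 * (expectation (\<lambda>\<omega>. I k \<omega> * \<bar>u k \<omega>\<bar>) / (D (Suc k))\<^sup>2))"
    by (intro sum_mono R_expectation(3)) simp
  also have "\<dots> = ?c * (\<Sum>k<n. 1 / D (Suc k) ^ 3)
      + 10 * \<alpha> * (\<Sum>k<n. expectation (\<lambda>\<omega>. I k \<omega> * \<bar>v k (u k \<omega>)\<bar>) / (D (Suc k))\<^sup>2)
      + 4 * (\<Sum>k<n. 1 / D (Suc k) ^ 4) + 2 * (\<Sum>k<n. expectation (\<lambda>\<omega>. I k \<omega> * \<bar>u k \<omega>\<bar>) / (D (Suc k))\<^sup>2)"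
    by (simp only: sum.distrib sum_distrib_left)
  also have "\<dots> \<le> ?c * 1 + 10 * \<alpha> * (3 + 4 * K'') + 4 * (1/50) + 2 * (2 + 4 * K'')"
  proof (intro add_mono mult_left_mono)
    have "(\<Sum>k<n. 1 / D (Suc k) ^ 3) \<le> 2 / D n" by (rule sum_inverse_cube')
    also have "\<dots> \<le> 1" using D_ge_10[of n] by simp
    finally show "(\<Sum>k<n. 1 / D (Suc k) ^ 3) \<le> 1" .
  qed (use c alpha_pos sum_Iv[OF x] sum_abs_u[OF x] sum_inverse_fourth in auto)
  finally show ?thesis by (simp add: CR_def)
qed

section \<open>The logarithm of the product on the survival event, and its probabilistic
  form\<close>

definition main :: real where
  "main = (\<Sum>k<n. ln (\<rho> (Suc k))) + ln x + (1 - \<alpha>) / 2 * L"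

text \<open>Three replacements are made in \<open>ln_step\<close>: \<open>ln (1 - \<eta>)\<close> by
  its second order expansion, \<open>\<eta>^2\<close> by \<open>\<zeta>^2\<close>, and the drift
  factor by \<open>- \<delta> k / D k\<close>. Their errors are the parts of \<open>R\<close>; the
  mean of \<open>\<zeta>^2 / 2\<close> is split off as \<open>m\<zeta> k / 2\<close>, its
  fluctuation goes into \<open>X\<close>.\<close>

lemma ln_Y_step:
  assumes k: "k < n" and I: "I n \<omega> = 1"
  shows "\<bar>ln (Y k \<omega>) - (ln (\<rho> (Suc k)) - \<zeta> k \<omega> - m\<zeta> k / 2 - X k \<omega> - \<delta> k / D k
     + ln (D k * (1 + u k \<omega>)) - ln (D (Suc k) * (1 + u (Suc k) \<omega>)))\<bar> \<le> R k \<omega>"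
proof -
  have ub: "\<bar>u k \<omega>\<bar> \<le> 1/4" "\<bar>u (Suc k) \<omega>\<bar> \<le> 1/4" using I_nz[of n \<omega>] I k by auto
  have Ik: "I k \<omega> = 1" using I k by (auto simp: I_def split: if_splits)
  have k': "Suc k \<le> n" using k by simp
  let ?d = "D (Suc k)" and ?a = "\<bar>A (Suc k) \<omega>\<bar>" and ?g = "\<bar>G (Suc k) \<omega>\<bar>" and ?v = "\<bar>v k (u k \<omega>)\<bar>"
  have d: "0 < ?d" using D_step[OF k] by simp
  define N where "N = (?a + ?g) / ?d"
  have N0: "0 \<le> N" using d by (simp add: N_def)
  have eta: "\<eta> k \<omega> = (A (Suc k) \<omega> * (1 + (1 - \<tau> (Suc k)) * v k (u k \<omega>)) + B (Suc k) \<omega> / \<rho> (Suc k)) / (?d * (1 + v k (u k \<omega>)))"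
    by (simp add: \<eta>_def G_def)
  note ls = ln_step[OF k u_def ub(1) Y.simps(2) u_def ub(2), folded eta]
  note eb = eta_zeta_bounds[OF k ub(1), folded N_def]
  have T1: "\<bar>ln (1 - \<eta> k \<omega>) + \<eta> k \<omega> + (\<eta> k \<omega>)\<^sup>2 / 2\<bar> \<le> 80 * (?a ^ 3 + ?g ^ 3) / ?d ^ 3"
  proof -
    have "\<bar>ln (1 - \<eta> k \<omega>) + \<eta> k \<omega> + (\<eta> k \<omega>)\<^sup>2 / 2\<bar> \<le> 5/2 * \<bar>\<eta> k \<omega>\<bar> ^ 3" by (rule ln_taylor2[OF ls(1)])
    also have "\<dots> \<le> 5/2 * (2 * N) ^ 3" using eb(1) by (intro mult_left_mono power_mono) auto
    also have "\<dots> = 20 * N ^ 3" unfolding power_mult_distrib[of 2 N] by simp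
    also have "\<dots> = 20 * (?a + ?g) ^ 3 / ?d ^ 3" by (simp add: N_def power_divide)
    \<comment> \<open>Convexity of the cube; this is the origin of the 80 in
      \<open>R\<close>.\<close>
    also have "\<dots> \<le> 20 * (4 * (?a ^ 3 + ?g ^ 3)) / ?d ^ 3"
    proof (intro divide_right_mono mult_left_mono)
      have "4 * (a ^ 3 + g ^ 3) - (a + g) ^ 3 = 3 * ((a + g) * (a - g)\<^sup>2)" for a g :: real
        by (simp add: power2_eq_square power3_eq_cube algebra_simps)
      moreover have "0 \<le> (?a + ?g) * (?a - ?g)\<^sup>2" by (intro mult_nonneg_nonneg) auto
      ultimately show "(?a + ?g) ^ 3 \<le> 4 * (?a ^ 3 + ?g ^ 3)" by (smt (verit))
    qed (use d in auto)
    finally show ?thesis by simp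
  qed
  have T3: "\<bar>((\<eta> k \<omega>)\<^sup>2 - (\<zeta> k \<omega>)\<^sup>2) / 2\<bar> \<le> ?v * (5 * (A (Suc k) \<omega>)\<^sup>2 + 5 * (G (Suc k) \<omega>)\<^sup>2) / ?d\<^sup>2"
  proof -
    have "((\<eta> k \<omega>)\<^sup>2 - (\<zeta> k \<omega>)\<^sup>2) / 2 = (\<eta> k \<omega> - \<zeta> k \<omega>) * ((\<eta> k \<omega> + \<zeta> k \<omega>) / 2)"
      by (simp add: power2_eq_square algebra_simps)
    then have "\<bar>((\<eta> k \<omega>)\<^sup>2 - (\<zeta> k \<omega>)\<^sup>2) / 2\<bar> = \<bar>\<eta> k \<omega> - \<zeta> k \<omega>\<bar> * \<bar>(\<eta> k \<omega> + \<zeta> k \<omega>) / 2\<bar>" by (simp only: abs_mult)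
    also have "\<dots> \<le> (3/2 * (?v * N)) * (3/2 * N)"
      using eb(1,2,3) N0 by (intro mult_mono) auto
    also have "\<dots> = ?v * (9/4 * (?a + ?g)\<^sup>2) / ?d\<^sup>2" by (simp add: N_def power2_eq_square)
    also have "\<dots> \<le> ?v * (9/4 * (2 * ?a\<^sup>2 + 2 * ?g\<^sup>2)) / ?d\<^sup>2"
      by (intro divide_right_mono mult_left_mono sum_sq_le) auto
    also have "\<dots> \<le> ?v * (5 * (A (Suc k) \<omega>)\<^sup>2 + 5 * (G (Suc k) \<omega>)\<^sup>2) / ?d\<^sup>2"
      by (intro divide_right_mono mult_left_mono) auto
    finally show ?thesis .
  qed
  have pd: "0 < D k" using D_step[OF k] by simp
  have T5: "\<bar>ln (1 - \<delta> k / D k / (1 + u k \<omega>)) + \<delta> k / D k\<bar> \<le> 4 * (1 / ?d\<^sup>2)\<^sup>2 + 2 * \<bar>u k \<omega>\<bar> * (1 / ?d\<^sup>2)"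
    using delta_nonneg[of k] pd delta_div_le(2)[OF k'] inverse_sq_le[OF k'] ub(1) by (intro drift_expansion) auto
  have "R k \<omega> = 80 * (?a ^ 3 + ?g ^ 3) / ?d ^ 3 + ?v * (5 * (A (Suc k) \<omega>)\<^sup>2 + 5 * (G (Suc k) \<omega>)\<^sup>2) / ?d\<^sup>2
      + (4 * (1 / ?d\<^sup>2)\<^sup>2 + 2 * \<bar>u k \<omega>\<bar> * (1 / ?d\<^sup>2))"
    by (simp add: R_def Ik power_divide)
  moreover have "X k \<omega> = \<eta> k \<omega> - \<zeta> k \<omega> + ((\<zeta> k \<omega>)\<^sup>2 - m\<zeta> k) / 2" by (simp add: X_def Ik)
  ultimately show ?thesis using T1 T3 T5 unfolding ls(2) by (simp add: diff_divide_distrib abs_le_iff)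
qed

lemma Y_bounds: "I n \<omega> = 1 \<Longrightarrow> k \<le> n \<Longrightarrow> 0 < Y k \<omega> \<and> x / 2 \<le> Y n \<omega> \<and> Y n \<omega> \<le> 2 * x"
proof -
  have b: "x / 2 \<le> Y k \<omega> \<and> Y k \<omega> \<le> 2 * x" if "I n \<omega> = 1" "k \<le> n" for k
  proof -
    have ub: "\<bar>u k \<omega>\<bar> \<le> 1/4" using I_nz[of n \<omega> k] that by auto
    have d: "0 < D k" "D k \<le> x" using D_pos that D_le_x by auto
    have Y: "Y k \<omega> = \<rho> k + D k * u k \<omega>" using d by (simp add: u_def)
    define w where "w = D k * u k \<omega>"
    have "\<bar>w\<bar> \<le> D k * (1/4)" unfolding w_def abs_mult using ub d by (intro mult_mono) auto
    then have "x / 2 \<le> (x + D k) / 2 + w" "(x + D k) / 2 + w \<le> 2 * x" using d by (simp_all add: abs_le_iff field_simps)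
    then show ?thesis unfolding Y big_root_def w_def by simp
  qed
  assume "I n \<omega> = 1" "k \<le> n"
  then show ?thesis using b[of k] b[of n] x_pos by auto
qed

text \<open>The boundary terms \<open>s k\<close> telescope, and since \<open>u 0\<close> and
  \<open>u n\<close> lie in the window only \<open>ln (D 0 / D n) = L\<close> remains up to 1. The
  last factor \<open>Y n\<close> has no successor and is compared with \<open>x\<close>
  directly.\<close>

lemma ln_prod_approx:
  assumes I: "I n \<omega> = 1"
  shows "\<bar>ln (\<Prod>k\<le>n. Y k \<omega>) - main + (\<Sum>k<n. \<zeta> k \<omega>)\<bar> \<le> 2 * \<alpha> + 4 + (\<Sum>k<n. R k \<omega>) + \<bar>\<Sum>k<n. X k \<omega>\<bar>"
proof -
  define s where "s k = ln (D k * (1 + u k \<omega>))" for k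
  have lnP: "ln (\<Prod>k\<le>n. Y k \<omega>) = (\<Sum>k<n. ln (Y k \<omega>)) + ln (Y n \<omega>)"
  proof -
    have pos: "0 < Y k \<omega>" if "k \<le> n" for k using Y_bounds[OF I that] by simp
    have "ln (\<Prod>k\<le>n. Y k \<omega>) = (\<Sum>k\<le>n. ln (Y k \<omega>))"
      by (intro ln_prod) (auto dest: pos simp del: Y.simps)
    then show ?thesis by (simp add: lessThan_Suc_atMost[symmetric])
  qed
  have "\<bar>\<Sum>k<n. ln (Y k \<omega>) - (ln (\<rho> (Suc k)) - \<zeta> k \<omega> - m\<zeta> k / 2 - X k \<omega> - \<delta> k / D k + s k - s (Suc k))\<bar> \<le> (\<Sum>k<n. R k \<omega>)"
    unfolding s_def by (intro order.trans[OF sum_abs] sum_mono ln_Y_step I) simp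
  also have "(\<Sum>k<n. ln (Y k \<omega>) - (ln (\<rho> (Suc k)) - \<zeta> k \<omega> - m\<zeta> k / 2 - X k \<omega> - \<delta> k / D k + s k - s (Suc k)))
     = (\<Sum>k<n. ln (Y k \<omega>)) - (\<Sum>k<n. ln (\<rho> (Suc k))) + (\<Sum>k<n. \<zeta> k \<omega>) + (\<Sum>k<n. m\<zeta> k) / 2 + (\<Sum>k<n. X k \<omega>)
       + (\<Sum>k<n. \<delta> k / D k) - (\<Sum>k<n. s k - s (Suc k))"
    by (simp add: sum_subtractf sum.distrib sum_divide_distrib)
  also have "(\<Sum>k<n. s k - s (Suc k)) = s 0 - s n" by (rule sum_lessThan_telescope')
  finally have 1: "\<bar>(\<Sum>k<n. ln (Y k \<omega>)) - (\<Sum>k<n. ln (\<rho> (Suc k))) + (\<Sum>k<n. \<zeta> k \<omega>) + (\<Sum>k<n. m\<zeta> k) / 2 + (\<Sum>k<n. X k \<omega>)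
       + (\<Sum>k<n. \<delta> k / D k) - (s 0 - s n)\<bar> \<le> (\<Sum>k<n. R k \<omega>)" .
  have 2: "\<bar>(\<Sum>k<n. m\<zeta> k) - \<alpha> * L\<bar> \<le> 4 * \<alpha>"
  proof -
    have "(\<Sum>k<n. m\<zeta> k) = \<alpha> * (\<Sum>k<n. (1 + \<tau> (Suc k)) / (D (Suc k))\<^sup>2)" by (simp add: m\<zeta>_def sum_distrib_left)
    then have "(\<Sum>k<n. m\<zeta> k) - \<alpha> * L = \<alpha> * ((\<Sum>k<n. (1 + \<tau> (Suc k)) / (D (Suc k))\<^sup>2) - L)"
      by (simp add: right_diff_distrib)
    then show ?thesis using sum_variance alpha_pos by (simp add: abs_mult)
  qed
  have l1: "\<bar>ln (1 + u k \<omega>)\<bar> \<le> 1/2" if "k \<le> n" for k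
  proof -
    have ub: "\<bar>u k \<omega>\<bar> \<le> 1/4" using I_nz[of n \<omega> k] I that by auto
    then have "- 1 < u k \<omega>" "u k \<omega> \<le> 1/4" by linarith+
    then have "ln (1 + u k \<omega>) \<le> 1/2" using ln_add_one_self_le_self2[of "u k \<omega>"] by linarith
    moreover have "- ln (1 + u k \<omega>) \<le> 1/2"
    proof -
      have p: "0 < 1 + u k \<omega>" using ub by (simp add: abs_le_iff)
      have "- ln (1 + u k \<omega>) = ln (1 / (1 + u k \<omega>))" using p by (simp add: ln_div)
      also have "\<dots> \<le> 1 / (1 + u k \<omega>) - 1" using p by (intro ln_le_minus_one) simp
      also have "\<dots> \<le> 1 / (3/4) - 1" using ub by (intro diff_right_mono divide_left_mono) (auto simp: abs_le_iff)
      finally show ?thesis by simp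
    qed
    ultimately show ?thesis by (simp add: abs_le_iff)
  qed
  have s: "s k = ln (D k) + ln (1 + u k \<omega>)" if "k \<le> n" for k
  proof -
    have "\<bar>u k \<omega>\<bar> \<le> 1/4" using I_nz[of n \<omega> k] I that by auto
    then show ?thesis unfolding s_def using D_pos[OF that] by (intro ln_mult_pos) (auto simp: abs_le_iff)
  qed
  have 3: "\<bar>(s 0 - s n) - L\<bar> \<le> 1"
  proof -
    have "s 0 - s n = ln (D 0) - ln (D n) + (ln (1 + u 0 \<omega>) - ln (1 + u n \<omega>))" using s[of 0] s[of n] by simp
    also have "ln (D 0) - ln (D n) = L" using D_pos[of n] x_pos by (simp add: L_def D_0 ln_div)
    finally show ?thesis using l1[OF le0] l1[OF order_refl] by linarith
  qed
  have 4: "\<bar>ln (Y n \<omega>) - ln x\<bar> \<le> 1"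
  proof -
    have y: "x / 2 \<le> Y n \<omega>" "Y n \<omega> \<le> 2 * x" using Y_bounds[OF I order_refl] by auto
    then have p: "0 < Y n \<omega>" using x_pos by simp
    have "ln (x / 2) \<le> ln (Y n \<omega>)" "ln (Y n \<omega>) \<le> ln (2 * x)" using y p x_pos by (auto intro!: ln_mono)
    moreover have "ln (x / 2) = ln x - ln 2" "ln (2 * x) = ln 2 + ln x" using x_pos by (simp_all add: ln_div ln_mult_pos)
    moreover have "ln 2 \<le> (1::real)" using ln_le_minus_one[of "2::real"] by simp
    ultimately show ?thesis by (simp add: abs_le_iff)
  qed
  \<comment> \<open>The coefficient \<open>(1 - \<alpha>) / 2\<close> of \<open>L\<close> is a
    balance: the boundary terms give 1, the drift takes \<open>1/2\<close>, and the mean of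
    \<open>\<zeta>^2 / 2\<close> takes \<open>\<alpha> / 2\<close>.\<close>
  have "main = (\<Sum>k<n. ln (\<rho> (Suc k))) + ln x + (L / 2 - \<alpha> * L / 2)"
    by (simp add: main_def field_simps)
  then show ?thesis unfolding lnP using 1 2 3 4 sum_delta by (simp only: combine_errors)
qed

text \<open>Three bad events are added: an exit before \<open>n\<close>, a large remainder sum
  (Markov), and a large martingale (Chebyshev). \<open>T\<close> stands for the logarithm of the
  determinant, which agrees with that of the product only on the survival event.\<close>

theorem ln_prod_approx_prob:
  assumes x: "x \<le> D n ^ 3" and T [measurable]: "T \<in> borel_measurable M"
    and TY: "\<And>\<omega>. \<omega> \<in> space M \<Longrightarrow> I n \<omega> = 1 \<Longrightarrow> T \<omega> = ln (\<Prod>k\<le>n. Y k \<omega>)" and l: "l > 0"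
  shows "prob {\<omega> \<in> space M. \<bar>T \<omega> - main + (\<Sum>k<n. \<zeta> k \<omega>)\<bar> > 2 * \<alpha> + 4 + 2 * l}
    \<le> 256 * K'' * (x / D n ^ 3) + CR / l + CX / l\<^sup>2"
proof -
  let ?R = "\<lambda>\<omega>. \<Sum>k<n. R k \<omega>" and ?X = "\<lambda>\<omega>. \<Sum>k<n. X k \<omega>"
  have Xm: "X k \<in> borel_measurable M" if "k < n" for k
    using X_adapted[of k "Suc k"] that by (intro measurable_Fm[of _ "Suc k"]) auto
  have [measurable]: "?X \<in> borel_measurable M" using Xm by (intro borel_measurable_sum) auto
  have Ri: "integrable M ?R" using R_expectation(1) by (intro Bochner_Integration.integrable_sum) auto
  then have [measurable]: "?R \<in> borel_measurable M" by auto
  let ?B1 = "{\<omega> \<in> space M. I n \<omega> \<noteq> 1}" and ?B2 = "{\<omega> \<in> space M. ?R \<omega> \<ge> l}" and ?B3 = "{\<omega> \<in> space M. (?X \<omega>)\<^sup>2 \<ge> l\<^sup>2}"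
  have B1: "prob ?B1 \<le> 256 * K'' * (x / D n ^ 3)"
  proof -
    have "expectation (I n) = expectation (indicator {\<omega> \<in> space M. I n \<omega> = 1})"
      by (intro Bochner_Integration.integral_cong) (auto simp: I_def indicator_def)
    also have "\<dots> = prob {\<omega> \<in> space M. I n \<omega> = 1}" by simp
    finally have "prob {\<omega> \<in> space M. I n \<omega> = 1} = expectation (I n)" ..
    moreover have "prob ?B1 = 1 - prob {\<omega> \<in> space M. I n \<omega> = 1}" by (rule prob_neg) measurable
    ultimately show ?thesis using exit_probability by simp
  qed
  have B2: "prob ?B2 \<le> CR / l"
  proof -
    have "prob ?B2 \<le> expectation ?R / l"
      using l R_expectation(2) by (intro integral_Markov_inequality_measure[OF Ri sets.top] AE_I2 sum_nonneg) auto
    also have "\<dots> \<le> CR / l" using sum_R_expectation[OF x] l by (intro divide_right_mono) auto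
    finally show ?thesis .
  qed
  have B3: "prob ?B3 \<le> CX / l\<^sup>2"
  proof -
    have "prob ?B3 \<le> expectation (\<lambda>\<omega>. (?X \<omega>)\<^sup>2) / l\<^sup>2"
      using l sum_X_orthogonal[of n] by (intro integral_Markov_inequality_measure[OF _ sets.top] AE_I2) auto
    also have "\<dots> \<le> CX / l\<^sup>2" using sum_X_second_moment[OF x] l by (intro divide_right_mono) auto
    finally show ?thesis .
  qed
  have "{\<omega> \<in> space M. \<bar>T \<omega> - main + (\<Sum>k<n. \<zeta> k \<omega>)\<bar> > 2 * \<alpha> + 4 + 2 * l} \<subseteq> ?B1 \<union> (?B2 \<union> ?B3)"
  proof (rule subsetI, rule ccontr)
    fix \<omega> assume a: "\<omega> \<in> {\<omega> \<in> space M. \<bar>T \<omega> - main + (\<Sum>k<n. \<zeta> k \<omega>)\<bar> > 2 * \<alpha> + 4 + 2 * l}" and "\<omega> \<notin> ?B1 \<union> (?B2 \<union> ?B3)"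
    then have I: "I n \<omega> = 1" and r: "?R \<omega> < l" and xx: "(?X \<omega>)\<^sup>2 < l\<^sup>2" by auto
    have "\<bar>?X \<omega>\<bar> < l" using abs_le_square_iff[of l "?X \<omega>"] xx l by linarith
    then have "\<bar>T \<omega> - main + (\<Sum>k<n. \<zeta> k \<omega>)\<bar> \<le> 2 * \<alpha> + 4 + 2 * l"
      using ln_prod_approx[OF I] r TY[of \<omega>] a I by simp
    then show False using a by simp
  qed
  then have "prob {\<omega> \<in> space M. \<bar>T \<omega> - main + (\<Sum>k<n. \<zeta> k \<omega>)\<bar> > 2 * \<alpha> + 4 + 2 * l} \<le> prob (?B1 \<union> (?B2 \<union> ?B3))"
    by (intro finite_measure_mono) auto
  also have "\<dots> \<le> prob ?B1 + prob (?B2 \<union> ?B3)" by (intro measure_Un_le) auto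
  also have "prob (?B2 \<union> ?B3) \<le> prob ?B2 + prob ?B3" by (intro measure_Un_le) auto
  finally show ?thesis using B1 B2 B3 by simp
qed

text \<open>On survival every \<open>Y k\<close> is positive, so no minor vanishes and the
  three-term recursion can be divided by the previous minor, which is the Riccati recursion up to
  sign. The off-diagonal entries enter through their squares.\<close>

lemma det_eq_prod:
  assumes I: "I n \<omega> = 1" and m: "m \<le> n"
    and a: "\<And>k. a (Suc k) = A k \<omega>" and b: "\<And>k. (b (Suc k))\<^sup>2 = real (Suc k) + B (Suc k) \<omega>"
  shows "\<bar>det (tridiag (Suc m) (\<lambda>i. a i - x) b)\<bar> = (\<Prod>k\<le>m. Y k \<omega>)"
proof -
  let ?P = "\<lambda>j. det (tridiag j (\<lambda>i. a i - x) b)"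
  have rec: "?P (Suc j) = - Y j \<omega> * ?P j \<and> ?P j \<noteq> 0" if "j \<le> n" for j
    using that
  proof (induction j)
    case 0
    then show ?case by (simp add: det_tridiag_0 det_tridiag_1 a[of 0, simplified])
  next
    case (Suc j)
    then have IH: "?P (Suc j) = - Y j \<omega> * ?P j" "?P j \<noteq> 0" by auto
    have Yj: "Y j \<omega> \<noteq> 0" using Y_bounds[OF I, of j] Suc.prems by auto
    have nz: "?P (Suc j) \<noteq> 0" using IH Yj by simp
    have Pj: "?P j = - ?P (Suc j) / Y j \<omega>" using IH Yj by (simp add: field_simps)
    have "?P (Suc (Suc j)) = (a (j + 2) - x) * ?P (Suc j) - (b (j + 1))\<^sup>2 * ?P j" by (rule det_tridiag_Suc_Suc)
    also have "\<dots> = (A (Suc j) \<omega> - x) * ?P (Suc j) + (real (Suc j) + B (Suc j) \<omega>) * ?P (Suc j) / Y j \<omega>"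
      using a[of "Suc j"] b[of j] by (subst Pj) simp
    also have "\<dots> = - Y (Suc j) \<omega> * ?P (Suc j)" by (simp add: algebra_simps)
    finally show ?case using nz by simp
  qed
  show ?thesis using m
  proof (induction m)
    case 0
    then show ?case using rec[of 0] Y_bounds[OF I, of 0] by (simp add: det_tridiag_0)
  next
    case (Suc m)
    then have "\<bar>?P (Suc (Suc m))\<bar> = Y (Suc m) \<omega> * \<bar>?P (Suc m)\<bar>"
      using rec[of "Suc m"] Y_bounds[OF I, of "Suc m"] by (simp add: abs_mult del: Y.simps)
    then show ?case using Suc by (simp add: prod.atMost_Suc mult.commute del: Y.simps)
  qed
qed

end

section \<open>The filtration generated by the matrix entries\<close>

context prob_space begin

lemma sets_vimage_algebra_subset:
  assumes "f \<in> measurable N S" "space N = X"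
  shows "sets (vimage_algebra X f S) \<subseteq> sets N"
  unfolding sets_vimage_algebra using assms measurable_sets[OF assms(1)]
  by (intro sets.sigma_sets_subset[of _ N, unfolded assms(2)]) auto

text \<open>Independence of \<sigma>-algebras passes to functions measurable with respect to them;
  this lets the past be an arbitrary function of the earlier entries.\<close>

lemma indep_var_vimage_algebra:
  assumes ind: "indep_set (sets F) (sets F')" and sp: "space F = space M" "space F' = space M"
    and f: "f \<in> measurable F S" and g: "g \<in> measurable F' T"
  shows "indep_var S f T g"
proof -
  have i: "sets F \<subseteq> events" "sets F' \<subseteq> events" "\<forall>a\<in>sets F. \<forall>b\<in>sets F'. prob (a \<inter> b) = prob a * prob b"
    using ind unfolding indep_sets2_eq by auto
  have fM: "f \<in> measurable M S" using i(1) sp f by (intro measurable_from_subalg[OF _ f]) (auto simp: subalgebra_def)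
  have gM: "g \<in> measurable M T" using i(2) sp g by (intro measurable_from_subalg[OF _ g]) (auto simp: subalgebra_def)
  have 1: "sigma_sets (space M) {f -` A \<inter> space M | A. A \<in> sets S} \<subseteq> sets F"
    using measurable_sets[OF f] sp by (intro sets.sigma_sets_subset[of _ F, unfolded sp]) auto
  have 2: "sigma_sets (space M) {g -` A \<inter> space M | A. A \<in> sets T} \<subseteq> sets F'"
    using measurable_sets[OF g] sp by (intro sets.sigma_sets_subset[of _ F', unfolded sp]) auto
  show ?thesis unfolding indep_var_eq indep_sets2_eq
    by (intro conjI ballI fM gM order.trans[OF 1 i(1)] order.trans[OF 2 i(2)]
        bspec[OF bspec[OF i(3) subsetD[OF 1]] subsetD[OF 2]])
qed

lemma indep_vars_vimage_algebra:
  assumes "indep_vars N X J" "P \<inter> Q = {}" "P \<subseteq> J" "Q \<subseteq> J"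
  shows "indep_set (sets (vimage_algebra (space M) (\<lambda>\<omega>. \<lambda>i\<in>P. X i \<omega>) (PiM P N)))
     (sets (vimage_algebra (space M) (\<lambda>\<omega>. \<lambda>i\<in>Q. X i \<omega>) (PiM Q N)))"
  using indep_var_restrict[OF assms] unfolding indep_var_eq sets_vimage_algebra by simp

lemma measurable_vimage_algebra_component:
  assumes "i \<in> P" "\<And>i \<omega>. i \<in> P \<Longrightarrow> \<omega> \<in> \<Omega> \<Longrightarrow> X i \<omega> \<in> space (N i)"
  shows "X i \<in> measurable (vimage_algebra \<Omega> (\<lambda>\<omega>. \<lambda>i\<in>P. X i \<omega>) (PiM P N)) (N i)"
proof -
  have "(\<lambda>\<omega>. \<lambda>i\<in>P. X i \<omega>) \<in> measurable (vimage_algebra \<Omega> (\<lambda>\<omega>. \<lambda>i\<in>P. X i \<omega>) (PiM P N)) (PiM P N)"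
    using assms by (intro measurable_vimage_algebra1) (auto simp: space_PiM)
  from measurable_compose[OF this measurable_component_singleton[OF assms(1)]]
  show ?thesis using assms(1) by simp
qed

text \<open>The filtration is generated by growing blocks of entries. Disjoint blocks of an
  independent family generate independent \<sigma>-algebras, which yields independence of past and
  next pair, and also that \<open>A\<close> and \<open>B\<close> of one step are
  uncorrelated.\<close>

lemma noise_tridiagonal:
  fixes a b :: "nat \<Rightarrow> 'a \<Rightarrow> real"
  assumes alpha: "\<alpha> > 0"
    and ind: "indep_vars (\<lambda>_. borel) (\<lambda>k. case k of Inl i \<Rightarrow> a i | Inr i \<Rightarrow> b i) (Inl ` {1..} \<union> Inr ` {1..})"
    and a: "\<And>i. i \<ge> 1 \<Longrightarrow> distributed M lborel (a i) (normal_density 0 (sqrt \<alpha>))"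
    and b: "\<And>i. i \<ge> 1 \<Longrightarrow> distributed M lborel (\<lambda>\<omega>. (2 / \<alpha>) * (b i \<omega>)\<^sup>2) (chi2_density (2 * real i / \<alpha>))"
  shows "\<exists>Fm. noise M \<alpha> Fm (\<lambda>k. a (Suc k)) (\<lambda>k \<omega>. if k = 0 then 0 else (b k \<omega>)\<^sup>2 - real k)"
proof -
  define Z where "Z k = (case k of Inl i \<Rightarrow> a i | Inr i \<Rightarrow> b i)" for k
  define J where "J = (Inl ` {1..} \<union> Inr ` {1..} :: (nat + nat) set)"
  \<comment> \<open>The indices are staggered: step \<open>k\<close> consumes
    \<open>a (k + 1)\<close> and \<open>b k\<close>, so the past at time \<open>k\<close> holds one
    more diagonal than off-diagonal entry, and the next pair is \<open>a (k + 2)\<close>,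
    \<open>b (k + 1)\<close>.\<close>
  define P where "P k = (Inl ` {1..Suc k} \<union> Inr ` {1..k} :: (nat + nat) set)" for k
  define Q where "Q k = ({Inl (Suc (Suc k)), Inr (Suc k)} :: (nat + nat) set)" for k
  define F where "F S = vimage_algebra (space M) (\<lambda>\<omega>. \<lambda>i\<in>S. Z i \<omega>) (PiM S (\<lambda>_. borel :: real measure))" for S
  have ind': "indep_vars (\<lambda>_. borel) Z J" using ind by (simp add: Z_def[abs_def] J_def)
  have Zm: "Z i \<in> borel_measurable M" if "i \<in> J" for i using ind' that unfolding indep_vars_def2 by blast
  have spF: "space (F S) = space M" for S by (simp add: F_def)
  have Fc: "Z i \<in> borel_measurable (F S)" if "i \<in> S" for i S
    unfolding F_def using that measurable_vimage_algebra_component[of i S "space M" Z "\<lambda>_. borel"] by simp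
  have Fmono: "sets (F S) \<subseteq> sets N" if "\<And>i. i \<in> S \<Longrightarrow> Z i \<in> borel_measurable N" "space N = space M" for S N
    unfolding F_def using that by (intro sets_vimage_algebra_subset measurable_restrict) auto
  have PJ: "P k \<subseteq> J" "Q k \<subseteq> J" "P k \<inter> Q k = {}" "P k \<subseteq> P (Suc k)" for k by (auto simp: P_def Q_def J_def)
  have sub: "subalgebra M (F (P k))" for k
  proof -
    have "sets (F (P k)) \<subseteq> events" by (rule Fmono) (use PJ(1)[of k] Zm in auto)
    then show ?thesis by (simp add: subalgebra_def spF)
  qed
  have indF: "indep_set (sets (F S)) (sets (F T))" if "S \<inter> T = {}" "S \<subseteq> J" "T \<subseteq> J" for S T
    unfolding F_def by (rule indep_vars_vimage_algebra[OF ind' that])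
  define B where "B k \<omega> = (if k = 0 then 0 else (b k \<omega>)\<^sup>2 - real k)" for k \<omega>
  have BS: "B (Suc k) \<omega> = (b (Suc k) \<omega>)\<^sup>2 - real (Suc k)" for k \<omega> by (simp add: B_def)
  have Za: "Z (Inl i) = a i" and Zb: "Z (Inr i) = b i" for i by (simp_all add: Z_def)
  have aF: "a (Suc k) \<in> borel_measurable (F S)" if "Inl (Suc k) \<in> S" for k S
    using Fc[OF that] by (simp add: Za)
  have BF: "B k \<in> borel_measurable (F S)" if "k \<ge> 1 \<Longrightarrow> Inr k \<in> S" for k S
  proof (cases "k = 0")
    case True then show ?thesis by (simp add: B_def[abs_def])
  next
    case False
    then have [measurable]: "b k \<in> borel_measurable (F S)" using Fc[of "Inr k" S] that by (simp add: Zb)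
    show ?thesis unfolding B_def[abs_def] by measurable
  qed
  have am: "a (Suc k) \<in> borel_measurable M" for k using Zm[of "Inl (Suc k)"] by (simp add: J_def Za)
  have bm [measurable]: "b (Suc k) \<in> borel_measurable M" for k using Zm[of "Inr (Suc k)"] by (simp add: J_def Zb)
  have am1: "integrable M (a (Suc k))" for k
    using normal_moments(1)[OF alpha a, of "Suc k" 1] by simp
  have B4: "integrable M (\<lambda>\<omega>. B (Suc k) \<omega> ^ 4)" "expectation (B (Suc k)) = 0"
    "expectation (\<lambda>\<omega>. (B (Suc k) \<omega>)\<^sup>2) = \<alpha> * real (Suc k)"
    "expectation (\<lambda>\<omega>. B (Suc k) \<omega> ^ 4) = 3 * \<alpha>\<^sup>2 * (real (Suc k))\<^sup>2 + 6 * \<alpha> ^ 3 * real (Suc k)" for k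
    unfolding BS using chi2_central_moments[OF alpha _ b[of "Suc k"]] by auto
  have Bi: "integrable M (B (Suc k))" for k
  proof -
    have [measurable]: "B (Suc k) \<in> borel_measurable M" unfolding BS by measurable
    show ?thesis using integrable_power_le(2)[OF _ B4(1), of k 1] by simp
  qed
  have "noise M \<alpha> (\<lambda>k. F (P k)) (\<lambda>k. a (Suc k)) B"
  proof
    show "\<alpha> > 0" by (rule alpha)
    show "subalgebra M (F (P k))" for k by (rule sub)
    show "subalgebra (F (P (Suc k))) (F (P k))" for k
    proof -
      have "sets (F (P k)) \<subseteq> sets (F (P (Suc k)))" by (rule Fmono) (use PJ(4)[of k] Fc spF in auto)
      then show ?thesis by (simp add: subalgebra_def spF)
    qed
    show "a (Suc k) \<in> borel_measurable (F (P k))" for k by (rule aF) (auto simp: P_def)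
    show "B k \<in> borel_measurable (F (P k))" for k by (rule BF) (auto simp: P_def)
    show "indep_var borel f borel (\<lambda>\<omega>. g (a (Suc (Suc k)) \<omega>, B (Suc k) \<omega>))"
      if f: "f \<in> borel_measurable (F (P k))" and g: "g \<in> borel_measurable (borel \<Otimes>\<^sub>M borel)" for k and f g :: "_ \<Rightarrow> real"
    proof (rule indep_var_vimage_algebra[OF indF[of "P k" "Q k"] spF spF f])
      have "(\<lambda>\<omega>. (a (Suc (Suc k)) \<omega>, B (Suc k) \<omega>)) \<in> measurable (F (Q k)) (borel \<Otimes>\<^sub>M borel)"
        by (intro measurable_Pair aF BF) (auto simp: Q_def)
      from measurable_compose[OF this g] show "(\<lambda>\<omega>. g (a (Suc (Suc k)) \<omega>, B (Suc k) \<omega>)) \<in> borel_measurable (F (Q k))" .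
    qed (use PJ in auto)
    show "integrable M (\<lambda>\<omega>. a (Suc k) \<omega> ^ 4)" "expectation (a (Suc k)) = 0" "expectation (\<lambda>\<omega>. (a (Suc k) \<omega>)\<^sup>2) = \<alpha>"
      "expectation (\<lambda>\<omega>. a (Suc k) \<omega> ^ 4) = 3 * \<alpha>\<^sup>2" for k
      using normal_moments[OF alpha a[of "Suc k"]] by auto
    show "expectation (\<lambda>\<omega>. a (Suc (Suc k)) \<omega> * B (Suc k) \<omega>) = 0" for k
    proof -
      have "indep_var borel (a (Suc (Suc k))) borel (B (Suc k))"
        by (rule indep_var_vimage_algebra[OF indF[of "{Inl (Suc (Suc k))}" "{Inr (Suc k)}"] spF spF])
           (auto simp: J_def intro!: aF BF)
      from indep_var_lebesgue_integral[OF this am1 Bi] show ?thesis by (simp add: B4)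
    qed
  qed (rule B4)+
  then show ?thesis unfolding B_def[abs_def] by blast
qed

end

section \<open>Asymptotics of the deterministic terms\<close>

lemma exp_expansion4:
  obtains q :: real where "0 \<le> q" "q \<le> exp \<bar>y\<bar> / 24 * y ^ 4" "exp y = 1 + y + y\<^sup>2 / 2 + y ^ 3 / 6 + q"
proof -
  obtain t where t: "\<bar>t\<bar> \<le> \<bar>y\<bar>" "exp y = (\<Sum>m<4. y ^ m / fact m) + exp t / fact 4 * y ^ 4"
    using Maclaurin_exp_le[of y 4] by blast
  have "exp t \<le> exp \<bar>y\<bar>" using t(1) by simp
  then have "exp t / fact 4 * y ^ 4 \<le> exp \<bar>y\<bar> / 24 * y ^ 4"
    by (intro mult_right_mono) (auto simp: fact_numeral zero_le_even_power)
  moreover have "exp y = 1 + y + y\<^sup>2 / 2 + y ^ 3 / 6 + exp t / fact 4 * y ^ 4"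
    unfolding t(2) by (simp add: eval_nat_numeral fact_numeral lessThan_Suc)
  ultimately show ?thesis by (intro that[of "exp t / fact 4 * y ^ 4"]) (auto simp: zero_le_even_power)
qed

text \<open>With \<open>2 cosh \<phi> = 2 + s\<close> the expression is
  \<open>\<phi>^2 - 2/3 \<phi>^3 + O(\<phi>^4)\<close>, and \<open>\<phi>^2 = s + O(s^2)\<close>.
  Multiplied by \<open>N\<close> at \<open>s = N powr (-2/3) * \<sigma>\<close>, it gives the
  centring terms \<open>\<sigma> N^(1/3)\<close> and \<open>2/3 \<sigma>^(3/2)\<close>.\<close>

lemma edge_expansion:
  fixes \<phi> s :: real
  assumes p: "0 \<le> \<phi>" and s: "exp \<phi> + exp (- \<phi>) = 2 + s" and s1: "s \<le> 1"
  shows "\<bar>\<phi> + exp (- 2 * \<phi>) / 2 - 1 / 2 - (s - 2/3 * (sqrt s) ^ 3)\<bar> \<le> 6 * s\<^sup>2"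
proof -
  obtain q1 where q1: "0 \<le> q1" "q1 \<le> exp \<bar>\<phi>\<bar> / 24 * \<phi> ^ 4" "exp \<phi> = 1 + \<phi> + \<phi>\<^sup>2 / 2 + \<phi> ^ 3 / 6 + q1"
    by (rule exp_expansion4)
  obtain q2 where q2: "0 \<le> q2" "q2 \<le> exp \<bar>- \<phi>\<bar> / 24 * (- \<phi>) ^ 4" "exp (- \<phi>) = 1 + (- \<phi>) + (- \<phi>)\<^sup>2 / 2 + (- \<phi>) ^ 3 / 6 + q2"
    by (rule exp_expansion4)
  obtain q3 where q3: "0 \<le> q3" "q3 \<le> exp \<bar>- 2 * \<phi>\<bar> / 24 * (- 2 * \<phi>) ^ 4"
      "exp (- 2 * \<phi>) = 1 + (- 2 * \<phi>) + (- 2 * \<phi>)\<^sup>2 / 2 + (- 2 * \<phi>) ^ 3 / 6 + q3"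
    by (rule exp_expansion4)
  have sq: "s = \<phi>\<^sup>2 + q1 + q2" using s q1(3) q2(3) by simp
  then have ps: "\<phi>\<^sup>2 \<le> s" using q1(1) q2(1) by simp
  then have s0: "0 \<le> s" using zero_le_power2[of \<phi>] by linarith
  have p1: "\<phi> \<le> 1" using ps s1 p power2_le_imp_le[of \<phi> 1] by simp
  have e1: "exp (1::real) \<le> 3" by (rule exp_le)
  have ee: "exp \<phi> \<le> 3" using p1 e1 by (meson exp_le_cancel_iff order_trans)
  have e2: "exp (2 * \<phi>) \<le> 9"
  proof -
    have "exp (2 * \<phi>) = (exp \<phi>)\<^sup>2" by (simp add: power2_eq_square flip: exp_add)
    also have "\<dots> \<le> 3\<^sup>2" using ee by (intro power_mono) auto
    finally show ?thesis by simp
  qed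
  have p4: "0 \<le> \<phi> ^ 4" by (simp add: zero_le_even_power)
  have "q1 \<le> 1/2 * \<phi> ^ 4"
    using q1(2) mult_right_mono[of "exp \<phi> / 24" "1/2" "\<phi> ^ 4"] ee p p4 by simp
  moreover have "q2 \<le> 1/2 * \<phi> ^ 4"
    using q2(2) mult_right_mono[of "exp \<phi> / 24" "1/2" "\<phi> ^ 4"] ee p p4 by simp
  ultimately have q12: "s - \<phi>\<^sup>2 \<le> \<phi> ^ 4" using sq by simp
  have "(- 2 * \<phi>) ^ 4 = 16 * \<phi> ^ 4" by (simp add: power_mult_distrib)
  then have q3b: "q3 \<le> 6 * \<phi> ^ 4"
    using q3(2) mult_right_mono[of "exp (2 * \<phi>) / 24 * 16" "6" "\<phi> ^ 4"] e2 p p4 by (simp add: abs_mult)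
  have p4s: "\<phi> ^ 4 \<le> s\<^sup>2"
    using power_mono[OF ps, of 2] by (simp flip: power_mult)
  define w where "w = sqrt s"
  have w: "0 \<le> w" "w\<^sup>2 = s" "w \<le> 1" using s0 s1 by (auto simp: w_def)
  have pw: "\<phi> \<le> w" unfolding w_def using ps p by (simp add: real_le_rsqrt)
  have w3: "w ^ 3 - \<phi> ^ 3 \<le> 3 * s\<^sup>2"
  proof (cases "w = 0")
    case True
    then have "w ^ 3 = 0" by simp
    then show ?thesis using zero_le_power[OF p, of 3] zero_le_power2[of s] by linarith
  next
    case False
    \<comment> \<open>Dividing \<open>s - \<phi>^2 \<le> s^2\<close> by \<open>w = sqrt s\<close>
      gives \<open>w - \<phi> \<le> w^3\<close>, so the cubes differ by O(\<open>s^2\<close>)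
      only.\<close>
    have "(w - \<phi>) * w \<le> (w - \<phi>) * (w + \<phi>)" using pw p w by (intro mult_left_mono) auto
    also have "\<dots> = s - \<phi>\<^sup>2" using w(2) by (simp add: power2_eq_square algebra_simps)
    also have "\<dots> \<le> s\<^sup>2" using q12 p4s by simp
    also have "\<dots> = w ^ 3 * w" unfolding w(2)[symmetric] by (simp add: power2_eq_square power3_eq_cube)
    finally have "w - \<phi> \<le> w ^ 3" using False w by simp
    then have "(w - \<phi>) * (w\<^sup>2 + w * \<phi> + \<phi>\<^sup>2) \<le> w ^ 3 * (w\<^sup>2 + w * w + w\<^sup>2)"
      using pw p w by (intro mult_mono add_mono power_mono) auto
    also have "\<dots> = 3 * w * (w ^ 4)" by (simp add: power2_eq_square power3_eq_cube power4_eq_xxxx)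
    also have "\<dots> \<le> 3 * 1 * (w ^ 4)" using w by (intro mult_right_mono mult_left_mono) auto
    also have "w ^ 4 = s\<^sup>2" unfolding w(2)[symmetric] by simp
    also have "(w - \<phi>) * (w\<^sup>2 + w * \<phi> + \<phi>\<^sup>2) = w ^ 3 - \<phi> ^ 3" by (simp add: power2_eq_square power3_eq_cube algebra_simps)
    finally show ?thesis by simp
  qed
  have w3': "0 \<le> w ^ 3 - \<phi> ^ 3" using power_mono[OF pw p, of 3] by simp
  have "\<phi> + exp (- 2 * \<phi>) / 2 - 1 / 2 = \<phi>\<^sup>2 - 2/3 * \<phi> ^ 3 + q3 / 2"
    unfolding q3(3) by (simp add: power_mult_distrib field_simps)
  then have "\<phi> + exp (- 2 * \<phi>) / 2 - 1 / 2 - (s - 2/3 * w ^ 3) = - (s - \<phi>\<^sup>2) + 2/3 * (w ^ 3 - \<phi> ^ 3) + q3 / 2" by simp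
  moreover have "q3 / 2 \<le> 3 * s\<^sup>2" using q3b p4s by simp
  moreover have "s - \<phi>\<^sup>2 \<le> s\<^sup>2" using q12 p4s by simp
  moreover have "0 \<le> s - \<phi>\<^sup>2" using ps by simp
  moreover have "\<bar>e\<bar> \<le> 6 * t"
    if "e = - p + 2/3 * d + q / 2" "q / 2 \<le> 3 * t" "p \<le> t" "0 \<le> p" "d \<le> 3 * t" "0 \<le> d" "0 \<le> q" for e p d q t :: real
    using that by linarith
  ultimately show ?thesis using w3 w3' q3(1) unfolding w_def[symmetric] by blast
qed

text \<open>The normalising logarithm and \<open>L\<close> are both \<open>- ln s / 2\<close> up to
  bounded errors, hence interchangeable. For the centring, the roots at \<open>t = N\<close> are
  \<open>sqrt N * exp \<phi>\<close> and \<open>sqrt N * exp (- \<phi>)\<close> with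
  \<open>\<phi> = arcosh \<theta>\<close>, which reduces it to
  \<open>edge_expansion\<close>.\<close>

lemma ln_edge_terms:
  fixes N s :: real
  assumes N: "0 < N" and s: "0 < s" "s \<le> 1" and Ns: "25 \<le> N * s"
  defines "\<theta> \<equiv> (2 + s) / 2"
  defines "x \<equiv> 2 * \<theta> * sqrt N"
  shows "\<bar>ln ((\<theta> + sqrt (\<theta>\<^sup>2 - 1)) / (2 * sqrt (\<theta>\<^sup>2 - 1))) + ln s / 2\<bar> \<le> 2"
    "\<bar>ln (x / root_gap x (N - 1)) + ln s / 2\<bar> \<le> 2"
    "\<bar>N * ln (big_root x N) + (small_root x N)\<^sup>2 / 2 - N / 2 * ln N - N / 2 - (N * s - 2/3 * N * (sqrt s) ^ 3)\<bar> \<le> 6 * (N * s\<^sup>2)"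
    "x\<^sup>2 \<ge> 4 * (N - 1) + 100" "0 < x" "x / root_gap x (N - 1) ^ 3 \<le> 1 / (sqrt (N * s) ^ 3 / sqrt N)"
proof -
  have th: "\<theta>\<^sup>2 - 1 = s + s\<^sup>2 / 4" by (simp add: \<theta>_def power2_eq_square field_simps)
  have th1: "1 \<le> \<theta>" "\<theta> \<le> 3/2" using s by (auto simp: \<theta>_def)
  define q where "q = sqrt (\<theta>\<^sup>2 - 1)"
  have q2: "q\<^sup>2 = s + s\<^sup>2 / 4" unfolding q_def th using s by simp
  have q0: "0 < q" unfolding q_def th using s by (simp add: add_pos_pos)
  have sN: "0 < sqrt N" "(sqrt N)\<^sup>2 = N" using N by auto
  have x2: "x\<^sup>2 = N * (2 + s)\<^sup>2" unfolding x_def \<theta>_def power_mult_distrib using sN by (simp add: power_divide)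
  show x0: "0 < x" using th1 sN by (simp add: x_def)
  have x2': "x\<^sup>2 = 4 * N + 4 * (N * s) + N * s\<^sup>2" unfolding x2 by (simp add: power2_eq_square algebra_simps)
  have Ns2: "0 \<le> N * s\<^sup>2" using N by simp
  \<comment> \<open>The condition \<open>25 \<le> N * s\<close> supplies the margin
    \<open>100 = 4 * 25\<close>.\<close>
  show xe: "x\<^sup>2 \<ge> 4 * (N - 1) + 100" using x2' Ns Ns2 by simp
  have ln2: "0 \<le> ln (2::real)" "ln (2::real) \<le> 1" using ln_le_minus_one[of "2::real"] by auto
  have ln3: "ln (3::real) \<le> 2" using ln_le_minus_one[of "3::real"] by simp
  have lnq: "ln q = ln s / 2 + ln (1 + s / 4) / 2"
  proof -
    have "2 * ln q = ln (q\<^sup>2)" using q0 by (simp add: ln_realpow)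
    also have "q\<^sup>2 = s * (1 + s / 4)" unfolding q2 by (simp add: power2_eq_square algebra_simps)
    also have "ln (s * (1 + s / 4)) = ln s + ln (1 + s / 4)" using s by (intro ln_mult_pos) auto
    finally show ?thesis by simp
  qed
  have l4: "0 \<le> ln (1 + s / 4)" "ln (1 + s / 4) \<le> 1" using s ln_add_one_self_le_self[of "s / 4"] by auto
  have q32: "q \<le> 3/2"
  proof -
    have "s\<^sup>2 \<le> 1" using s by (simp add: power_le_one)
    then have "q\<^sup>2 \<le> (3/2)\<^sup>2" unfolding q2 using s by (simp add: power2_eq_square)
    then show ?thesis by (rule power2_le_imp_le) simp
  qed
  have lt: "0 \<le> ln (\<theta> + q)" "ln (\<theta> + q) \<le> 2"
  proof -
    show "0 \<le> ln (\<theta> + q)" using th1 q0 by simp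
    have "ln (\<theta> + q) \<le> ln 3" using th1 q0 q32 by (intro ln_mono) auto
    then show "ln (\<theta> + q) \<le> 2" using ln3 by simp
  qed
  have "ln ((\<theta> + q) / (2 * q)) = ln (\<theta> + q) - (ln 2 + ln q)"
    using th1 q0 by (simp add: ln_div ln_mult_pos)
  then show "\<bar>ln ((\<theta> + sqrt (\<theta>\<^sup>2 - 1)) / (2 * sqrt (\<theta>\<^sup>2 - 1))) + ln s / 2\<bar> \<le> 2"
    unfolding q_def[symmetric] using lnq l4 lt ln2 by linarith
  \<comment> \<open>The last gap of the recursion sits at \<open>N - 1\<close>, which adds 4 to its
    square, whereas the integral for the centring runs up to \<open>N\<close>.\<close>
  define g where "g = root_gap x (N - 1)"
  have g2: "g\<^sup>2 = 4 * (N * s) + N * s\<^sup>2 + 4" unfolding g_def root_gap_def using x2' Ns Ns2 by simp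
  have g0: "0 \<le> g" unfolding g_def root_gap_def using x2' Ns Ns2 by simp
  have gNs: "N * s \<le> g\<^sup>2" "0 < g\<^sup>2" using g2 Ns Ns2 by auto
  then have gp: "0 < g" using g0 by (cases "g = 0") auto
  have rat: "2 * ln (x / g) = ln (x\<^sup>2 / g\<^sup>2)"
    using x0 gp ln_realpow[of "x / g" 2] by (simp add: power_divide)
  have "ln (x\<^sup>2 / g\<^sup>2) = ln (x\<^sup>2) - ln (g\<^sup>2)" using x0 gNs(2) by (intro ln_divide_pos) auto
  moreover have "ln (x\<^sup>2) = ln N + 2 * ln (2 + s)"
    unfolding x2 using N s by (simp add: ln_mult_pos ln_realpow)
  moreover have "ln N + ln s + ln 4 \<le> ln (g\<^sup>2)"
  proof -
    have "ln N + ln s + ln 4 = ln (N * s * 4)" using N s by (simp add: ln_mult_pos)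
    also have "\<dots> \<le> ln (g\<^sup>2)" using g2 Ns Ns2 N s by (intro ln_mono) auto
    finally show ?thesis .
  qed
  moreover have "ln (g\<^sup>2) \<le> ln N + ln s + ln 9"
  proof -
    have "N * s\<^sup>2 \<le> N * s" using N s by (simp add: power2_eq_square)
    then have "g\<^sup>2 \<le> N * s * 9" using g2 Ns by simp
    then have "ln (g\<^sup>2) \<le> ln (N * s * 9)" using gNs by (intro ln_mono) auto
    also have "\<dots> = ln N + ln s + ln 9" using N s by (simp add: ln_mult_pos)
    finally show ?thesis .
  qed
  moreover have "ln 2 \<le> ln (2 + s)" "ln (2 + s) \<le> ln 3" using s by (auto intro!: ln_mono)
  moreover have "ln (4::real) = 2 * ln 2" "ln (9::real) = 2 * ln 3"
    using ln_realpow[of "2::real" 2] ln_realpow[of "3::real" 2] by auto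
  ultimately show "\<bar>ln (x / root_gap x (N - 1)) + ln s / 2\<bar> \<le> 2"
    unfolding g_def[symmetric] using rat ln3 ln2 by linarith
  define \<phi> where "\<phi> = ln (\<theta> + q)"
  have e1: "exp \<phi> = \<theta> + q" unfolding \<phi>_def using th1 q0 by simp
  have "(\<theta> + q) * (\<theta> - q) = \<theta>\<^sup>2 - q\<^sup>2" by (simp add: power2_eq_square algebra_simps)
  also have "\<dots> = 1" unfolding q2 using th by simp
  finally have "(\<theta> + q) * (\<theta> - q) = 1" .
  then have e2: "exp (- \<phi>) = \<theta> - q" unfolding exp_minus e1 using th1 q0 by (simp add: inverse_eq_divide divide_eq_eq mult.commute)
  have gap: "root_gap x N = 2 * q * sqrt N"
  proof -
    have "x\<^sup>2 - 4 * N = 4 * N * (\<theta>\<^sup>2 - 1)" unfolding x2' th by (simp add: algebra_simps)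
    then show ?thesis unfolding root_gap_def q_def by (simp add: real_sqrt_mult)
  qed
  have br: "big_root x N = exp \<phi> * sqrt N" unfolding big_root_def gap e1 unfolding x_def by (simp add: field_simps)
  have sr: "small_root x N = exp (- \<phi>) * sqrt N" unfolding small_root_def gap e2 unfolding x_def by (simp add: field_simps)
  have "ln (big_root x N) = \<phi> + ln N / 2" unfolding br using N by (simp add: ln_mult_pos ln_sqrt)
  moreover have "(small_root x N)\<^sup>2 = N * exp (- 2 * \<phi>)"
  proof -
    have "(exp (- \<phi>))\<^sup>2 = exp (- 2 * \<phi>)" by (simp add: power2_eq_square flip: exp_add)
    then show ?thesis unfolding sr power_mult_distrib using N by (simp add: mult.commute)
  qed
  ultimately have "N * ln (big_root x N) + (small_root x N)\<^sup>2 / 2 - N / 2 * ln N - N / 2 - (N * s - 2/3 * N * (sqrt s) ^ 3)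
     = N * (\<phi> + exp (- 2 * \<phi>) / 2 - 1 / 2 - (s - 2/3 * (sqrt s) ^ 3))" by (simp add: algebra_simps)
  also have "\<bar>\<dots>\<bar> \<le> N * (6 * s\<^sup>2)"
  proof -
    have "exp \<phi> + exp (- \<phi>) = 2 + s" unfolding e1 e2 by (simp add: \<theta>_def)
    from edge_expansion[OF _ this s(2)] lt(1)
    show ?thesis unfolding abs_mult using N by (auto simp: \<phi>_def intro!: mult_left_mono)
  qed
  finally show "\<bar>N * ln (big_root x N) + (small_root x N)\<^sup>2 / 2 - N / 2 * ln N - N / 2 - (N * s - 2/3 * N * (sqrt s) ^ 3)\<bar> \<le> 6 * (N * s\<^sup>2)"
    by simp
  have Ns0: "0 < N * s" using N s by simp
  have g2s: "2 * sqrt (N * s) \<le> g"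
  proof -
    have "(2 * sqrt (N * s))\<^sup>2 \<le> g\<^sup>2" using g2 Ns Ns2 by (simp add: power_mult_distrib)
    then show ?thesis using g0 by (rule power2_le_imp_le)
  qed
  have "x / g ^ 3 \<le> (8 * sqrt N) / (2 * sqrt (N * s)) ^ 3"
  proof (rule frac_le)
    show "x \<le> 8 * sqrt N" unfolding x_def using th1 sN by (intro mult_right_mono) auto
    show "(2 * sqrt (N * s)) ^ 3 \<le> g ^ 3" using g2s Ns0 by (intro power_mono) auto
  qed (use sN Ns0 in auto)
  also have "\<dots> = 1 / (sqrt (N * s) ^ 3 / sqrt N)" unfolding power_mult_distrib by simp
  finally show "x / root_gap x (N - 1) ^ 3 \<le> 1 / (sqrt (N * s) ^ 3 / sqrt N)" by (simp add: g_def)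
qed

section \<open>The limit theorem\<close>

lemma sum_Plus_image:
  "(\<Sum>i\<in>(\<lambda>k. Suc (Suc k)) ` {..<n} <+> Suc ` {..<n}. h i) = (\<Sum>k<n. h (Inl (Suc (Suc k))) + h (Inr (Suc k)))"
  for h :: "nat + nat \<Rightarrow> real"
  by (simp add: sum.Plus sum.reindex inj_on_def sum.distrib)

text \<open>The lower hypothesis sends \<open>\<sigma>\<close> to infinity. The upper one gives
  \<open>\<sigma> \<le> (ln N)^2\<close> eventually, hence
  \<open>ln \<sigma> \<le> 2 ln (ln N)\<close> and
  \<open>N s^2 = N^(-1/3) \<sigma>^2 \<le> 1\<close>.\<close>

lemma sigma_asymptotics:
  fixes \<sigma> :: "nat \<Rightarrow> real"
  assumes pos: "\<And>N. \<sigma> N > 0"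
    and lo: "((\<lambda>N. (ln (ln (real N)))\<^sup>2 / \<sigma> N) \<longlongrightarrow> 0) sequentially"
    and hi: "((\<lambda>N. \<sigma> N / (ln (real N))\<^sup>2) \<longlongrightarrow> 0) sequentially"
  defines "s \<equiv> \<lambda>N. real N powr (-2/3) * \<sigma> N"
  shows "filterlim \<sigma> at_top sequentially"
    "\<forall>\<^sub>F N in sequentially. 3 \<le> N \<and> 1 \<le> \<sigma> N \<and> ln (\<sigma> N) \<le> 2 * ln (ln (real N)) \<and> 0 < s N \<and> s N \<le> 1
       \<and> 25 \<le> real N * s N \<and> real N * (s N)\<^sup>2 \<le> 1"
proof -
  have "\<forall>\<^sub>F N in sequentially. (ln (ln (real N)))\<^sup>2 / \<sigma> N < 1" by (rule order_tendstoD(2)[OF lo]) simp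
  then have lo': "\<forall>\<^sub>F N in sequentially. (ln (ln (real N)))\<^sup>2 \<le> \<sigma> N"
    by eventually_elim (use pos in \<open>simp add: divide_less_eq\<close>)
  have "filterlim (\<lambda>N. (ln (ln (real N)))\<^sup>2) at_top sequentially" by real_asymp
  from filterlim_at_top_mono[OF this lo'] show top: "filterlim \<sigma> at_top sequentially" .
  have hi1: "\<forall>\<^sub>F N in sequentially. \<sigma> N / (ln (real N))\<^sup>2 < 1" by (rule order_tendstoD(2)[OF hi]) simp
  have e1: "\<forall>\<^sub>F N in sequentially. real N powr (-2/3) * (ln (real N))\<^sup>2 \<le> 1" by real_asymp
  have e2: "\<forall>\<^sub>F N in sequentially. 25 \<le> real N powr (1/3)" by real_asymp
  have e3: "\<forall>\<^sub>F N in sequentially. real N powr (-1/3) * (ln (real N)) ^ 4 \<le> 1" by real_asymp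
  have s1: "\<forall>\<^sub>F N in sequentially. 1 \<le> \<sigma> N" using top by (simp add: filterlim_at_top)
  show "\<forall>\<^sub>F N in sequentially. 3 \<le> N \<and> 1 \<le> \<sigma> N \<and> ln (\<sigma> N) \<le> 2 * ln (ln (real N)) \<and> 0 < s N \<and> s N \<le> 1
       \<and> 25 \<le> real N * s N \<and> real N * (s N)\<^sup>2 \<le> 1"
    using hi1 e1 e2 e3 s1 eventually_ge_at_top[of 3]
  proof eventually_elim
    case (elim N)
    have N: "0 < real N" "1 < real N" using elim by auto
    have l: "0 < ln (real N)" using N by simp
    have sl: "\<sigma> N \<le> (ln (real N))\<^sup>2" using elim(1) l by (simp add: divide_less_eq split: if_splits)
    have "ln (\<sigma> N) \<le> ln ((ln (real N))\<^sup>2)" using sl pos[of N] by (intro ln_mono) auto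
    also have "\<dots> = 2 * ln (ln (real N))" using l by (simp add: ln_realpow)
    finally have a: "ln (\<sigma> N) \<le> 2 * ln (ln (real N))" .
    have b: "0 < s N" using pos[of N] N by (simp add: s_def)
    have "s N \<le> real N powr (-2/3) * (ln (real N))\<^sup>2" unfolding s_def using sl by (intro mult_left_mono) auto
    then have c: "s N \<le> 1" using elim(2) by simp
    have Ns: "real N * s N = real N powr (1/3) * \<sigma> N"
    proof -
      have "real N * real N powr (-2/3) = real N powr (1 + -2/3)" using N by (subst powr_add) simp
      then show ?thesis by (simp add: s_def mult.assoc[symmetric])
    qed
    have "25 * 1 \<le> real N powr (1/3) * \<sigma> N" using elim(3,5) by (intro mult_mono) auto
    then have d: "25 \<le> real N * s N" using Ns by simp
    have "real N * (s N)\<^sup>2 = real N powr (-1/3) * (\<sigma> N)\<^sup>2"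
    proof -
      have "real N powr (1/3) * real N powr (-2/3) = real N powr (-1/3)" using N by (simp flip: powr_add)
      moreover have "real N * (s N)\<^sup>2 = (real N powr (1/3) * \<sigma> N) * (real N powr (-2/3) * \<sigma> N)"
        unfolding power2_eq_square mult.assoc[symmetric] Ns by (simp only: s_def mult.assoc)
      ultimately show ?thesis by (simp add: power2_eq_square mult_ac)
    qed
    also have "\<dots> \<le> real N powr (-1/3) * ((ln (real N))\<^sup>2)\<^sup>2"
      using sl pos[of N] by (intro mult_left_mono power_mono) auto
    also have "\<dots> \<le> 1" using elim(4) by simp
    finally show ?case using elim a b c d by simp
  qed
qed

lemma rescaled_powers:
  fixes N \<sigma> :: real
  assumes N: "0 < N" and sg: "0 < \<sigma>"
  defines "s \<equiv> N powr (-2/3) * \<sigma>"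
  shows "N * s = \<sigma> * N powr (1/3)" "N * (sqrt s) ^ 3 = \<sigma> powr (3/2)" "sqrt (N * s) ^ 3 / sqrt N = \<sigma> powr (3/2)"
    "ln s = - 2/3 * ln N + ln \<sigma>"
proof -
  have c: "(sqrt y) ^ 3 = y powr (3/2)" if "0 < y" for y :: real
  proof -
    have "(sqrt y) ^ 3 = (y powr (1/2)) powr 3" using that by (simp add: powr_half_sqrt)
    also have "\<dots> = y powr (3/2)" by (simp add: powr_powr)
    finally show ?thesis .
  qed
  have "N * N powr (-2/3) = N powr (1 + -2/3)" using N by (subst powr_add) simp
  then show Ns: "N * s = \<sigma> * N powr (1/3)" by (simp add: s_def mult.assoc[symmetric])
  have s0: "0 < s" using N sg by (simp add: s_def)
  have "N * s powr (3/2) = N * (N powr (-2/3)) powr (3/2) * \<sigma> powr (3/2)"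
    unfolding s_def using N sg by (simp add: powr_mult)
  also have "(N powr (-2/3)) powr (3/2) = N powr (-1)" by (simp add: powr_powr)
  also have "N powr (-1) = inverse N" using N by (simp add: powr_minus)
  finally show "N * (sqrt s) ^ 3 = \<sigma> powr (3/2)" unfolding c[OF s0] using N by simp
  have "sqrt (N * s) ^ 3 = (\<sigma> * N powr (1/3)) powr (3/2)" using c[OF mult_pos_pos[OF N s0]] unfolding Ns .
  also have "\<dots> = \<sigma> powr (3/2) * (N powr (1/3)) powr (3/2)" using N sg by (simp add: powr_mult)
  also have "(N powr (1/3)) powr (3/2) = sqrt N" using N by (simp add: powr_powr powr_half_sqrt)
  finally show "sqrt (N * s) ^ 3 / sqrt N = \<sigma> powr (3/2)" using N by simp
  show "ln s = - 2/3 * ln N + ln \<sigma>" unfolding s_def using N sg by (simp add: ln_mult_pos ln_powr)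
qed

theorem theorem2:
  fixes M :: "'w measure" and \<alpha> :: real
    and a b :: "nat \<Rightarrow> 'w \<Rightarrow> real" and \<sigma> :: "nat \<Rightarrow> real"
  assumes "prob_space M"
    and "\<alpha> > 0"
    and "prob_space.indep_vars M (\<lambda>_. borel)
           (\<lambda>k. case k of Inl i \<Rightarrow> a i | Inr i \<Rightarrow> b i)
           (Inl ` {1..} \<union> Inr ` {1..})"
    and "\<And>i. i \<ge> 1 \<Longrightarrow> distributed M lborel (a i) (normal_density 0 (sqrt \<alpha>))"
    and "\<And>i \<omega>. i \<ge> 1 \<Longrightarrow> \<omega> \<in> space M \<Longrightarrow> b i \<omega> \<ge> 0"
    and "\<And>i. i \<ge> 1 \<Longrightarrow> distributed M lborel (\<lambda>\<omega>. (2 / \<alpha>) * (b i \<omega>)\<^sup>2)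
                                (chi2_density (2 * real i / \<alpha>))"
    and "\<And>N. \<sigma> N > 0"
    and "((\<lambda>N. (ln (ln (real N)))\<^sup>2 / \<sigma> N) \<longlongrightarrow> 0) sequentially"
    and "((\<lambda>N. \<sigma> N / (ln (real N))\<^sup>2) \<longlongrightarrow> 0) sequentially"
  shows "let \<theta> = (\<lambda>N. (2 + real N powr (-2/3) * \<sigma> N) / 2);
             D = (\<lambda>N \<omega>. det (smult_mat (1 / sqrt (real N)) (tridiag N (\<lambda>i. a i \<omega>) (\<lambda>i. b i \<omega>))
                               - smult_mat (2 * \<theta> N) (1\<^sub>m N)))
         in weak_conv_m
              (\<lambda>N. distr M borel (\<lambda>\<omega>.
                 (ln \<bar>D N \<omega>\<bar> - real N / 2 + (\<alpha> - 1) / 6 * ln (real N)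
                    - \<sigma> N * real N powr (1/3) + 2/3 * \<sigma> N powr (3/2))
                 / sqrt (\<alpha> * ln ((\<theta> N + sqrt ((\<theta> N)\<^sup>2 - 1)) / (2 * sqrt ((\<theta> N)\<^sup>2 - 1))))))
              std_normal_distribution"
proof -
  note alpha = assms(2)
  interpret prob_space M by (rule assms(1))
  define A where "A k = a (Suc k)" for k
  define B where "B k \<omega> = (if k = 0 then 0 else (b k \<omega>)\<^sup>2 - real k)" for k \<omega>
  obtain Fm where noise: "noise M \<alpha> Fm A B"
    using noise_tridiagonal[OF assms(2,3,4,6)] unfolding A_def[abs_def] B_def[abs_def] by blast
  interpret noise M \<alpha> Fm A B by (rule noise)
  define s where "s N = real N powr (-2/3) * \<sigma> N" for N
  define \<theta> where "\<theta> N = (2 + s N) / 2" for N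
  define x where "x N = 2 * \<theta> N * sqrt (real N)" for N
  define W where "W N = ln ((\<theta> N + sqrt ((\<theta> N)\<^sup>2 - 1)) / (2 * sqrt ((\<theta> N)\<^sup>2 - 1)))" for N
  define den where "den N = sqrt (\<alpha> * W N)" for N
  define Dt where "Dt N \<omega> = det (smult_mat (1 / sqrt (real N)) (tridiag N (\<lambda>i. a i \<omega>) (\<lambda>i. b i \<omega>))
                               - smult_mat (2 * \<theta> N) (1\<^sub>m N))" for N \<omega>
  define Q where "Q N \<omega> = (ln \<bar>Dt N \<omega>\<bar> - real N / 2 + (\<alpha> - 1) / 6 * ln (real N)
                    - \<sigma> N * real N powr (1/3) + 2/3 * \<sigma> N powr (3/2)) / den N" for N \<omega>
  define gap where "gap N k = root_gap (x N) (real k)" for N k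
  \<comment> \<open>The linear part of the fluctuation, \<open>- \<Sum> \<zeta>\<close> over the
    normalisation, written without the locale so that it makes sense for every
    \<open>N\<close>.\<close>
  define T where "T N \<omega> = - (\<Sum>k<N - 1. (A (Suc k) \<omega> + B (Suc k) \<omega> / big_root (x N) (real (Suc k))) / gap N (Suc k)) / den N" for N \<omega>
  define Lg where "Lg N = edge.L (x N) (N - 1)" for N
  \<comment> \<open>The deterministic discrepancy between \<open>main\<close> and the centring of
    the theorem. The summand \<open>N / 2 * ln N\<close> is the logarithm of the scaling factor
    \<open>sqrt N ^ N\<close> of the determinant.\<close>
  define E where "E N = edge_noise.main \<alpha> (x N) (N - 1) - real N / 2 * ln (real N) - real N / 2 + (\<alpha> - 1) / 6 * ln (real N)
                    - \<sigma> N * real N powr (1/3) + 2/3 * \<sigma> N powr (3/2)" for N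

  define good where "good N \<longleftrightarrow> 3 \<le> N \<and> 1 \<le> \<sigma> N \<and> ln (\<sigma> N) \<le> 2 * ln (ln (real N)) \<and> 0 < s N \<and> s N \<le> 1
       \<and> 25 \<le> real N * s N \<and> real N * (s N)\<^sup>2 \<le> 1" for N
  have ev_good: "\<forall>\<^sub>F N in sequentially. good N"
    using sigma_asymptotics(2)[OF assms(7,8,9)] by (simp add: good_def[abs_def] s_def[abs_def])
  have sigma_top: "filterlim \<sigma> at_top sequentially" by (rule sigma_asymptotics(1)[OF assms(7,8,9)])

  have edge: "edge (x N) (N - 1)" if "good N" for N
  proof -
    have N: "0 < real N" "real (N - 1) = real N - 1" using that by (auto simp: good_def)
    show ?thesis
      using ln_edge_terms(4,5)[of "real N" "s N"] that N
      by (intro edge.intro) (auto simp: good_def x_def \<theta>_def N(2))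
  qed
  have en: "edge_noise M \<alpha> Fm A B (x N) (N - 1)" if "good N" for N
    using noise edge[OF that] by (simp add: edge_noise_def)

  have terms: "\<bar>W N - ln (real N) / 3\<bar> \<le> 2 + ln (ln (real N))" "\<bar>Lg N - W N\<bar> \<le> 4"
      "\<bar>E N\<bar> \<le> 8 + \<bar>1 - \<alpha>\<bar> / 2 * (6 + ln (ln (real N)))"
      "x N / gap N (N - 1) ^ 3 \<le> 1 / \<sigma> N powr (3/2)"
    if g: "good N" for N
  proof -
    have N: "0 < real N" "real (N - 1) = real N - 1" "real (N - 1) + 1 = real N" "1 \<le> N" using g by (auto simp: good_def)
    have sg: "0 < \<sigma> N" "1 \<le> \<sigma> N" "ln (\<sigma> N) \<le> 2 * ln (ln (real N))" using g by (auto simp: good_def)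
    have cs: "0 < s N" "s N \<le> 1" "25 \<le> real N * s N" "real N * (s N)\<^sup>2 \<le> 1" using g by (auto simp: good_def)
    note t = ln_edge_terms[OF N(1) cs(1-3), folded \<theta>_def, folded x_def, folded W_def N(2)]
    note rp = rescaled_powers[OF N(1) sg(1), folded s_def]
    have ls: "0 \<le> ln (\<sigma> N)" using sg by simp
    have w: "\<bar>W N - ln (real N) / 3\<bar> \<le> 2 + ln (ln (real N))" using t(1) rp(4) sg(3) ls by linarith
    then show "\<bar>W N - ln (real N) / 3\<bar> \<le> 2 + ln (ln (real N))" .
    have Le: "Lg N = ln (x N / gap N (N - 1))" unfolding Lg_def gap_def by (rule edge.L_def[OF edge[OF g]])
    then have L: "\<bar>Lg N + ln (s N) / 2\<bar> \<le> 2" using t(2) by (simp add: gap_def)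
    then show LW: "\<bar>Lg N - W N\<bar> \<le> 4" using t(1) by linarith
    show "x N / gap N (N - 1) ^ 3 \<le> 1 / \<sigma> N powr (3/2)" using t(6) unfolding rp(3) gap_def .
    define F where "F = real N * ln (big_root (x N) (real N)) + (small_root (x N) (real N))\<^sup>2 / 2"
    define m where "m = (\<Sum>k<N - 1. ln (big_root (x N) (real (Suc k)))) + ln (x N)"
    have m: "edge_noise.main \<alpha> (x N) (N - 1) = m + (1 - \<alpha>) / 2 * Lg N"
      unfolding m_def Lg_def by (rule edge_noise.main_def[OF en[OF g]])
    have mF: "F \<le> m" "m \<le> F + ln 2"
      using edge.sum_ln_big_root[OF edge[OF g]] edge.x_pos[OF edge[OF g]] unfolding N(3) F_def m_def by (auto simp: ln_div)
    have ln2: "ln (2::real) \<le> 1" using ln_le_minus_one[of "2::real"] by simp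
    have F: "\<bar>F - real N / 2 * ln (real N) - real N / 2 - (\<sigma> N * real N powr (1/3) - 2/3 * \<sigma> N powr (3/2))\<bar> \<le> 6"
      using t(3) cs(4) unfolding F_def[symmetric] rp(1) mult.assoc[of "2/3" "real N"] rp(2) by linarith
    have p: "\<bar>(1 - \<alpha>) / 2 * (Lg N - ln (real N) / 3)\<bar> \<le> \<bar>1 - \<alpha>\<bar> / 2 * (6 + ln (ln (real N)))"
    proof -
      have "\<bar>Lg N - ln (real N) / 3\<bar> \<le> 6 + ln (ln (real N))" using w LW by linarith
      then have "\<bar>(1 - \<alpha>) / 2\<bar> * \<bar>Lg N - ln (real N) / 3\<bar> \<le> \<bar>(1 - \<alpha>) / 2\<bar> * (6 + ln (ln (real N)))"
        by (rule mult_left_mono) simp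
      then show ?thesis by (simp add: abs_mult)
    qed
    have "E N = (m - F) + (F - real N / 2 * ln (real N) - real N / 2 - (\<sigma> N * real N powr (1/3) - 2/3 * \<sigma> N powr (3/2)))
        + (1 - \<alpha>) / 2 * (Lg N - ln (real N) / 3)"
      unfolding E_def m by (simp add: field_simps)
    then show "\<bar>E N\<bar> \<le> 8 + \<bar>1 - \<alpha>\<bar> / 2 * (6 + ln (ln (real N)))" using mF ln2 F p by linarith
  qed

  \<comment> \<open>\<open>W\<close> is \<open>ln N / 3\<close> up to O(\<open>ln (ln N)\<close>);
    half of that is enough as a lower bound.\<close>
  have W_ge: "\<forall>\<^sub>F N in sequentially. ln (real N) / 6 \<le> W N"
  proof -
    have "\<forall>\<^sub>F N in sequentially. 2 + ln (ln (real N)) \<le> ln (real N) / 6" by real_asymp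
    with ev_good show ?thesis by eventually_elim (use terms(1) in fastforce)
  qed
  have ln6: "filterlim (\<lambda>N. ln (real N) / 6) at_top sequentially" by real_asymp
  have W_top: "filterlim W at_top sequentially" by (rule filterlim_at_top_mono[OF ln6 W_ge])
  have den_top: "filterlim den at_top sequentially" unfolding den_def[abs_def]
    using W_top alpha by (intro filterlim_compose[OF sqrt_at_top] filterlim_tendsto_pos_mult_at_top[OF tendsto_const])
  \<comment> \<open>\<open>E\<close> is O(\<open>ln (ln N)\<close>), because the logarithmic
    correction replaces \<open>L\<close> by \<open>ln N / 3\<close>, and this is negligible against
    \<open>sqrt (ln N)\<close>.\<close>
  have E_lim: "(\<lambda>N. E N / den N) \<longlonglongrightarrow> 0"
  proof (rule Lim_null_comparison)
    define h where "h = \<bar>1 - \<alpha>\<bar> / 2"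
    show "\<forall>\<^sub>F N in sequentially. norm (E N / den N) \<le> (8 + h * (6 + ln (ln (real N)))) / sqrt (ln (real N)) * sqrt (6 / \<alpha>)"
      using ev_good W_ge
    proof eventually_elim
      case (elim N)
      have l: "0 < ln (real N)" using elim by (simp add: good_def)
      have d: "sqrt (\<alpha> * (ln (real N) / 6)) \<le> den N" unfolding den_def using elim alpha by (intro real_sqrt_le_mono mult_left_mono) auto
      have d0: "0 < sqrt (\<alpha> * (ln (real N) / 6))" using l alpha by simp
      have "norm (E N / den N) = \<bar>E N\<bar> / den N" using less_le_trans[OF d0 d] by (simp add: abs_divide)
      also have "\<dots> \<le> (8 + h * (6 + ln (ln (real N)))) / sqrt (\<alpha> * (ln (real N) / 6))"
        using terms(3)[OF elim(1), folded h_def] d d0 by (intro frac_le) auto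
      also have "\<dots> = (8 + h * (6 + ln (ln (real N)))) / sqrt (ln (real N)) * sqrt (6 / \<alpha>)"
        by (simp add: real_sqrt_mult real_sqrt_divide)
      finally show ?case .
    qed
    have l1: "(\<lambda>N. 1 / sqrt (ln (real N))) \<longlonglongrightarrow> 0" by real_asymp
    have l2: "(\<lambda>N. (6 + ln (ln (real N))) / sqrt (ln (real N))) \<longlonglongrightarrow> 0" by real_asymp
    have "(\<lambda>N. (8 * (1 / sqrt (ln (real N))) + h * ((6 + ln (ln (real N))) / sqrt (ln (real N)))) * sqrt (6 / \<alpha>)) \<longlonglongrightarrow> (8 * 0 + h * 0) * sqrt (6 / \<alpha>)"
      by (intro tendsto_intros l1 l2)
    then show "(\<lambda>N. (8 + h * (6 + ln (ln (real N)))) / sqrt (ln (real N)) * sqrt (6 / \<alpha>)) \<longlonglongrightarrow> 0"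
      by (simp add: add_divide_distrib distrib_left)
  qed
  have am [measurable]: "i \<ge> 1 \<Longrightarrow> a i \<in> borel_measurable M" for i
    using assms(4)[of i] by (auto simp: distributed_def)
  have bm [measurable]: "i \<ge> 1 \<Longrightarrow> b i \<in> borel_measurable M" for i
    using assms(3) unfolding indep_vars_def2 by (auto dest!: bspec[of _ _ "Inr i"])
  have Dt: "Dt N \<omega> = det (tridiag N (\<lambda>i. a i \<omega> - x N) (\<lambda>i. b i \<omega>)) / sqrt (real N) ^ N" for N \<omega>
    unfolding Dt_def x_def by (rule det_scaled_tridiag)
  have Dtm [measurable]: "Dt N \<in> borel_measurable M" for N
    unfolding Dt[abs_def] by measurable
  have Qm: "Q N \<in> borel_measurable M" for N unfolding Q_def[abs_def] by measurable
  have Tm: "T N \<in> borel_measurable M" for N unfolding T_def[abs_def] by measurable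

  define J where "J = (Inl ` {1..} \<union> Inr ` {1..} :: (nat + nat) set)"
  define Z where "Z k \<omega> = (case k of Inl i \<Rightarrow> a i \<omega> | Inr i \<Rightarrow> (b i \<omega>)\<^sup>2 - real i)" for k :: "nat + nat" and \<omega>
  \<comment> \<open>Entry \<open>a i\<close> is the noise of step \<open>i - 1\<close> and
    \<open>b i\<close> that of step \<open>i\<close>, hence the different gap indices.\<close>
  define c where "c N k = (case k of Inl i \<Rightarrow> - (1 / (gap N (i - 1) * den N)) | Inr i \<Rightarrow> - (1 / (big_root (x N) (real i) * gap N i * den N)))" for N :: nat and k :: "nat + nat"
  \<comment> \<open>The entry \<open>a 1\<close> is absent: it enters only the initial value
    \<open>Y 0\<close>.\<close>
  define S where "S N = (\<lambda>k. Suc (Suc k)) ` {..<N - 1} <+> Suc ` {..<N - 1}" for N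
  have Z_simps: "Z (Inl (Suc k)) = A k" "Z (Inr (Suc k)) = B (Suc k)" for k
    by (auto simp: Z_def A_def B_def fun_eq_iff)
  have T_sum: "T N \<omega> = (\<Sum>k\<in>S N. c N k * Z k \<omega>)" for N \<omega>
  proof -
    have "T N \<omega> = (\<Sum>k<N - 1. - ((A (Suc k) \<omega> + B (Suc k) \<omega> / big_root (x N) (real (Suc k))) / gap N (Suc k)) / den N)"
      unfolding T_def sum_negf[symmetric] sum_divide_distrib ..
    also have "\<dots> = (\<Sum>k\<in>S N. c N k * Z k \<omega>)"
      unfolding S_def sum_Plus_image Z_simps
      by (rule sum.cong) (simp_all add: c_def add_divide_distrib diff_divide_distrib)
    finally show ?thesis .
  qed
  have "weak_conv_m (\<lambda>N. distr M borel (\<lambda>\<omega>. \<Sum>k\<in>S N. c N k * Z k \<omega>)) std_normal_distribution"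
  proof (rule lyapunov_clt)
    let ?f = "\<lambda>k y :: real. case k of Inl i \<Rightarrow> y | Inr i \<Rightarrow> y\<^sup>2 - real i"
    have "indep_vars (\<lambda>_. borel) (\<lambda>k \<omega>. ?f k ((case k of Inl i \<Rightarrow> a i | Inr i \<Rightarrow> b i) \<omega>)) J"
    proof (rule indep_vars_compose2[where Y = ?f and N = "\<lambda>_. borel", OF assms(3)[folded J_def]])
      show "?f k \<in> measurable borel borel" for k by (cases k) simp_all
    qed
    also have "(\<lambda>k \<omega>. ?f k ((case k of Inl i \<Rightarrow> a i | Inr i \<Rightarrow> b i) \<omega>)) = Z"
      by (auto simp: Z_def fun_eq_iff split: sum.split)
    finally show "indep_vars (\<lambda>_. borel) Z J" .
    show "S N \<subseteq> J" "finite (S N)" for N by (auto simp: S_def J_def)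
    show "integrable M (\<lambda>\<omega>. Z i \<omega> ^ 4)" "expectation (Z i) = 0" if "i \<in> J" for i
    proof -
      from that consider k where "i = Inl (Suc k)" | k where "i = Inr (Suc k)"
        unfolding J_def by (auto simp: Suc_le_eq dest!: gr0_implies_Suc)
      then show "integrable M (\<lambda>\<omega>. Z i \<omega> ^ 4)" "expectation (Z i) = 0"
        by (cases; simp add: Z_simps A_int B_int A_moments B_moments)+
    qed
    have var: "(\<Sum>k\<in>S N. (c N k)\<^sup>2 * expectation (\<lambda>\<omega>. (Z k \<omega>)\<^sup>2)) = (\<Sum>k<N - 1. (1 + edge.\<tau> (x N) (Suc k)) / (gap N (Suc k))\<^sup>2) / W N"
      if g: "good N" and W0: "0 < W N" for N
    proof -
      interpret en: edge_noise M \<alpha> Fm A B "x N" "N - 1" by (rule en[OF g])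
      have d2: "(den N)\<^sup>2 = \<alpha> * W N" unfolding den_def using alpha W0 by simp
      have "(c N (Inl (Suc (Suc k))))\<^sup>2 * expectation (\<lambda>\<omega>. (Z (Inl (Suc (Suc k))) \<omega>)\<^sup>2) + (c N (Inr (Suc k)))\<^sup>2 * expectation (\<lambda>\<omega>. (Z (Inr (Suc k)) \<omega>)\<^sup>2)
          = (1 + en.\<tau> (Suc k)) / (gap N (Suc k))\<^sup>2 / W N" if "k < N - 1" for k
        unfolding Z_simps A_moments B_moments en.index_le_rho_sq[OF Suc_leI[OF that], symmetric]
        using alpha by (simp add: c_def power_divide power_mult_distrib d2 add_divide_distrib)
      then show ?thesis unfolding S_def sum_Plus_image by (simp add: sum_divide_distrib)
    qed
    show "(\<lambda>N. \<Sum>k\<in>S N. (c N k)\<^sup>2 * expectation (\<lambda>\<omega>. (Z k \<omega>)\<^sup>2)) \<longlonglongrightarrow> 1"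
    proof (rule Lim_transform)
      show "(\<lambda>N. 1 :: real) \<longlonglongrightarrow> 1" by simp
      show "(\<lambda>N. (\<Sum>k\<in>S N. (c N k)\<^sup>2 * expectation (\<lambda>\<omega>. (Z k \<omega>)\<^sup>2)) - 1) \<longlonglongrightarrow> 0"
      proof (rule Lim_null_comparison)
        \<comment> \<open>The 8 adds the error 4 between the variance sum and \<open>Lg\<close> to
          the error 4 between \<open>Lg\<close> and \<open>W\<close>.\<close>
        show "\<forall>\<^sub>F N in sequentially. norm ((\<Sum>k\<in>S N. (c N k)\<^sup>2 * expectation (\<lambda>\<omega>. (Z k \<omega>)\<^sup>2)) - 1) \<le> 8 / W N"
          using ev_good filterlim_at_top_dense[THEN iffD1, OF W_top, rule_format, of 0]
        proof eventually_elim
          case (elim N)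
          let ?v = "\<Sum>k<N - 1. (1 + edge.\<tau> (x N) (Suc k)) / (gap N (Suc k))\<^sup>2"
          have "\<bar>?v - Lg N\<bar> \<le> 4" unfolding gap_def Lg_def by (rule edge.sum_variance[OF edge[OF elim(1)]])
          then have v: "\<bar>?v - W N\<bar> \<le> 8" using terms(2)[OF elim(1)] by linarith
          have "?v / W N - 1 = (?v - W N) / W N" using elim by (simp add: diff_divide_distrib)
          then show ?case unfolding var[OF elim] using v elim by (simp add: abs_divide divide_right_mono)
        qed
        show "(\<lambda>N. 8 / W N) \<longlonglongrightarrow> 0" by (intro tendsto_divide_0[OF tendsto_const] filterlim_at_top_imp_at_infinity W_top)
      qed
    qed
    define K where "K = 6 * \<alpha>\<^sup>2 + 6 * \<alpha> ^ 3"
    have K0: "0 \<le> K" unfolding K_def using alpha by simp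
    show "(\<lambda>N. \<Sum>k\<in>S N. (c N k) ^ 4 * expectation (\<lambda>\<omega>. Z k \<omega> ^ 4)) \<longlonglongrightarrow> 0"
    proof (rule Lim_null_comparison)
      \<comment> \<open>The sum of \<open>1 / gap^4\<close> stays bounded while the variance
        diverges logarithmically, so the Lyapunov ratio is O(\<open>1 / den^4\<close>).\<close>
      show "\<forall>\<^sub>F N in sequentially. norm (\<Sum>k\<in>S N. (c N k) ^ 4 * expectation (\<lambda>\<omega>. Z k \<omega> ^ 4)) \<le> K / den N ^ 4"
        using ev_good
      proof eventually_elim
        case (elim N)
        interpret en: edge_noise M \<alpha> Fm A B "x N" "N - 1" by (rule en[OF elim])
        have nn: "0 \<le> (\<Sum>k\<in>S N. (c N k) ^ 4 * expectation (\<lambda>\<omega>. Z k \<omega> ^ 4))"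
          by (intro sum_nonneg mult_nonneg_nonneg integral_nonneg_AE) (auto simp: zero_le_even_power)
        have "(c N (Inl (Suc (Suc k)))) ^ 4 * expectation (\<lambda>\<omega>. Z (Inl (Suc (Suc k))) \<omega> ^ 4) + (c N (Inr (Suc k))) ^ 4 * expectation (\<lambda>\<omega>. Z (Inr (Suc k)) \<omega> ^ 4)
            \<le> K / den N ^ 4 * (1 / gap N (Suc k) ^ 4)" if "k < N - 1" for k
        proof -
          have "expectation (\<lambda>\<omega>. B (Suc k) \<omega> ^ 4) / big_root (x N) (real (Suc k)) ^ 4 \<le> 3 * \<alpha>\<^sup>2 + 6 * \<alpha> ^ 3"
            using en.G_moments(4)[OF that] by (simp add: en.G_def power_divide)
          then have "(3 * \<alpha>\<^sup>2 + expectation (\<lambda>\<omega>. B (Suc k) \<omega> ^ 4) / big_root (x N) (real (Suc k)) ^ 4) / (gap N (Suc k) * den N) ^ 4 \<le> K / (gap N (Suc k) * den N) ^ 4"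
            by (intro divide_right_mono) (auto simp: K_def zero_le_even_power)
          then show ?thesis unfolding Z_simps A_moments
            by (simp add: c_def power_mult_distrib power_divide add_divide_distrib mult_ac)
        qed
        then have "(\<Sum>k\<in>S N. (c N k) ^ 4 * expectation (\<lambda>\<omega>. Z k \<omega> ^ 4)) \<le> (\<Sum>k<N - 1. K / den N ^ 4 * (1 / gap N (Suc k) ^ 4))"
          unfolding S_def sum_Plus_image by (intro sum_mono) simp
        also have "\<dots> = K / den N ^ 4 * (\<Sum>k<N - 1. 1 / gap N (Suc k) ^ 4)" by (rule sum_distrib_left[symmetric])
        also have "\<dots> \<le> K / den N ^ 4 * 1"
          using en.sum_inverse_fourth K0 unfolding gap_def by (intro mult_left_mono) (auto simp: zero_le_even_power)
        finally show ?case using nn by simp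
      qed
      show "(\<lambda>N. K / den N ^ 4) \<longlonglongrightarrow> 0"
        by (intro tendsto_divide_0[OF tendsto_const] filterlim_at_top_imp_at_infinity filterlim_pow_at_top den_top) simp
    qed
  qed
  then have T_conv: "weak_conv_m (\<lambda>N. distr M borel (T N)) std_normal_distribution"
    unfolding T_sum[abs_def] .

  have "weak_conv_m (\<lambda>N. distr M borel (Q N)) std_normal_distribution"
  proof (rule weak_conv_m_perturb[OF Tm Qm T_conv isCont_cdf_std_normal])
    fix e :: real assume e: "e > 0"
    \<comment> \<open>Solves \<open>2 * \<alpha> + 4 + 2 * l = e / 2 * den\<close>, so that the
      threshold of \<open>ln_prod_approx_prob\<close> is half of \<open>e\<close> in units of
      \<open>den\<close>; the other half is left for \<open>E / den\<close>.\<close>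
    define l where "l N = (e / 2 * den N - (2 * \<alpha> + 4)) / 2" for N
    have l_top: "filterlim l at_top sequentially"
    proof -
      have "filterlim (\<lambda>N. - (\<alpha> + 2) + e / 4 * den N) at_top sequentially"
        using e by (intro filterlim_tendsto_add_at_top[OF tendsto_const] filterlim_tendsto_pos_mult_at_top[OF tendsto_const _ den_top]) auto
      moreover have "l = (\<lambda>N. - (\<alpha> + 2) + e / 4 * den N)" by (auto simp: l_def fun_eq_iff field_simps)
      ultimately show ?thesis by simp
    qed
    let ?K = "edge_noise.K'' \<alpha>" and ?R = "edge_noise.CR \<alpha>" and ?X = "edge_noise.CX \<alpha>"
    have sp: "filterlim (\<lambda>N. \<sigma> N powr (3/2)) at_top sequentially"
      using sigma_top by (intro filterlim_compose[OF _ sigma_top]) real_asymp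
    show "(\<lambda>N. prob {\<omega> \<in> space M. \<bar>Q N \<omega> - T N \<omega>\<bar> > e}) \<longlonglongrightarrow> 0"
    proof (rule Lim_null_comparison)
      have evE: "\<forall>\<^sub>F N in sequentially. \<bar>E N / den N\<bar> < e / 2"
        using order_tendstoD(2)[OF tendsto_rabs[OF E_lim], of "e / 2"] e by simp
      have ev1: "\<forall>\<^sub>F N in sequentially. 1 < \<sigma> N powr (3/2)"
        using sp by (simp add: filterlim_at_top_dense)
      show "\<forall>\<^sub>F N in sequentially. norm (prob {\<omega> \<in> space M. \<bar>Q N \<omega> - T N \<omega>\<bar> > e}) \<le> 256 * ?K * (1 / \<sigma> N powr (3/2)) + ?R / l N + ?X / (l N)\<^sup>2"
        using ev_good evE ev1 filterlim_at_top_dense[THEN iffD1, OF l_top, rule_format, of 0]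
          filterlim_at_top_dense[THEN iffD1, OF den_top, rule_format, of 0]
      proof eventually_elim
        case (elim N)
        interpret en: edge_noise M \<alpha> Fm A B "x N" "N - 1" by (rule en[OF elim(1)])
        have N: "0 < real N" "N = Suc (N - 1)" using elim(1) by (auto simp: good_def)
        \<comment> \<open>Adding \<open>N / 2 * ln N\<close> undoes the scaling by
          \<open>1 / sqrt N\<close>, so on survival this is the logarithm of the product of the
          \<open>Y k\<close>.\<close>
        let ?U = "\<lambda>\<omega>. ln \<bar>Dt N \<omega>\<bar> + real N / 2 * ln (real N)"
        have gapN: "0 < gap N (N - 1)" unfolding gap_def by (rule en.D_pos) simp
        have xg: "x N / gap N (N - 1) ^ 3 \<le> 1 / \<sigma> N powr (3/2)" by (rule terms(4)[OF elim(1)])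
        have "1 / y \<le> 1" if "1 < y" for y :: real using that by simp
        from this[OF elim(3)] have "1 / \<sigma> N powr (3/2) \<le> 1" .
        with xg have "x N / gap N (N - 1) ^ 3 \<le> 1" by (rule order.trans)
        then have xle: "x N \<le> gap N (N - 1) ^ 3" using gapN by (simp add: divide_le_eq)
        have U: "?U \<omega> = ln (\<Prod>k\<le>N - 1. en.Y k \<omega>)" if I: "en.I (N - 1) \<omega> = 1" for \<omega>
        proof -
          have d: "\<bar>det (tridiag N (\<lambda>i. a i \<omega> - x N) (\<lambda>i. b i \<omega>))\<bar> = (\<Prod>k\<le>N - 1. en.Y k \<omega>)"
            using en.det_eq_prod[OF I order_refl, of "\<lambda>i. a i \<omega>" "\<lambda>i. b i \<omega>"] N(2) by (simp add: A_def B_def)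
          have pos: "0 < (\<Prod>k\<le>N - 1. en.Y k \<omega>)" using en.Y_bounds[OF I] by (intro prod_pos) (auto simp del: en.Y.simps)
          have "\<bar>Dt N \<omega>\<bar> = (\<Prod>k\<le>N - 1. en.Y k \<omega>) / sqrt (real N) ^ N"
            unfolding Dt abs_divide d using N by simp
          then have "ln \<bar>Dt N \<omega>\<bar> = ln (\<Prod>k\<le>N - 1. en.Y k \<omega>) - real N * ln (sqrt (real N))"
            using pos N by (simp add: ln_divide_pos ln_realpow del: en.Y.simps)
          then show ?thesis using N by (simp add: ln_sqrt)
        qed
        have Tz: "T N \<omega> = - (\<Sum>k<N - 1. en.\<zeta> k \<omega>) / den N" for \<omega>
          by (simp add: T_def en.\<zeta>_def en.G_def gap_def)
        have QT: "Q N \<omega> - T N \<omega> = (?U \<omega> - en.main + (\<Sum>k<N - 1. en.\<zeta> k \<omega>)) / den N + E N / den N" for \<omega>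
          unfolding Q_def Tz E_def by (simp add: add_divide_distrib[symmetric] diff_divide_distrib[symmetric])
        have "{\<omega> \<in> space M. \<bar>Q N \<omega> - T N \<omega>\<bar> > e} \<subseteq> {\<omega> \<in> space M. 2 * \<alpha> + 4 + 2 * l N < \<bar>?U \<omega> - en.main + (\<Sum>k<N - 1. en.\<zeta> k \<omega>)\<bar>}"
        proof (intro subsetI CollectI conjI)
          fix \<omega> assume a: "\<omega> \<in> {\<omega> \<in> space M. \<bar>Q N \<omega> - T N \<omega>\<bar> > e}"
          then show "\<omega> \<in> space M" by simp
          have "e < \<bar>(?U \<omega> - en.main + (\<Sum>k<N - 1. en.\<zeta> k \<omega>)) / den N + E N / den N\<bar>" using a unfolding QT by simp
          then have "e / 2 < \<bar>(?U \<omega> - en.main + (\<Sum>k<N - 1. en.\<zeta> k \<omega>)) / den N\<bar>" using elim(2) by linarith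
          then have "e / 2 * den N < \<bar>?U \<omega> - en.main + (\<Sum>k<N - 1. en.\<zeta> k \<omega>)\<bar>" using elim(5) by (simp add: abs_divide less_divide_eq)
          moreover have "2 * \<alpha> + 4 + 2 * l N = e / 2 * den N" by (simp add: l_def field_simps)
          ultimately show "2 * \<alpha> + 4 + 2 * l N < \<bar>?U \<omega> - en.main + (\<Sum>k<N - 1. en.\<zeta> k \<omega>)\<bar>" by (simp only:)
        qed
        then have "prob {\<omega> \<in> space M. \<bar>Q N \<omega> - T N \<omega>\<bar> > e} \<le> prob {\<omega> \<in> space M. 2 * \<alpha> + 4 + 2 * l N < \<bar>?U \<omega> - en.main + (\<Sum>k<N - 1. en.\<zeta> k \<omega>)\<bar>}"
          by (intro finite_measure_mono) auto
        also have "\<dots> \<le> 256 * ?K * (x N / gap N (N - 1) ^ 3) + ?R / l N + ?X / (l N)\<^sup>2"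
          unfolding gap_def using xle U elim(4) by (intro en.ln_prod_approx_prob) (auto simp: gap_def)
        also have "\<dots> \<le> 256 * ?K * (1 / \<sigma> N powr (3/2)) + ?R / l N + ?X / (l N)\<^sup>2"
          using xg en.K''_pos by (intro add_right_mono mult_left_mono) auto
        finally show ?case by simp
      qed
      have "(\<lambda>N. 256 * ?K * (1 / \<sigma> N powr (3/2)) + ?R / l N + ?X / (l N)\<^sup>2) \<longlonglongrightarrow> 256 * ?K * 0 + 0 + 0"
        by (intro tendsto_add tendsto_mult tendsto_const tendsto_divide_0[OF tendsto_const] filterlim_at_top_imp_at_infinity
            sp l_top filterlim_pow_at_top) simp
      then show "(\<lambda>N. 256 * ?K * (1 / \<sigma> N powr (3/2)) + ?R / l N + ?X / (l N)\<^sup>2) \<longlonglongrightarrow> 0" by simp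
    qed
  qed
  then show ?thesis
    unfolding Let_def Q_def[abs_def] den_def W_def Dt_def \<theta>_def s_def .
qed

end
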